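(* Let $\ \widehat{}\ $ denote the Pontryagin duality functor. (a) For $\ \widehat{}:\mathbf{AG}\to\mathbf{CAG}$, the pair $(\mathbf h_{\mathfrak{sub}^\star},\mathbf h_{\mathfrak{sub}})$ satisfies $SBT_{\;\widehat{}}$. In particular, the pair $(\mathrm{ent}^\star,\mathrm{ent})$ satisfies $BT_{\;\widehat{}}$. (b) For $\ \widehat{}:\mathbf{CAG}\to\mathbf{AG}$, the pair $(\mathbf h_{\mathfrak{sub}},\mathbf h_{\mathfrak{sub}^\star})$ satisfies $SBT_{\;\widehat{}}$. In particular, the pair $(\mathrm{ent},\mathrm{ent}^\star)$ satisfies $BT_{\;\widehat{}}$.
   Context: $\mathbf{AG}$ is the category of (discrete) abelian groups and homomorphisms; $\mathbf{CAG}$ is the category of compact (Hausdorff) abelian groups and continuous homomorphisms. On $\mathbf{CAG}$ the functor $\mathfrak{sub}$ and the entropy $\mathrm{ent}$ are applied to the underlying abstract groups and homomorphisms. A normed semigroup $(S,v)$ is a semigroup $S$ with a function $v:S\to\mathbb R_{\ge0}$. $\mathfrak S^*$ is the category of normed semigroups and all semigroup homomorphisms; $\mathfrak S$ has the same objects and only contractive homomorphisms ($v'(\phi(x))\le v(x)$). For an endomorphism $\phi$ of $(S,v)$, $T_n(\phi,x)=x\cdot\phi(x)\cdots\phi^{n-1}(x)$ and $h_{\mathfrak S}(\phi)=\sup_{x\in S}\limsup_{n\to\infty}\frac{v(T_n(\phi,x))}{n}$. For a functor $F$ to $\mathfrak S$, $\mathbf h_F(\phi)=h_{\mathfrak S}(F(\phi))$.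 For functors $\varepsilon:\mathfrak X_1\to\mathfrak X_2$, $F_i:\mathfrak X_i\to\mathfrak S$ such that $F_1$ and $F_2\varepsilon$ have the same variance, $(\mathbf h_{F_1},\mathbf h_{F_2})$ satisfies $SBT_\varepsilon$ if there is a natural transformation $\eta:F_1\to F_2\varepsilon$ (in $\mathfrak S^*$) such that each $\eta_X$ is a norm-preserving semigroup isomorphism. A pair of entropies $(h_1,h_2)$ satisfies $BT_\varepsilon$ if $h_2(\varepsilon(\phi))=h_1(\phi)$ for every endomorphism $\phi$ in $\mathfrak X_1$. Functor $\mathfrak{sub}$ (covariant): $\mathfrak{sub}(G)=\mathcal F(G)$ is the semilattice of all finite subgroups of $G$ under $+$ with norm $\log|F|$, $\mathfrak{sub}(\phi):F\mapsto\phi(F)$. Functor $\mathfrak{sub}^\star$ (contravariant): $\mathfrak{sub}^\star(G)=\mathcal C(G)$ is the semilattice of all finite-index subgroups of $G$ under $\cap$ with norm $\log[G:N]$, $\mathfrak{sub}^\star(\phi):N\mapsto\phi^{-1}(N)$. $\mathrm{ent}(\phi)=\sup\{\lim_n\frac1n\log|F+\phi(F)+\dots+\phi^{n-1}(F)|:F\in\mathcal F(G)\}$ and $\mathrm{ent}^\star(\phi)=\sup\{\lim_n\frac1n\log[G:N\cap\phi^{-1}(N)\cap\dots\cap\phi^{-n+1}(N)]:N\in\mathcal C(G)\}$. *)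

theory Defs
  imports "HOL-Analysis.Analysis" "HOL-Algebra.Coset"
begin

section \<open>Categories and functors\<close>

text \<open>
  The categories below are concrete. Morphisms are functions that are extensional on the carrier of
  their source, so that HOL equality is equality of morphisms; composition needs the source of the
  first morphism to know where to restrict, and functors act on morphisms with given source and
  target. The objects of a category live on one fixed but arbitrary carrier type, which plays the
  role of a universe.
\<close>

record ('o, 'm) cat =
  Obj :: "'o set"
  Hom :: "'o \<Rightarrow> 'o \<Rightarrow> 'm set"
  Id :: "'o \<Rightarrow> 'm"
  Comp :: "'o \<Rightarrow> 'm \<Rightarrow> 'm \<Rightarrow> 'm"  \<comment> \<open>\<open>Comp X g f\<close> is \<open>g \<circ> f\<close> for \<open>f\<close> with source \<open>X\<close>\<close>

definition is_category :: "('o, 'm) cat \<Rightarrow> bool" where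
  "is_category \<C> \<longleftrightarrow>
     (\<forall>X\<in>Obj \<C>. Id \<C> X \<in> Hom \<C> X X) \<and>
     (\<forall>X\<in>Obj \<C>. \<forall>Y\<in>Obj \<C>. \<forall>Z\<in>Obj \<C>. \<forall>f\<in>Hom \<C> X Y. \<forall>g\<in>Hom \<C> Y Z.
        Comp \<C> X g f \<in> Hom \<C> X Z) \<and>
     (\<forall>X\<in>Obj \<C>. \<forall>Y\<in>Obj \<C>. \<forall>f\<in>Hom \<C> X Y.
        Comp \<C> X f (Id \<C> X) = f \<and> Comp \<C> X (Id \<C> Y) f = f) \<and>
     (\<forall>W\<in>Obj \<C>. \<forall>X\<in>Obj \<C>. \<forall>Y\<in>Obj \<C>. \<forall>Z\<in>Obj \<C>.
        \<forall>f\<in>Hom \<C> W X. \<forall>g\<in>Hom \<C> X Y. \<forall>h\<in>Hom \<C> Y Z.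
        Comp \<C> W h (Comp \<C> W g f) = Comp \<C> W (Comp \<C> X h g) f)"

record ('o, 'm, 'p, 'n) functor_data =
  omap :: "'o \<Rightarrow> 'p"
  mmap :: "'o \<Rightarrow> 'o \<Rightarrow> 'm \<Rightarrow> 'n"
  contravariant :: bool

definition is_functor ::
    "('o, 'm) cat \<Rightarrow> ('p, 'n) cat \<Rightarrow> ('o, 'm, 'p, 'n) functor_data \<Rightarrow> bool" where
  "is_functor \<C> \<D> F \<longleftrightarrow>
     is_category \<C> \<and> is_category \<D> \<and>
     (\<forall>X\<in>Obj \<C>. omap F X \<in> Obj \<D>) \<and>
     (\<forall>X\<in>Obj \<C>. mmap F X X (Id \<C> X) = Id \<D> (omap F X)) \<and>
     (\<forall>X\<in>Obj \<C>. \<forall>Y\<in>Obj \<C>. \<forall>f\<in>Hom \<C> X Y.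
        mmap F X Y f \<in> (if contravariant F then Hom \<D> (omap F Y) (omap F X)
                        else Hom \<D> (omap F X) (omap F Y))) \<and>
     (\<forall>X\<in>Obj \<C>. \<forall>Y\<in>Obj \<C>. \<forall>Z\<in>Obj \<C>. \<forall>f\<in>Hom \<C> X Y. \<forall>g\<in>Hom \<C> Y Z.
        mmap F X Z (Comp \<C> X g f) =
          (if contravariant F then Comp \<D> (omap F Z) (mmap F X Y f) (mmap F Y Z g)
           else Comp \<D> (omap F X) (mmap F Y Z g) (mmap F X Y f)))"

definition functor_comp ::
    "('p, 'n, 'q, 'k) functor_data \<Rightarrow> ('o, 'm, 'p, 'n) functor_data \<Rightarrow>
     ('o, 'm, 'q, 'k) functor_data" where
  "functor_comp F E =
     \<lparr> omap = (\<lambda>X. omap F (omap E X)),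
       mmap = (\<lambda>X Y f. if contravariant E then mmap F (omap E Y) (omap E X) (mmap E X Y f)
                        else mmap F (omap E X) (omap E Y) (mmap E X Y f)),
       contravariant = (contravariant F \<noteq> contravariant E) \<rparr>"


section \<open>Normed semigroups\<close>

record 's nsemigroup = "'s partial_object" +
  op :: "'s \<Rightarrow> 's \<Rightarrow> 's"
  nrm :: "'s \<Rightarrow> real"

definition normed_semigroup :: "'s nsemigroup \<Rightarrow> bool" where
  "normed_semigroup S \<longleftrightarrow>
     (\<forall>x\<in>carrier S. \<forall>y\<in>carrier S. op S x y \<in> carrier S) \<and>
     (\<forall>x\<in>carrier S. \<forall>y\<in>carrier S. \<forall>z\<in>carrier S.
        op S (op S x y) z = op S x (op S y z)) \<and>
     (\<forall>x\<in>carrier S. nrm S x \<ge> 0)"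

text \<open>The morphisms of \<open>\<SS>\<^sup>*\<close>; source and target may live on different types.\<close>

definition semigroup_hom :: "'s nsemigroup \<Rightarrow> 't nsemigroup \<Rightarrow> ('s \<Rightarrow> 't) set" where
  "semigroup_hom S T =
     {f \<in> carrier S \<rightarrow>\<^sub>E carrier T.
        \<forall>x\<in>carrier S. \<forall>y\<in>carrier S. f (op S x y) = op T (f x) (f y)}"

text \<open>The category \<open>\<SS>\<close>, with contractive homomorphisms only.\<close>

definition NSG :: "('s nsemigroup, 's \<Rightarrow> 's) cat" where
  "NSG =
     \<lparr> Obj = {S. normed_semigroup S},
       Hom = (\<lambda>S T. {f \<in> semigroup_hom S T. \<forall>x\<in>carrier S. nrm T (f x) \<le> nrm S x}),
       Id = (\<lambda>S. restrict id (carrier S)),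
       Comp = (\<lambda>S g f. compose (carrier S) g f) \<rparr>"

definition norm_preserving_iso :: "'s nsemigroup \<Rightarrow> 't nsemigroup \<Rightarrow> ('s \<Rightarrow> 't) \<Rightarrow> bool" where
  "norm_preserving_iso S T f \<longleftrightarrow>
     f \<in> semigroup_hom S T \<and> bij_betw f (carrier S) (carrier T) \<and>
     (\<forall>x\<in>carrier S. nrm T (f x) = nrm S x)"

text \<open>Natural transformations in \<open>\<SS>\<^sup>*\<close> between two functors of the same variance; they
  may take values in normed semigroups on different types.\<close>

definition natural_transformation ::
    "('o, 'm) cat \<Rightarrow> ('o, 'm, 's nsemigroup, 's \<Rightarrow> 's) functor_data \<Rightarrow>
     ('o, 'm, 't nsemigroup, 't \<Rightarrow> 't) functor_data \<Rightarrow> ('o \<Rightarrow> 's \<Rightarrow> 't) \<Rightarrow> bool" where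
  "natural_transformation \<C> F G \<eta> \<longleftrightarrow>
     (\<forall>X\<in>Obj \<C>. \<eta> X \<in> semigroup_hom (omap F X) (omap G X)) \<and>
     (\<forall>X\<in>Obj \<C>. \<forall>Y\<in>Obj \<C>. \<forall>f\<in>Hom \<C> X Y.
        if contravariant F
        then compose (carrier (omap F Y)) (\<eta> X) (mmap F X Y f)
               = compose (carrier (omap F Y)) (mmap G X Y f) (\<eta> Y)
        else compose (carrier (omap F X)) (\<eta> Y) (mmap F X Y f)
               = compose (carrier (omap F X)) (mmap G X Y f) (\<eta> X))"

text \<open>For the pair of entropies \<open>(\<^bold>h\<^bsub>F1\<^esub>, \<^bold>h\<^bsub>F2\<^esub>)\<close>, \<open>SBT\<^bsub>E\<^esub>\<close> is by
  definition a property of the functors \<open>F1\<close>, \<open>F2\<close> and \<open>E\<close>.\<close>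

definition SBT ::
    "('o, 'm) cat \<Rightarrow> ('p, 'n) cat \<Rightarrow> ('o, 'm, 'p, 'n) functor_data \<Rightarrow>
     ('o, 'm, 's nsemigroup, 's \<Rightarrow> 's) functor_data \<Rightarrow>
     ('p, 'n, 't nsemigroup, 't \<Rightarrow> 't) functor_data \<Rightarrow> bool" where
  "SBT \<X>1 \<X>2 E F1 F2 \<longleftrightarrow>
     is_functor \<X>1 \<X>2 E \<and> is_functor \<X>1 NSG F1 \<and> is_functor \<X>2 NSG F2 \<and>
     contravariant F1 = contravariant (functor_comp F2 E) \<and>
     (\<exists>\<eta>. natural_transformation \<X>1 F1 (functor_comp F2 E) \<eta> \<and>
          (\<forall>X\<in>Obj \<X>1. norm_preserving_iso (omap F1 X) (omap (functor_comp F2 E) X) (\<eta> X)))"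

definition BT ::
    "('o, 'm) cat \<Rightarrow> ('o, 'm, 'p, 'n) functor_data \<Rightarrow>
     ('o \<Rightarrow> 'm \<Rightarrow> ereal) \<Rightarrow> ('p \<Rightarrow> 'n \<Rightarrow> ereal) \<Rightarrow> bool" where
  "BT \<X>1 E h1 h2 \<longleftrightarrow>
     (\<forall>X\<in>Obj \<X>1. \<forall>\<phi>\<in>Hom \<X>1 X X. h2 (omap E X) (mmap E X X \<phi>) = h1 X \<phi>)"


section \<open>Discrete and compact abelian groups, Pontryagin duality\<close>

record 'a top_group = "'a monoid" +
  gtop :: "'a topology"

definition topological_abelian_group :: "'a top_group \<Rightarrow> bool" where
  "topological_abelian_group G \<longleftrightarrow>
     comm_group G \<and> topspace (gtop G) = carrier G \<and>
     continuous_map (prod_topology (gtop G) (gtop G)) (gtop G) (\<lambda>(x, y). x \<otimes>\<^bsub>G\<^esub> y) \<and>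
     continuous_map (gtop G) (gtop G) (\<lambda>x. inv\<^bsub>G\<^esub> x)"

text \<open>Abelian groups are regarded as topological groups with the discrete topology.\<close>

definition AG :: "('a top_group, 'a \<Rightarrow> 'a) cat" where
  "AG =
     \<lparr> Obj = {G. comm_group G \<and> gtop G = discrete_topology (carrier G)},
       Hom = (\<lambda>G H. hom G H \<inter> extensional (carrier G)),
       Id = (\<lambda>G. restrict id (carrier G)),
       Comp = (\<lambda>G g f. compose (carrier G) g f) \<rparr>"

definition CAG :: "('a top_group, 'a \<Rightarrow> 'a) cat" where
  "CAG =
     \<lparr> Obj = {G. topological_abelian_group G \<and> compact_space (gtop G) \<and> Hausdorff_space (gtop G)},
       Hom = (\<lambda>G H. {f \<in> hom G H \<inter> extensional (carrier G). continuous_map (gtop G) (gtop H) f}),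
       Id = (\<lambda>G. restrict id (carrier G)),
       Comp = (\<lambda>G g f. compose (carrier G) g f) \<rparr>"

definition circle_group :: "complex top_group" where
  "circle_group =
     \<lparr> carrier = sphere 0 1, mult = (*), one = 1,
       gtop = subtopology euclidean (sphere 0 1) \<rparr>"

definition characters :: "'a top_group \<Rightarrow> ('a \<Rightarrow> complex) set" where
  "characters G =
     {\<xi> \<in> hom G circle_group \<inter> extensional (carrier G).
        continuous_map (gtop G) (gtop circle_group) \<xi>}"

definition compact_open_topology :: "'a top_group \<Rightarrow> ('a \<Rightarrow> complex) topology" where
  "compact_open_topology G =
     topology_generated_by
       {{\<xi> \<in> characters G. \<xi> ` K \<subseteq> U} | K U.
          compactin (gtop G) K \<and> openin (gtop circle_group) U}"

definition dual_group :: "'a top_group \<Rightarrow> ('a \<Rightarrow> complex) top_group" where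
  "dual_group G =
     \<lparr> carrier = characters G,
       mult = (\<lambda>\<xi> \<psi>. \<lambda>x\<in>carrier G. \<xi> x * \<psi> x),
       one = (\<lambda>x\<in>carrier G. 1),
       gtop = compact_open_topology G \<rparr>"

definition dual ::
    "('a top_group, 'a \<Rightarrow> 'a,
      ('a \<Rightarrow> complex) top_group, ('a \<Rightarrow> complex) \<Rightarrow> ('a \<Rightarrow> complex)) functor_data" where
  "dual =
     \<lparr> omap = dual_group,
       mmap = (\<lambda>G H \<phi>. \<lambda>\<xi>\<in>carrier (dual_group H). compose (carrier G) \<xi> \<phi>),
       contravariant = True \<rparr>"


section \<open>The functors of finite and of finite-index subgroups, and the entropies\<close>

definition finite_subgroups :: "('a, 'b) monoid_scheme \<Rightarrow> 'a set set" where
  "finite_subgroups G = {F. subgroup F G \<and> finite F}"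

definition finite_index_subgroups :: "('a, 'b) monoid_scheme \<Rightarrow> 'a set set" where
  "finite_index_subgroups G = {N. subgroup N G \<and> finite (rcosets\<^bsub>G\<^esub> N)}"

definition group_index :: "('a, 'b) monoid_scheme \<Rightarrow> 'a set \<Rightarrow> nat" where
  "group_index G N = card (rcosets\<^bsub>G\<^esub> N)"

definition sub ::
    "('a top_group, 'a \<Rightarrow> 'a, 'a set nsemigroup, 'a set \<Rightarrow> 'a set) functor_data" where
  "sub =
     \<lparr> omap = (\<lambda>G. \<lparr> carrier = finite_subgroups G,
                      op = (\<lambda>F F'. F <#>\<^bsub>G\<^esub> F'),
                      nrm = (\<lambda>F. ln (real (card F))) \<rparr>),
       mmap = (\<lambda>G H \<phi>. \<lambda>F\<in>finite_subgroups G. \<phi> ` F),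
       contravariant = False \<rparr>"

definition sub_star ::
    "('a top_group, 'a \<Rightarrow> 'a, 'a set nsemigroup, 'a set \<Rightarrow> 'a set) functor_data" where
  "sub_star =
     \<lparr> omap = (\<lambda>G. \<lparr> carrier = finite_index_subgroups G,
                      op = (\<lambda>N N'. N \<inter> N'),
                      nrm = (\<lambda>N. ln (real (group_index G N))) \<rparr>),
       mmap = (\<lambda>G H \<phi>. \<lambda>N\<in>finite_index_subgroups H. {x \<in> carrier G. \<phi> x \<in> N}),
       contravariant = True \<rparr>"

text \<open>\<open>F + \<phi>(F) + \<dots> + \<phi>\<^sup>n\<^sup>-\<^sup>1(F)\<close>, in multiplicative notation; the value at 0 is irrelevant.\<close>

primrec trajectory ::
    "('a, 'b) monoid_scheme \<Rightarrow> ('a \<Rightarrow> 'a) \<Rightarrow> 'a set \<Rightarrow> nat \<Rightarrow> 'a set" where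
  "trajectory G \<phi> F 0 = {\<one>\<^bsub>G\<^esub>}"
| "trajectory G \<phi> F (Suc n) = trajectory G \<phi> F n <#>\<^bsub>G\<^esub> ((\<phi> ^^ n) ` F)"

definition cotrajectory ::
    "('a, 'b) monoid_scheme \<Rightarrow> ('a \<Rightarrow> 'a) \<Rightarrow> 'a set \<Rightarrow> nat \<Rightarrow> 'a set" where
  "cotrajectory G \<phi> N n = {x \<in> carrier G. \<forall>i<n. (\<phi> ^^ i) x \<in> N}"

definition ent :: "('a, 'b) monoid_scheme \<Rightarrow> ('a \<Rightarrow> 'a) \<Rightarrow> ereal" where
  "ent G \<phi> =
     (SUP F\<in>finite_subgroups G.
        ereal (lim (\<lambda>n. ln (real (card (trajectory G \<phi> F n))) / real n)))"

definition ent_star :: "('a, 'b) monoid_scheme \<Rightarrow> ('a \<Rightarrow> 'a) \<Rightarrow> ereal" where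
  "ent_star G \<phi> =
     (SUP N\<in>finite_index_subgroups G.
        ereal (lim (\<lambda>n. ln (real (group_index G (cotrajectory G \<phi> N n))) / real n)))"

end

theory Submission
  imports Defs
begin

text \<open>
  The bridge is \<open>N \<mapsto> N\<^sup>\<bottom>\<close>, and everything follows from two properties of a pairing of abelian groups
  \<open>G\<close> and \<open>X\<close> into the circle: \<open>G\<close> separates the points of \<open>X\<close>, and \<open>N\<^sup>\<bottom>\<^sup>\<bottom> = N\<close> for \<open>N \<le> G\<close> of finite
  index. Orthogonality of characters gives \<open>|N\<^sup>\<bottom>| \<le> [G:N]\<close> and \<open>[G:F\<^sup>\<bottom>] \<le> |F|\<close>, and then counting
  forces \<open>F\<^sup>\<bottom>\<^sup>\<bottom> = F\<close> and equality of the norms.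

  The two properties rest on Bohr's theorem that an almost periodic function \<open>f\<close> on a discrete abelian
  group with \<open>f a \<noteq> f 1\<close> yields a character \<open>\<xi>\<close> with \<open>\<xi> a \<noteq> 1\<close> which is controlled by \<open>f\<close>. This
  covers continuous functions on compact groups and indicator functions of finite-index subgroups at
  once, without Haar measure: an invariant mean on bounded functions, which exists by compactness,
  suffices. For \<open>\<parallel>v\<parallel> \<le> 1\<close> let \<open>\<phi>\<^sub>v\<close> be the autocorrelation of the convolution of \<open>f - f(a \<cdot>)\<close> with
  \<open>v\<close>. The functions \<open>\<phi>\<^sub>v\<close> are equicontinuous with respect to \<open>f\<close>, so some limit \<open>\<phi>\<close> of them
  maximizes the mean of \<open>|\<phi>|\<^sup>2\<close>; replacing \<open>v\<close> by \<open>(v \<plusminus> z v(b \<cdot>))/2\<close> writes \<open>\<phi>\<close> as a convex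
  combination, and strict convexity makes \<open>\<phi>\<close> an eigenvector of all translations, that is, a multiple
  of a character.
\<close>

section \<open>Invariant means on abelian groups\<close>

text \<open>Fourier coefficients explain the variational problem. If \<open>v\<close> has
  coefficients c(\<chi>), the autocorrelation \<phi> has, up to conjugating the index, coefficients
  w(\<chi>) |c(\<chi>)|^2 with fixed weights w \<ge> 0, so the mean of |\<phi>|^2 is the sum of w^2
  |c|^4. Among all c with sum of |c|^2 at most 1, this convex quantity is largest at a single
  character. The obstacle is that a mean gives only a seminorm on an incomplete space, so a
  maximizing sequence of \<open>v\<close> has no limit to take. What does have pointwise limits is
  the pair of \<phi> and the autocorrelation s of \<open>v\<close>. The function s remembers enough
  of \<open>v\<close> to express the norm constraint for the averaged competitors, and at a
  maximizer s is the conjugate of the desired character. For a compact group, a subgroup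
  \<open>N\<close> of the dual must be recovered from its common kernel. No mean on the quotient by
  that kernel is constructed: powers of a peak function built from finitely many members of
  \<open>N\<close> stay orthogonal to every character outside \<open>N\<close> and concentrate where
  those members are close to 1.\<close>

definition bounded_fun :: "('a, 'b) monoid_scheme \<Rightarrow> ('a \<Rightarrow> complex) \<Rightarrow> bool" where
  "bounded_fun G f \<longleftrightarrow> (\<exists>B. \<forall>x\<in>carrier G. norm (f x) \<le> B)"

text \<open>The value \<open>0\<close> at unbounded functions makes means vanish there, so that no carrier type of
  bounded functions is needed.\<close>

definition sup_norm :: "('a, 'b) monoid_scheme \<Rightarrow> ('a \<Rightarrow> complex) \<Rightarrow> real" where
  "sup_norm G f = (if bounded_fun G f then SUP x\<in>carrier G. norm (f x) else 0)"

lemma bounded_funI: "(\<And>x. x \<in> carrier G \<Longrightarrow> norm (f x) \<le> B) \<Longrightarrow> bounded_fun G f"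
  by (auto simp: bounded_fun_def)

lemma bounded_fun_const [simp, intro]: "bounded_fun G (\<lambda>x. c)"
  by (rule bounded_funI[where B = "norm c"]) simp

lemma bounded_fun_add [simp, intro]:
  assumes "bounded_fun G f" "bounded_fun G g" shows "bounded_fun G (\<lambda>x. f x + g x)"
proof -
  obtain A B where "\<forall>x\<in>carrier G. norm (f x) \<le> A" "\<forall>x\<in>carrier G. norm (g x) \<le> B"
    using assms by (auto simp: bounded_fun_def)
  then show ?thesis
    by (intro bounded_funI[where B = "A + B"]) (meson add_mono norm_triangle_le)
qed

lemma bounded_fun_mult [simp, intro]:
  assumes "bounded_fun G f" "bounded_fun G g" shows "bounded_fun G (\<lambda>x. f x * g x)"
proof -
  obtain A B where AB: "\<forall>x\<in>carrier G. norm (f x) \<le> A" "\<forall>x\<in>carrier G. norm (g x) \<le> B"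
    using assms by (auto simp: bounded_fun_def)
  show ?thesis
  proof (rule bounded_funI)
    fix x assume "x \<in> carrier G"
    with AB have "norm (f x) \<le> A" "norm (g x) \<le> B" by auto
    then show "norm (f x * g x) \<le> A * B"
      unfolding norm_mult by (intro mult_mono) (auto intro: order_trans[OF norm_ge_zero])
  qed
qed

lemma bounded_fun_cnj [simp, intro]: "bounded_fun G f \<Longrightarrow> bounded_fun G (\<lambda>x. cnj (f x))"
  by (simp add: bounded_fun_def)

lemma bounded_fun_uminus [simp, intro]: "bounded_fun G f \<Longrightarrow> bounded_fun G (\<lambda>x. - f x)"
  by (simp add: bounded_fun_def)

lemma bounded_fun_diff [simp, intro]:
  assumes "bounded_fun G f" "bounded_fun G g" shows "bounded_fun G (\<lambda>x. f x - g x)"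
  using bounded_fun_add[OF assms(1) bounded_fun_uminus[OF assms(2)]] by simp

lemma bounded_fun_divide [simp, intro]: "bounded_fun G f \<Longrightarrow> bounded_fun G (\<lambda>x. f x / c)"
  unfolding divide_inverse by (rule bounded_fun_mult) auto

lemma bounded_fun_sum [simp, intro]:
  "(\<And>i. i \<in> I \<Longrightarrow> bounded_fun G (f i)) \<Longrightarrow> bounded_fun G (\<lambda>x. \<Sum>i\<in>I. f i x)"
  by (induction I rule: infinite_finite_induct) auto

lemma (in group) bounded_fun_translate:
  "bounded_fun G f \<Longrightarrow> a \<in> carrier G \<Longrightarrow> bounded_fun G (\<lambda>x. f (a \<otimes> x))"
  unfolding bounded_fun_def by (meson m_closed)

lemma norm_le_sup_norm:
  assumes "bounded_fun G f" "x \<in> carrier G" shows "norm (f x) \<le> sup_norm G f"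
proof -
  have "bdd_above ((\<lambda>x. norm (f x)) ` carrier G)"
    using assms(1) by (auto simp: bounded_fun_def bdd_above_def)
  then show ?thesis using assms cSUP_upper[of x "carrier G" "\<lambda>x. norm (f x)"]
    by (simp add: sup_norm_def)
qed

lemma (in group) sup_norm_le:
  assumes "\<And>x. x \<in> carrier G \<Longrightarrow> norm (f x) \<le> B" shows "sup_norm G f \<le> B"
  using assms bounded_funI[of G f B] by (auto simp: sup_norm_def intro!: cSUP_least)

text \<open>The parameter \<open>S\<close> collects the translations under which invariance is
  already secured, so that invariance can be gained one element at a time. The norm bound is imposed
  on every function and forces the value \<open>0\<close> at unbounded ones; the algebraic laws
  concern bounded ones.\<close>

definition means :: "('a, 'b) monoid_scheme \<Rightarrow> 'a set \<Rightarrow> (('a \<Rightarrow> complex) \<Rightarrow> complex) set" where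
  "means G S =
     {M. (\<forall>f. norm (M f) \<le> sup_norm G f) \<and> M (\<lambda>x. 1) = 1 \<and>
         (\<forall>f g. bounded_fun G f \<longrightarrow> bounded_fun G g \<longrightarrow> M (\<lambda>x. f x + g x) = M f + M g) \<and>
         (\<forall>c f. bounded_fun G f \<longrightarrow> M (\<lambda>x. c * f x) = c * M f) \<and>
         (\<forall>f. bounded_fun G f \<longrightarrow> M (\<lambda>x. cnj (f x)) = cnj (M f)) \<and>
         (\<forall>a\<in>S. \<forall>f. bounded_fun G f \<longrightarrow> M (\<lambda>x. f (mult G a x)) = M f)}"

text \<open>Tychonoff: a mean is a point of a product of closed discs indexed by all functions, and
  each law involves finitely many coordinates, so it cuts out a closed set.\<close>

lemma compact_means: "compact (means G S)"
proof -
  define P where "P = Pi\<^sub>E UNIV (\<lambda>f. cball (0::complex) (sup_norm G f))"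
  have P: "compact P"
    using compactin_PiE[of "\<lambda>_. euclidean" UNIV "\<lambda>f. cball (0::complex) (sup_norm G f)"]
    by (simp add: P_def euclidean_product_topology)
  have "closed {M. M (\<lambda>x. 1) = 1 \<and>
         (\<forall>f g. bounded_fun G f \<longrightarrow> bounded_fun G g \<longrightarrow> M (\<lambda>x. f x + g x) = M f + M g) \<and>
         (\<forall>c f. bounded_fun G f \<longrightarrow> M (\<lambda>x. c * f x) = c * M f) \<and>
         (\<forall>f. bounded_fun G f \<longrightarrow> M (\<lambda>x. cnj (f x)) = cnj (M f)) \<and>
         (\<forall>a. a \<in> S \<longrightarrow> (\<forall>f. bounded_fun G f \<longrightarrow> M (\<lambda>x. f (mult G a x)) = M f))}"
    (is "closed ?C")
    by (intro closed_Collect_conj closed_Collect_all closed_Collect_imp open_Collect_const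
        closed_Collect_eq[OF continuous_on_product_coordinates continuous_on_const]
        closed_Collect_eq[OF continuous_on_product_coordinates
          continuous_on_add[OF continuous_on_product_coordinates continuous_on_product_coordinates]]
        closed_Collect_eq[OF continuous_on_product_coordinates
          continuous_on_mult_left[OF continuous_on_product_coordinates]]
        closed_Collect_eq[OF continuous_on_product_coordinates
          continuous_on_cnj[OF continuous_on_product_coordinates]]
        closed_Collect_eq[OF continuous_on_product_coordinates continuous_on_product_coordinates])
  moreover have "P = {M. \<forall>f. norm (M f) \<le> sup_norm G f}"
    by (simp add: P_def PiE_iff set_eq_iff)
  then have "means G S = P \<inter> ?C"
    by (simp add: means_def Collect_conj_eq Ball_def)
  ultimately show ?thesis using P by (simp add: compact_Int_closed)
qed

lemma mean_norm_le_sup_norm: "M \<in> means G S \<Longrightarrow> norm (M f) \<le> sup_norm G f"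
  by (simp only: means_def mem_Collect_eq)

lemma mean_one: "M \<in> means G S \<Longrightarrow> M (\<lambda>x. 1) = 1"
  by (simp only: means_def mem_Collect_eq)

lemma mean_add:
  "M \<in> means G S \<Longrightarrow> bounded_fun G f \<Longrightarrow> bounded_fun G g \<Longrightarrow> M (\<lambda>x. f x + g x) = M f + M g"
  by (simp only: means_def mem_Collect_eq)

lemma mean_mult_left: "M \<in> means G S \<Longrightarrow> bounded_fun G f \<Longrightarrow> M (\<lambda>x. c * f x) = c * M f"
  by (simp only: means_def mem_Collect_eq)

lemma mean_cnj: "M \<in> means G S \<Longrightarrow> bounded_fun G f \<Longrightarrow> M (\<lambda>x. cnj (f x)) = cnj (M f)"
  by (simp only: means_def mem_Collect_eq)

lemma mean_translate:
  "M \<in> means G S \<Longrightarrow> a \<in> S \<Longrightarrow> bounded_fun G f \<Longrightarrow> M (\<lambda>x. f (mult G a x)) = M f"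
  by (simp only: means_def mem_Collect_eq)

lemma mean_uminus: "M \<in> means G S \<Longrightarrow> bounded_fun G f \<Longrightarrow> M (\<lambda>x. - f x) = - M f"
  using mean_mult_left[of M G S f "-1"] by simp

lemma mean_diff:
  assumes "M \<in> means G S" "bounded_fun G f" "bounded_fun G g"
  shows "M (\<lambda>x. f x - g x) = M f - M g"
  using mean_add[OF assms(1,2) bounded_fun_uminus[OF assms(3)]] mean_uminus[OF assms(1,3)] by simp

lemma mean_sum:
  assumes "M \<in> means G S" "\<And>i. i \<in> I \<Longrightarrow> bounded_fun G (f i)"
  shows "M (\<lambda>x. \<Sum>i\<in>I. f i x) = (\<Sum>i\<in>I. M (f i))"
  using assms(2)
proof (induction I rule: infinite_finite_induct)
  case (insert i I)
  then have "M (\<lambda>x. f i x + (\<Sum>i\<in>I. f i x)) = M (f i) + M (\<lambda>x. \<Sum>i\<in>I. f i x)"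
    by (intro mean_add[OF assms(1)] bounded_fun_sum) auto
  with insert show ?case by (simp only: sum.insert insert_iff simp_thms)
qed (use mean_mult_left[OF assms(1), of "\<lambda>_. 0" 0] in \<open>simp_all only: sum.infinite sum.empty mult_zero_left bounded_fun_const simp_thms\<close>)

lemma bounded_fun_cong:
  "(\<And>x. x \<in> carrier G \<Longrightarrow> f x = g x) \<Longrightarrow> bounded_fun G f \<longleftrightarrow> bounded_fun G g"
  by (simp add: bounded_fun_def)

lemma (in group) mean_norm_le:
  "M \<in> means G S \<Longrightarrow> (\<And>x. x \<in> carrier G \<Longrightarrow> norm (f x) \<le> B) \<Longrightarrow> norm (M f) \<le> B"
  by (rule order_trans[OF mean_norm_le_sup_norm sup_norm_le])

lemma mean_not_bounded: "M \<in> means G S \<Longrightarrow> \<not> bounded_fun G f \<Longrightarrow> M f = 0"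
  using mean_norm_le_sup_norm[of M G S f] by (simp add: sup_norm_def)

text \<open>The norm bound at \<open>f - g\<close>, which vanishes on the carrier, shows that a mean
  ignores values outside it. If \<open>f\<close> is unbounded then so is \<open>g\<close>, and both
  values are \<open>0\<close>.\<close>

lemma (in group) mean_cong:
  assumes M: "M \<in> means G S" and eq: "\<And>x. x \<in> carrier G \<Longrightarrow> f x = g x"
  shows "M f = M g"
proof (cases "bounded_fun G f")
  case True
  moreover from this have "bounded_fun G g" using bounded_fun_cong[of G f g] eq by simp
  ultimately have "M (\<lambda>x. f x - g x) = M f - M g" by (rule mean_diff[OF M])
  moreover have "norm (M (\<lambda>x. f x - g x)) \<le> 0" by (rule mean_norm_le[OF M]) (simp add: eq)
  ultimately show ?thesis by simp
next
  case False
  then show ?thesis using mean_not_bounded[OF M] bounded_fun_cong[of G f g] eq by simp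
qed

lemma (in group) bounded_fun_translate_iff:
  assumes "a \<in> carrier G" shows "bounded_fun G (\<lambda>x. f (a \<otimes> x)) \<longleftrightarrow> bounded_fun G f"
proof
  assume "bounded_fun G (\<lambda>x. f (a \<otimes> x))"
  then obtain B where B: "\<forall>x\<in>carrier G. norm (f (a \<otimes> x)) \<le> B"
    by (auto simp: bounded_fun_def)
  have "norm (f x) \<le> B" if "x \<in> carrier G" for x
    using B[rule_format, of "inv a \<otimes> x"] that assms by (simp add: m_assoc[symmetric])
  then show "bounded_fun G f" by (rule bounded_funI)
qed (rule bounded_fun_translate[OF _ assms])

lemma (in group) sup_norm_translate_le:
  assumes "a \<in> carrier G" shows "sup_norm G (\<lambda>x. f (a \<otimes> x)) \<le> sup_norm G f"
proof (cases "bounded_fun G f")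
  case True
  show ?thesis
    by (rule sup_norm_le, rule norm_le_sup_norm[OF True]) (use assms in simp)
qed (simp add: sup_norm_def bounded_fun_translate_iff[OF assms])

text \<open>One step of the Markov--Kakutani argument: averaging an \<open>S\<close>-invariant mean over the powers of
  \<open>b\<close> makes it approximately \<open>b\<close>-invariant, and compactness removes the error.\<close>

lemma (in comm_group) means_insert:
  assumes M: "M \<in> means G S" and b: "b \<in> carrier G" and S: "S \<subseteq> carrier G"
  shows "means G (insert b S) \<noteq> {}"
proof -
  define h where "h f j = M (\<lambda>x. f (b [^] j \<otimes> x))" for f and j :: nat
  \<comment> \<open>Cesaro average of \<open>M\<close> over the translations by the powers of
    \<open>b\<close> with exponents \<open>0\<close> to \<open>n\<close>; counting to
    \<open>Suc n\<close> keeps the denominator nonzero.\<close>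
  define A where "A n = (\<lambda>f. (\<Sum>j<Suc n. h f j) / of_nat (Suc n))" for n
  note [simp del] = of_nat_Suc sum.lessThan_Suc nat_pow_Suc
  have bf: "bounded_fun G (\<lambda>x. f (b [^] (j::nat) \<otimes> x))" if "bounded_fun G f" for f j
    using bounded_fun_translate[OF that, of "b [^] j"] b by simp
  have nb: "norm (h f j) \<le> sup_norm G f" for f j
    unfolding h_def
    by (rule order_trans[OF mean_norm_le_sup_norm[OF M] sup_norm_translate_le]) (use b in simp)
  have hb: "h (\<lambda>x. f (b \<otimes> x)) j = h f (Suc j)" for f j
  proof -
    have "b \<otimes> (b [^] j \<otimes> x) = b [^] Suc j \<otimes> x" if "x \<in> carrier G" for x
      using that b nat_pow_Suc2[of b j] by (simp add: m_assoc)
    then show ?thesis unfolding h_def by (intro mean_cong[OF M]) simp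
  qed
  have Am: "A n \<in> means G S" for n
  proof -
    have 1: "norm (A n f) \<le> sup_norm G f" for f
    proof -
      have "norm (\<Sum>j<Suc n. h f j) \<le> of_nat (card {..<Suc n}) * sup_norm G f"
        by (rule sum_norm_bound) (rule nb)
      then show ?thesis
        by (simp add: A_def norm_divide divide_le_eq mult.commute)
    qed
    have 2: "A n (\<lambda>x. 1) = 1" by (simp add: A_def h_def mean_one[OF M])
    have 3: "A n (\<lambda>x. f x + g x) = A n f + A n g" if "bounded_fun G f" "bounded_fun G g" for f g
      using that bf by (simp add: A_def h_def mean_add[OF M] sum.distrib add_divide_distrib)
    have 4: "A n (\<lambda>x. c * f x) = c * A n f" if "bounded_fun G f" for c f
      using that bf by (simp add: A_def h_def mean_mult_left[OF M] sum_distrib_left)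
    have 5: "A n (\<lambda>x. cnj (f x)) = cnj (A n f)" if "bounded_fun G f" for f
      using that bf by (simp add: A_def h_def mean_cnj[OF M])
    have 6: "A n (\<lambda>x. f (a \<otimes> x)) = A n f" if "bounded_fun G f" "a \<in> S" for f a
    proof -
      have ac: "a \<in> carrier G" using that S by auto
      \<comment> \<open>Commutativity enters here: translations by \<open>a\<close> and by a power
        of \<open>b\<close> can be exchanged, so invariance under \<open>S\<close> survives the
        averaging.\<close>
      have "h (\<lambda>x. f (a \<otimes> x)) j = h f j" for j :: nat
      proof -
        have "h (\<lambda>x. f (a \<otimes> x)) j = M (\<lambda>x. f (b [^] j \<otimes> (a \<otimes> x)))"
          unfolding h_def by (rule mean_cong[OF M]) (use ac b in \<open>simp add: m_lcomm\<close>)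
        also have "\<dots> = h f j"
          unfolding h_def by (rule mean_translate[OF M \<open>a \<in> S\<close> bf[OF that(1)]])
        finally show ?thesis .
      qed
      then show ?thesis by (simp add: A_def)
    qed
    show ?thesis
      unfolding means_def by (intro CollectI conjI allI impI ballI) (rule 1 2 3 4 5 6; assumption)+
  qed
  \<comment> \<open>The sum telescopes to two boundary terms, each bounded by the sup norm of
    \<open>f\<close>.\<close>
  have At: "norm (A n (\<lambda>x. f (b \<otimes> x)) - A n f) \<le> 2 * sup_norm G f / of_nat (Suc n)" for n f
  proof -
    have "A n (\<lambda>x. f (b \<otimes> x)) - A n f = (\<Sum>j<Suc n. h f (Suc j) - h f j) / of_nat (Suc n)"
      by (simp add: A_def hb sum_subtractf diff_divide_distrib)
    also have "(\<Sum>j<Suc n. h f (Suc j) - h f j) = h f (Suc n) - h f 0"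
      by (rule sum_lessThan_telescope)
    finally have "norm (A n (\<lambda>x. f (b \<otimes> x)) - A n f) = norm (h f (Suc n) - h f 0) / of_nat (Suc n)"
      by (simp add: norm_divide)
    also have "\<dots> \<le> 2 * sup_norm G f / of_nat (Suc n)"
      using norm_triangle_ineq4[of "h f (Suc n)" "h f 0"] nb[of f "Suc n"] nb[of f 0]
      by (intro divide_right_mono) auto
    finally show ?thesis .
  qed
  define D where "D n = {M :: _ \<Rightarrow> complex. \<forall>f. norm (M (\<lambda>x. f (b \<otimes> x)) - M f) \<le> 2 * sup_norm G f / of_nat (Suc n)}"
    for n :: nat
  have "means G S \<inter> (\<Inter>n\<in>UNIV. D n) \<noteq> {}"
  proof (rule compact_imp_fip_image[OF compact_means])
    show "closed (D n)" for n
      unfolding D_def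
      by (intro closed_Collect_all closed_Collect_le[OF continuous_on_norm[OF continuous_on_diff[OF
            continuous_on_product_coordinates continuous_on_product_coordinates]] continuous_on_const])
    fix I :: "nat set" assume "finite I"
    then obtain m where m: "\<And>i. i \<in> I \<Longrightarrow> i \<le> m" by (meson finite_nat_set_iff_bounded_le)
    \<comment> \<open>The sets \<open>D i\<close> decrease with \<open>i\<close>, so an average
      whose index bounds a finite set of indices lies in all of the corresponding sets.\<close>
    have "A m \<in> D i" if "i \<in> I" for i
    proof -
      have "2 * sup_norm G f / of_nat (Suc m) \<le> 2 * sup_norm G f / of_nat (Suc i)" for f
      proof -
        have "0 \<le> sup_norm G f" using nb[of f 0] norm_ge_zero order_trans by blast
        then show ?thesis using m[OF that] by (intro divide_left_mono) (auto simp: of_nat_Suc)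
      qed
      then show ?thesis using At[of m] unfolding D_def by (auto intro: order_trans)
    qed
    then show "means G S \<inter> (\<Inter>i\<in>I. D i) \<noteq> {}" using Am by blast
  qed
  then obtain M' where M': "M' \<in> means G S" "\<And>n. M' \<in> D n" by auto
  have "M' (\<lambda>x. f (b \<otimes> x)) = M' f" for f
  proof -
    have "(\<lambda>n. 2 * sup_norm G f * inverse (of_nat (Suc n))) \<longlonglongrightarrow> 2 * sup_norm G f * 0"
      by (intro tendsto_intros LIMSEQ_inverse_real_of_nat)
    then have "norm (M' (\<lambda>x. f (b \<otimes> x)) - M' f) \<le> 2 * sup_norm G f * 0"
      by (rule LIMSEQ_le_const)
        (use M'(2) in \<open>auto simp: D_def divide_inverse\<close>)
    then show ?thesis by simp
  qed
  then have "M' \<in> means G (insert b S)"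
    using M'(1) by (simp only: means_def mem_Collect_eq) simp
  then show ?thesis by blast
qed

text \<open>Evaluation at the identity is a mean with no invariance; \<open>means_insert\<close>
  reaches every finite set of translations, and the finite intersection property passes to all of
  them.\<close>

theorem (in comm_group) invariant_mean_exists: "\<exists>M. M \<in> means G (carrier G)"
proof -
  have eval: "(\<lambda>f. if bounded_fun G f then f \<one> else 0) \<in> means G {}"
    unfolding means_def by (simp add: norm_le_sup_norm) (simp add: sup_norm_def)
  have fin: "means G S \<noteq> {}" if "finite S" "S \<subseteq> carrier G" for S
    using that
  proof (induction S rule: finite_induct)
    case (insert b S)
    then show ?case using means_insert[of _ S b] by auto
  qed (use eval in blast)
  define I where "I a = {M :: _ \<Rightarrow> complex. \<forall>f. bounded_fun G f \<longrightarrow> M (\<lambda>x. f (a \<otimes> x)) = M f}" for a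
  have means_I: "means G S = means G {} \<inter> (\<Inter>a\<in>S. I a)" for S
    by (simp add: means_def I_def set_eq_iff)
  have "means G {} \<inter> (\<Inter>a\<in>carrier G. I a) \<noteq> {}"
  proof (rule compact_imp_fip_image[OF compact_means])
    show "closed (I a)" for a
      unfolding I_def
      by (intro closed_Collect_all closed_Collect_imp open_Collect_const
          closed_Collect_eq[OF continuous_on_product_coordinates continuous_on_product_coordinates])
    show "means G {} \<inter> (\<Inter>a\<in>S. I a) \<noteq> {}" if "finite S" "S \<subseteq> carrier G" for S
      using fin[OF that] means_I[of S] by simp
  qed
  then show ?thesis using means_I[of "carrier G"] by blast
qed

section \<open>Positivity and the inner product of an invariant mean\<close>

locale mean_group = comm_group G for G (structure) +
  fixes M :: "('a \<Rightarrow> complex) \<Rightarrow> complex"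
  assumes M_mean: "M \<in> means G (carrier G)"
begin

lemmas M_one = mean_one[OF M_mean]
lemmas M_add = mean_add[OF M_mean]
lemmas M_diff = mean_diff[OF M_mean]
lemmas M_sum = mean_sum[OF M_mean]
lemmas M_cmult = mean_mult_left[OF M_mean]
lemmas M_cnj = mean_cnj[OF M_mean]
lemmas M_translate = mean_translate[OF M_mean]
lemmas M_cong = mean_cong[OF M_mean]
lemmas M_norm_le = mean_norm_le[OF M_mean]

lemma M_const: "M (\<lambda>x. c) = c"
  using M_cmult[of "\<lambda>x. 1" c] by (simp add: M_one)

text \<open>Positivity follows from norm one and the value \<open>1\<close> at the constant
  \<open>1\<close>: a function with values in [0, B] is within distance \<open>B\<close> of the
  constant \<open>B\<close>, and so is its mean.\<close>

lemma M_Re_nonneg: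
  assumes f: "bounded_fun G f" and Im: "\<And>x. x \<in> carrier G \<Longrightarrow> Im (f x) = 0"
    and Re: "\<And>x. x \<in> carrier G \<Longrightarrow> 0 \<le> Re (f x)"
  shows "0 \<le> Re (M f)"
proof -
  obtain B where B: "\<forall>x\<in>carrier G. norm (f x) \<le> B" using f by (auto simp: bounded_fun_def)
  have "norm (M (\<lambda>x. of_real B - f x)) \<le> B"
  proof (rule M_norm_le)
    fix x assume x: "x \<in> carrier G"
    have "of_real B - f x = of_real (B - Re (f x))" using Im[OF x] by (simp add: complex_eq_iff)
    then have "norm (of_real B - f x) = \<bar>B - Re (f x)\<bar>" by (simp only: norm_of_real)
    then show "norm (of_real B - f x) \<le> B"
      using Re[OF x] B x complex_Re_le_cmod[of "f x"] by force
  qed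
  moreover have "M (\<lambda>x. of_real B - f x) = of_real B - M f"
    by (simp add: M_diff[OF bounded_fun_const f] M_const)
  ultimately have "Re (of_real B - M f) \<le> B" using complex_Re_le_cmod order_trans by metis
  then show ?thesis by simp
qed

lemma M_Re_le:
  assumes f: "bounded_fun G f" and g: "bounded_fun G g"
    and le: "\<And>x. x \<in> carrier G \<Longrightarrow> Re (f x) \<le> Re (g x)"
  shows "Re (M f) \<le> Re (M g)"
proof -
  define h where "h x = g x - f x" for x
  have h: "bounded_fun G h" unfolding h_def[abs_def] using f g by auto
  \<comment> \<open>Adding the conjugate makes the difference real, as \<open>M_Re_nonneg\<close>
    requires.\<close>
  have "0 \<le> Re (M (\<lambda>x. h x + cnj (h x)))"
  proof (rule M_Re_nonneg)
    show "bounded_fun G (\<lambda>x. h x + cnj (h x))" using h by auto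
    show "0 \<le> Re (h x + cnj (h x))" if "x \<in> carrier G" for x using le[OF that] by (simp add: h_def)
  qed simp
  also have "M (\<lambda>x. h x + cnj (h x)) = M h + cnj (M h)"
    by (simp add: M_add M_cnj h)
  finally show ?thesis using f g by (simp add: h_def[abs_def] M_diff)
qed

definition ip :: "('a \<Rightarrow> complex) \<Rightarrow> ('a \<Rightarrow> complex) \<Rightarrow> complex" where
  "ip u v = M (\<lambda>x. u x * cnj (v x))"

definition nsq :: "('a \<Rightarrow> complex) \<Rightarrow> real" where
  "nsq u = Re (ip u u)"

lemma ip_cnj: "bounded_fun G u \<Longrightarrow> bounded_fun G v \<Longrightarrow> cnj (ip u v) = ip v u"
  using M_cnj[of "\<lambda>x. u x * cnj (v x)"] by (simp add: ip_def mult.commute)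

lemma ip_cong:
  "(\<And>x. x \<in> carrier G \<Longrightarrow> u x = u' x) \<Longrightarrow> (\<And>x. x \<in> carrier G \<Longrightarrow> v x = v' x) \<Longrightarrow> ip u v = ip u' v'"
  unfolding ip_def by (rule M_cong) simp

lemma nsq_cong: "(\<And>x. x \<in> carrier G \<Longrightarrow> u x = u' x) \<Longrightarrow> nsq u = nsq u'"
  unfolding nsq_def by (simp add: ip_cong[of u u' u u'])

lemma nsq_nonneg: "bounded_fun G u \<Longrightarrow> 0 \<le> nsq u"
  unfolding nsq_def ip_def by (rule M_Re_nonneg) auto

lemma nsq_scale: "bounded_fun G u \<Longrightarrow> nsq (\<lambda>x. c * u x) = (norm c)\<^sup>2 * nsq u"
proof -
  assume "bounded_fun G u"
  then have "ip (\<lambda>x. c * u x) (\<lambda>x. c * u x) = (c * cnj c) * ip u u"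
    using M_cmult[of "\<lambda>x. u x * cnj (u x)" "c * cnj c"] by (simp add: ip_def mult_ac)
  then show ?thesis by (simp add: nsq_def complex_norm_square[symmetric])
qed

lemma nsq_diff_scale:
  assumes u: "bounded_fun G u" and v: "bounded_fun G v"
  shows "nsq (\<lambda>x. u x - c * v x) = nsq u - 2 * Re (cnj c * ip u v) + (norm c)\<^sup>2 * nsq v"
proof -
  have 1: "bounded_fun G (\<lambda>x. u x * cnj (u x))" "bounded_fun G (\<lambda>x. cnj c * (u x * cnj (v x)))"
    "bounded_fun G (\<lambda>x. c * (v x * cnj (u x)))" "bounded_fun G (\<lambda>x. c * cnj c * (v x * cnj (v x)))"
    "bounded_fun G (\<lambda>x. u x * cnj (v x))" "bounded_fun G (\<lambda>x. v x * cnj (u x))"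
    "bounded_fun G (\<lambda>x. v x * cnj (v x))"
    using u v by auto
  have "ip (\<lambda>x. u x - c * v x) (\<lambda>x. u x - c * v x) =
      M (\<lambda>x. (u x * cnj (u x) - cnj c * (u x * cnj (v x))) -
             (c * (v x * cnj (u x)) - c * cnj c * (v x * cnj (v x))))"
    by (simp add: ip_def algebra_simps)
  also have "\<dots> = (ip u u - cnj c * ip u v) - (c * ip v u - c * cnj c * ip v v)"
    using 1 by (simp add: M_diff M_cmult ip_def)
  also have "c * ip v u = cnj (cnj c * ip u v)" using ip_cnj[OF u v] by simp
  finally show ?thesis by (simp add: nsq_def complex_norm_square[symmetric])
qed

text \<open>Cauchy--Schwarz for a form that is only semidefinite: subtracting \<open>ip u v\<close>
  times \<open>v\<close> from \<open>u\<close> leaves a nonnegative square norm, without dividing by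
  \<open>nsq v\<close>, which may vanish.\<close>

lemma norm_ip_le:
  assumes "bounded_fun G u" "bounded_fun G v" "nsq v \<le> 1"
  shows "(norm (ip u v))\<^sup>2 \<le> nsq u"
proof -
  define c where "c = ip u v"
  have "0 \<le> nsq (\<lambda>x. u x - c * v x)" using assms by (intro nsq_nonneg) auto
  also have "\<dots> = nsq u - 2 * (norm c)\<^sup>2 + (norm c)\<^sup>2 * nsq v"
  proof -
    have "Re (cnj c * c) = (norm c)\<^sup>2" by (simp add: cmod_power2) (simp add: power2_eq_square)
    then show ?thesis using nsq_diff_scale[OF assms(1,2), of c] by (simp only: c_def[symmetric])
  qed
  also have "\<dots> \<le> nsq u - 2 * (norm c)\<^sup>2 + (norm c)\<^sup>2"
    using assms(3) by (simp add: mult_left_le)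
  finally show ?thesis by (simp add: c_def)
qed

lemma nsq_le:
  assumes "\<And>x. x \<in> carrier G \<Longrightarrow> norm (u x) \<le> B" "0 \<le> B"
  shows "nsq u \<le> B\<^sup>2"
proof -
  have "norm (ip u u) \<le> B\<^sup>2" unfolding ip_def
    by (rule M_norm_le) (use assms in \<open>simp add: norm_mult power2_eq_square mult_mono\<close>)
  then show ?thesis unfolding nsq_def using complex_Re_le_cmod order_trans by blast
qed

text \<open>Cauchy--Schwarz with a sup bound on one factor. It keeps the later estimates uniform
  over all \<open>v\<close> with \<open>nsq v \<le> 1\<close>, whose sup norms are not
  controlled.\<close>

lemma norm_M_mult_le:
  assumes f: "\<And>x. x \<in> carrier G \<Longrightarrow> norm (f x) \<le> e" and v: "bounded_fun G v" "nsq v \<le> 1"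
  shows "norm (M (\<lambda>x. f x * v x)) \<le> e"
proof -
  have e: "0 \<le> e" using f[OF one_closed] norm_ge_zero order_trans by blast
  have "nsq (\<lambda>x. cnj (v x)) = nsq v" by (simp add: nsq_def ip_def mult.commute)
  then have "(norm (ip f (\<lambda>x. cnj (v x))))\<^sup>2 \<le> nsq f"
    using f v by (intro norm_ip_le) (auto intro: bounded_funI)
  also have "\<dots> \<le> e\<^sup>2" using f e by (rule nsq_le)
  finally show ?thesis using e unfolding ip_def by (simp add: abs_le_square_iff[symmetric])
qed

text \<open>The default value \<open>0\<close> covers unbounded functions, which frees later shifts
  from side conditions.\<close>

lemma M_shift:
  assumes "b \<in> carrier G"
  shows "M (\<lambda>x. f (b \<otimes> x)) = M f"
proof (cases "bounded_fun G f")
  case True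
  then show ?thesis by (rule M_translate[OF assms])
next
  case False
  then show ?thesis using mean_not_bounded[OF M_mean] bounded_fun_translate_iff[OF assms] by metis
qed

text \<open>Shifting by \<open>a\<close> leaves the mean fixed but multiplies it by
  \<open>\<xi> a\<close>. This is the source of all orthogonality relations below.\<close>

lemma M_character:
  assumes "\<And>x y. x \<in> carrier G \<Longrightarrow> y \<in> carrier G \<Longrightarrow> \<xi> (x \<otimes> y) = \<xi> x * \<xi> y"
    and "\<And>x. x \<in> carrier G \<Longrightarrow> norm (\<xi> x) = 1" and a: "a \<in> carrier G" "\<xi> a \<noteq> 1"
  shows "M \<xi> = 0"
proof -
  have b: "bounded_fun G \<xi>" by (rule bounded_funI[where B = 1]) (simp add: assms)
  have "M \<xi> = M (\<lambda>x. \<xi> (a \<otimes> x))" by (rule M_shift[OF a(1), symmetric])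
  also have "\<dots> = M (\<lambda>x. \<xi> a * \<xi> x)" by (rule M_cong) (simp add: assms a)
  also have "\<dots> = \<xi> a * M \<xi>" by (rule M_cmult[OF b])
  finally have "(\<xi> a - 1) * M \<xi> = 0" by (simp add: algebra_simps)
  then show ?thesis using a by simp
qed

lemma bounded_fun_correlation:
  assumes "bounded_fun G h" "bounded_fun G v"
  shows "bounded_fun G (\<lambda>x. M (\<lambda>y. h (x \<otimes> y) * v y))"
proof -
  obtain C D where C: "\<forall>x\<in>carrier G. norm (h x) \<le> C" and D: "\<forall>x\<in>carrier G. norm (v x) \<le> D"
    using assms by (auto simp: bounded_fun_def)
  have C0: "0 \<le> C" using C one_closed norm_ge_zero order_trans by blast
  show ?thesis
  proof (rule bounded_funI)
    fix x assume x: "x \<in> carrier G"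
    show "norm (M (\<lambda>y. h (x \<otimes> y) * v y)) \<le> C * D"
    proof (rule M_norm_le)
      fix y assume "y \<in> carrier G"
      then have "norm (h (x \<otimes> y)) \<le> C" "norm (v y) \<le> D" using C D x by auto
      then show "norm (h (x \<otimes> y) * v y) \<le> C * D"
        unfolding norm_mult using C0 by (intro mult_mono) auto
    qed
  qed
qed

end

section \<open>Almost periodicity and control by a function\<close>

definition near :: "('a, 'b) monoid_scheme \<Rightarrow> ('a \<Rightarrow> complex) \<Rightarrow> real \<Rightarrow> 'a \<Rightarrow> 'a \<Rightarrow> bool" where
  "near G f e x x' \<longleftrightarrow> (\<forall>y\<in>carrier G. norm (f (mult G x y) - f (mult G x' y)) \<le> e)"

text \<open>\<open>near\<close> compares two translates of \<open>f\<close> in the sup norm;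
  \<open>controlled\<close> is the Lipschitz condition for the resulting pseudometric. It involves
  two values of \<phi> at a time, hence passes to pointwise limits with the same constant.\<close>

definition controlled :: "('a, 'b) monoid_scheme \<Rightarrow> ('a \<Rightarrow> complex) \<Rightarrow> real \<Rightarrow> ('a \<Rightarrow> complex) \<Rightarrow> bool" where
  "controlled G f K \<phi> \<longleftrightarrow>
     (\<forall>x\<in>carrier G. \<forall>x'\<in>carrier G. \<forall>e. near G f e x x' \<longrightarrow> norm (\<phi> x - \<phi> x') \<le> K * e)"

text \<open>Bochner's criterion: the translates of \<open>f\<close> form a totally bounded set in
  the sup norm.\<close>

definition almost_periodic :: "('a, 'b) monoid_scheme \<Rightarrow> ('a \<Rightarrow> complex) \<Rightarrow> bool" where
  "almost_periodic G f \<longleftrightarrow>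
     (\<forall>e>0. \<exists>X. finite X \<and> X \<subseteq> carrier G \<and> (\<forall>x\<in>carrier G. \<exists>q\<in>X. near G f e x q))"

context comm_group
begin

text \<open>By commutativity \<open>b\<close> can be absorbed into \<open>y\<close>, over which
  \<open>near\<close> quantifies.\<close>

lemma near_translate:
  assumes "near G f e x x'" "x \<in> carrier G" "x' \<in> carrier G" "b \<in> carrier G"
  shows "near G f e (b \<otimes> x) (b \<otimes> x')"
  unfolding near_def
proof
  fix y assume y: "y \<in> carrier G"
  have "b \<otimes> x \<otimes> y = x \<otimes> (b \<otimes> y)" "b \<otimes> x' \<otimes> y = x' \<otimes> (b \<otimes> y)"
    using assms y by (simp_all add: m_lcomm m_assoc)
  then show "norm (f (b \<otimes> x \<otimes> y) - f (b \<otimes> x' \<otimes> y)) \<le> e"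
    using assms y by (simp add: near_def)
qed

lemma near_nonneg: "near G f e x x' \<Longrightarrow> 0 \<le> e"
  unfolding near_def using one_closed norm_ge_zero order_trans by blast

end

lemma controlledD:
  "controlled G f K \<phi> \<Longrightarrow> near G f e x x' \<Longrightarrow> x \<in> carrier G \<Longrightarrow> x' \<in> carrier G \<Longrightarrow>
   norm (\<phi> x - \<phi> x') \<le> K * e"
  by (auto simp: controlled_def)

lemma controlled_diff_scale:
  assumes "controlled G f K u" "controlled G f L v"
  shows "controlled G f (K + norm c * L) (\<lambda>x. u x - c * v x)"
  unfolding controlled_def
proof (intro ballI allI impI)
  fix x x' e assume x: "x \<in> carrier G" "x' \<in> carrier G" "near G f e x x'"
  have "u x - c * v x - (u x' - c * v x') = (u x - u x') - c * (v x - v x')"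
    by (simp add: algebra_simps)
  also have "norm \<dots> \<le> norm (u x - u x') + norm c * norm (v x - v x')"
    by (rule order_trans[OF norm_triangle_ineq4]) (simp add: norm_mult)
  also have "\<dots> \<le> K * e + norm c * (L * e)"
    using controlledD[OF assms(1) x(3,1,2)] controlledD[OF assms(2) x(3,1,2)]
    by (intro add_mono mult_left_mono) auto
  finally show "norm (u x - c * v x - (u x' - c * v x')) \<le> (K + norm c * L) * e"
    by (simp add: algebra_simps)
qed

context mean_group
begin

text \<open>Strict positivity of the mean holds here because finitely many translates of the set where
  \<open>\<phi>\<close> is large cover the group.\<close>

lemma nsq_le_zeroD:
  assumes ap: "almost_periodic G f" and ctl: "controlled G f K \<phi>" and b: "bounded_fun G \<phi>"
    and 0: "nsq \<phi> \<le> 0" and p: "p \<in> carrier G"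
  shows "\<phi> p = 0"
proof (rule ccontr)
  assume "\<phi> p \<noteq> 0"
  define c where "c = norm (\<phi> p)"
  \<comment> \<open>Chosen so that \<open>K * e\<close> is at most \<open>c / 2\<close>; the summand
    \<open>1\<close> avoids division by zero when \<open>K\<close> vanishes.\<close>
  define e where "e = c / (2 * (\<bar>K\<bar> + 1))"
  have c: "c > 0" using \<open>\<phi> p \<noteq> 0\<close> by (simp add: c_def)
  then have e: "e > 0" by (simp add: e_def add_nonneg_pos)
  have Ke: "K * e \<le> c / 2"
  proof -
    have "K * e \<le> (\<bar>K\<bar> + 1) * e" using e by (intro mult_right_mono) auto
    also have "\<dots> = c / 2" unfolding e_def by (simp add: field_simps)
    finally show ?thesis .
  qed
  obtain X where X: "finite X" "X \<subseteq> carrier G" "\<forall>x\<in>carrier G. \<exists>q\<in>X. near G f e x q"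
    using ap e by (auto simp: almost_periodic_def)
  \<comment> \<open>\<open>t q\<close> carries \<open>q\<close> to \<open>p\<close>: if
    \<open>x\<close> is near \<open>q\<close> then \<open>t q \<otimes> x\<close> is near
    \<open>p\<close>, where \<phi> still has modulus at least \<open>c / 2\<close>. So at every
    point one of the finitely many translates is large.\<close>
  define t where "t q = inv q \<otimes> p" for q
  have t: "t q \<in> carrier G" if "q \<in> X" for q using that X p by (auto simp: t_def)
  define g where "g x = (\<Sum>q\<in>X. \<phi> (t q \<otimes> x) * cnj (\<phi> (t q \<otimes> x)))" for x
  have bt: "bounded_fun G (\<lambda>x. \<phi> (t q \<otimes> x) * cnj (\<phi> (t q \<otimes> x)))" if "q \<in> X" for q
    using bounded_fun_translate[OF b t[OF that]] by auto
  have "M g = (\<Sum>q\<in>X. ip \<phi> \<phi>)"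
    unfolding g_def ip_def using bt t M_shift[of "t q" "\<lambda>x. \<phi> x * cnj (\<phi> x)" for q]
    by (simp add: M_sum)
  then have "Re (M g) \<le> 0" using 0 by (simp add: nsq_def mult_nonneg_nonpos)
  moreover have "Re (M (\<lambda>x. of_real ((c / 2)\<^sup>2))) \<le> Re (M g)"
  proof (rule M_Re_le)
    show "bounded_fun G g" unfolding g_def using bt by auto
    fix x assume x: "x \<in> carrier G"
    have g: "g x = of_real (\<Sum>q\<in>X. (norm (\<phi> (t q \<otimes> x)))\<^sup>2)"
      by (simp add: g_def complex_norm_square[symmetric])
    obtain q where q: "q \<in> X" "near G f e x q" using X x by blast
    then have qc: "q \<in> carrier G" using X by auto
    have "near G f e (t q \<otimes> x) (t q \<otimes> q)" by (rule near_translate[OF q(2) x qc t[OF q(1)]])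
    moreover have "t q \<otimes> q = p"
      unfolding t_def using qc p by (simp add: m_comm[of p q] m_assoc) (simp add: m_assoc[symmetric])
    ultimately have "norm (\<phi> (t q \<otimes> x) - \<phi> p) \<le> c / 2"
      using controlledD[OF ctl, of e "t q \<otimes> x" p] x p t[OF q(1)] Ke by simp
    then have "c / 2 \<le> norm (\<phi> (t q \<otimes> x))"
      using norm_triangle_ineq2[of "\<phi> p" "\<phi> (t q \<otimes> x)"] by (simp add: c_def norm_minus_commute)
    then have "(c / 2)\<^sup>2 \<le> (norm (\<phi> (t q \<otimes> x)))\<^sup>2" using c by (intro power_mono) auto
    also have "\<dots> \<le> (\<Sum>q\<in>X. (norm (\<phi> (t q \<otimes> x)))\<^sup>2)"
      by (rule member_le_sum[OF q(1)]) (use X in auto)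
    finally show "Re (of_real ((c / 2)\<^sup>2)) \<le> Re (g x)" unfolding g by simp
  qed simp
  moreover have "(c / 2)\<^sup>2 > 0" using c by simp
  ultimately show False by (simp add: M_const)
qed

text \<open>Arzela--Ascoli: a common Lipschitz constant and a finite net turn pointwise into uniform
  convergence. A mean is continuous for uniform convergence but in general not for pointwise
  convergence, so continuity of \<open>ip\<close> and \<open>nsq\<close> has to go through
  this.\<close>

lemma eventually_uniformly_close:
  fixes w :: "'p::topological_space \<Rightarrow> 'a \<Rightarrow> complex"
  assumes ap: "almost_periodic G f" and cont: "\<And>x. x \<in> carrier G \<Longrightarrow> continuous_on P (\<lambda>p. w p x)"
    and ctl: "\<And>p. p \<in> P \<Longrightarrow> controlled G f K (w p)" and p0: "p0 \<in> P" and e: "e > 0"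
  shows "eventually (\<lambda>p. \<forall>x\<in>carrier G. norm (w p x - w p0 x) \<le> e) (at p0 within P)"
proof -
  define d where "d = e / (3 * (\<bar>K\<bar> + 1))"
  have d: "d > 0" using e by (simp add: d_def add_nonneg_pos)
  have Kd: "K * d \<le> e / 3"
  proof -
    have "K * d \<le> (\<bar>K\<bar> + 1) * d" using d by (intro mult_right_mono) auto
    also have "\<dots> = e / 3" unfolding d_def by (simp add: field_simps)
    finally show ?thesis .
  qed
  obtain X where X: "finite X" "X \<subseteq> carrier G" "\<forall>x\<in>carrier G. \<exists>q\<in>X. near G f d x q"
    using ap d by (auto simp: almost_periodic_def)
  have "eventually (\<lambda>p. \<forall>q\<in>X. dist (w p q) (w p0 q) < e / 3) (at p0 within P)"
  proof (rule eventually_ball_finite[OF X(1)], rule ballI)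
    fix q assume "q \<in> X"
    then have "((\<lambda>p. w p q) \<longlongrightarrow> w p0 q) (at p0 within P)"
      using cont X p0 by (auto simp: continuous_on_def)
    then show "eventually (\<lambda>p. dist (w p q) (w p0 q) < e / 3) (at p0 within P)"
      by (rule tendstoD) (use e in simp)
  qed
  moreover have "eventually (\<lambda>p. p \<in> P) (at p0 within P)" by (simp add: eventually_at_filter)
  ultimately show ?thesis
  proof eventually_elim
    case (elim p)
    show ?case
    proof
      fix x assume x: "x \<in> carrier G"
      obtain q where q: "q \<in> X" "near G f d x q" using X x by blast
      then have qc: "q \<in> carrier G" using X by auto
      have "norm (w p x - w p q) \<le> e / 3" "norm (w p0 x - w p0 q) \<le> e / 3"
        using controlledD[OF ctl[OF p0] q(2) x qc] controlledD[OF ctl[OF elim(2)] q(2) x qc] Kd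
        by linarith+
      moreover have "norm (w p q - w p0 q) \<le> e / 3" using elim q by (simp add: dist_norm less_imp_le)
      moreover have "norm (w p x - w p0 x) \<le>
          norm (w p x - w p q) + norm (w p q - w p0 q) + norm (w p0 x - w p0 q)"
        using norm_triangle_ineq[of "w p x - w p q" "w p q - w p0 q"]
          norm_triangle_ineq[of "w p x - w p0 q" "w p0 q - w p0 x"]
        by (simp add: norm_minus_commute)
      ultimately show "norm (w p x - w p0 x) \<le> e" by simp
    qed
  qed
qed

lemma continuous_on_ip:
  fixes w :: "'p::topological_space \<Rightarrow> 'a \<Rightarrow> complex"
  assumes ap: "almost_periodic G f" and cont: "\<And>x. x \<in> carrier G \<Longrightarrow> continuous_on P (\<lambda>p. w p x)"
    and ctl: "\<And>p. p \<in> P \<Longrightarrow> controlled G f K (w p)" and g: "bounded_fun G g"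
    and w: "\<And>p. p \<in> P \<Longrightarrow> bounded_fun G (w p)"
  shows "continuous_on P (\<lambda>p. ip (w p) g)"
  unfolding continuous_on_def
proof (intro ballI tendstoI)
  fix p0 and e :: real assume p0: "p0 \<in> P" and e: "e > 0"
  obtain B where B: "\<forall>x\<in>carrier G. norm (g x) \<le> B" using g by (auto simp: bounded_fun_def)
  define d where "d = e / (2 * (\<bar>B\<bar> + 1))"
  have d: "d > 0" using e by (simp add: d_def add_nonneg_pos)
  have "eventually (\<lambda>p. p \<in> P) (at p0 within P)" by (simp add: eventually_at_filter)
  moreover have "eventually (\<lambda>p. \<forall>x\<in>carrier G. norm (w p x - w p0 x) \<le> d) (at p0 within P)"
    by (rule eventually_uniformly_close[OF ap _ _ p0 d]) (rule cont ctl; assumption)+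
  ultimately show "eventually (\<lambda>p. dist (ip (w p) g) (ip (w p0) g) < e) (at p0 within P)"
  proof eventually_elim
    case (elim p)
    have "ip (w p) g - ip (w p0) g = M (\<lambda>x. w p x * cnj (g x) - w p0 x * cnj (g x))"
      unfolding ip_def using w elim p0 g by (simp add: M_diff)
    also have "norm \<dots> \<le> d * (\<bar>B\<bar> + 1)"
    proof (rule M_norm_le)
      fix x assume x: "x \<in> carrier G"
      have "norm (w p x * cnj (g x) - w p0 x * cnj (g x)) = norm (w p x - w p0 x) * norm (g x)"
        by (simp add: norm_mult flip: left_diff_distrib)
      also have "\<dots> \<le> d * (\<bar>B\<bar> + 1)" 
      proof (rule mult_mono)
        show "norm (w p x - w p0 x) \<le> d" using elim x by blast
        show "norm (g x) \<le> \<bar>B\<bar> + 1" using B x by force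
      qed (use d in auto)
      finally show "norm (w p x * cnj (g x) - w p0 x * cnj (g x)) \<le> d * (\<bar>B\<bar> + 1)" .
    qed
    also have "\<dots> = e / 2" unfolding d_def by (simp add: field_simps)
    finally show ?case using e by (simp add: dist_norm)
  qed
qed

lemma continuous_on_nsq:
  fixes w :: "'p::topological_space \<Rightarrow> 'a \<Rightarrow> complex"
  assumes ap: "almost_periodic G f" and cont: "\<And>x. x \<in> carrier G \<Longrightarrow> continuous_on P (\<lambda>p. w p x)"
    and ctl: "\<And>p. p \<in> P \<Longrightarrow> controlled G f K (w p)"
    and w: "\<And>p x. p \<in> P \<Longrightarrow> x \<in> carrier G \<Longrightarrow> norm (w p x) \<le> B"
  shows "continuous_on P (\<lambda>p. nsq (w p))"
  unfolding continuous_on_def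
proof (intro ballI tendstoI)
  fix p0 and e :: real assume p0: "p0 \<in> P" and e: "e > 0"
  have B: "0 \<le> B" using w[OF p0 one_closed] norm_ge_zero order_trans by blast
  have bw: "bounded_fun G (w p)" if "p \<in> P" for p using w[OF that] by (rule bounded_funI)
  define d where "d = e / (4 * (B + 1))"
  have d: "d > 0" using e B by (simp add: d_def)
  have "eventually (\<lambda>p. p \<in> P) (at p0 within P)" by (simp add: eventually_at_filter)
  moreover have "eventually (\<lambda>p. \<forall>x\<in>carrier G. norm (w p x - w p0 x) \<le> d) (at p0 within P)"
    by (rule eventually_uniformly_close[OF ap _ _ p0 d]) (rule cont ctl; assumption)+
  ultimately show "eventually (\<lambda>p. dist (nsq (w p)) (nsq (w p0)) < e) (at p0 within P)"
  proof eventually_elim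
    case (elim p)
    have "nsq (w p) - nsq (w p0) = Re (M (\<lambda>x. w p x * cnj (w p x) - w p0 x * cnj (w p0 x)))"
      unfolding ip_def nsq_def using bw elim p0 by (simp add: M_diff)
    also have "\<bar>\<dots>\<bar> \<le> norm (M (\<lambda>x. w p x * cnj (w p x) - w p0 x * cnj (w p0 x)))"
      by (rule abs_Re_le_cmod)
    also have "\<dots> \<le> 2 * (B * d)"
    proof (rule M_norm_le)
      fix x assume x: "x \<in> carrier G"
      have eq: "w p x * cnj (w p x) - w p0 x * cnj (w p0 x) =
          (w p x - w p0 x) * cnj (w p x) + w p0 x * cnj (w p x - w p0 x)"
        by (simp add: algebra_simps)
      have "norm (w p x * cnj (w p x) - w p0 x * cnj (w p0 x)) \<le>
          norm (w p x - w p0 x) * norm (w p x) + norm (w p0 x) * norm (w p x - w p0 x)"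
        unfolding eq by (rule order_trans[OF norm_triangle_ineq]) (simp add: norm_mult del: complex_cnj_diff)
      also have "\<dots> \<le> d * B + B * d"
      proof -
        have 1: "norm (w p x - w p0 x) \<le> d" using elim x by blast
        have 2: "norm (w p x) \<le> B" "norm (w p0 x) \<le> B" using w x p0 elim by blast+
        show ?thesis using 1 2 d B by (intro add_mono mult_mono) auto
      qed
      finally show "norm (w p x * cnj (w p x) - w p0 x * cnj (w p0 x)) \<le> 2 * (B * d)" by simp
    qed
    also have "\<dots> \<le> 2 * ((B + 1) * d)" using d by simp
    also have "\<dots> = e / 2" unfolding d_def using B by (simp add: field_simps)
    finally show ?case using e by (simp add: dist_real_def)
  qed
qed

end

section \<open>Characters of almost periodic functions\<close>

context mean_group
begin

text \<open>The Fourier coefficients of \<open>autoc f a v\<close> are the squared moduli of those of \<open>v\<close>, damped by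
  the coefficients of \<open>f - f(a \<cdot>)\<close>, which vanish at characters trivial at \<open>a\<close>.\<close>

definition wave :: "('a \<Rightarrow> complex) \<Rightarrow> 'a \<Rightarrow> ('a \<Rightarrow> complex) \<Rightarrow> 'a \<Rightarrow> complex" where
  "wave f a v x = M (\<lambda>y. (f (x \<otimes> y) - f (a \<otimes> (x \<otimes> y))) * v y)"

text \<open>The autocorrelation of \<open>v\<close>, whose limit becomes a conjugate character. The
  value \<open>0\<close> outside the carrier makes its bounds hold on the whole type, as membership
  in a product of discs over the type demands.\<close>

definition self :: "('a \<Rightarrow> complex) \<Rightarrow> 'a \<Rightarrow> complex" where
  "self v x = (if x \<in> carrier G then ip (\<lambda>y. v (x \<otimes> y)) v else 0)"

definition autoc :: "('a \<Rightarrow> complex) \<Rightarrow> 'a \<Rightarrow> ('a \<Rightarrow> complex) \<Rightarrow> 'a \<Rightarrow> complex" where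
  "autoc f a v = self (wave f a v)"

text \<open>A Fourier multiplier: for \<open>norm z = 1\<close> it acts on a character \<chi> as the
  factor \<open>(1 + Re (cnj z * \<chi> b)) / 2\<close>, which lies in [0, 1]; the factors for
  \<open>z\<close> and \<open>-z\<close> add up to \<open>1\<close>.\<close>

definition mix :: "complex \<Rightarrow> 'a \<Rightarrow> ('a \<Rightarrow> complex) \<Rightarrow> 'a \<Rightarrow> complex" where
  "mix z b \<phi> x = (if x \<in> carrier G
     then \<phi> x / 2 + (z * \<phi> (inv b \<otimes> x) + cnj z * \<phi> (b \<otimes> x)) / 4 else 0)"

text \<open>The product expands into four correlations. The two pure ones agree after an invariant
  shift and make up half of \<open>self v x\<close>; the two mixed ones give the translates.\<close>

lemma self_mix:
  assumes v: "bounded_fun G v" and b: "b \<in> carrier G" and z: "norm z = 1"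
  shows "self (\<lambda>y. (v y + z * v (inv b \<otimes> y)) / 2) x = mix z b (self v) x"
proof (cases "x \<in> carrier G")
  case x: True
  have zz: "z * cnj z = 1" using z by (simp add: complex_norm_square[symmetric])
  define p where "p y = v (x \<otimes> y) * cnj (v y)" for y
  define q where "q y = v (inv b \<otimes> (x \<otimes> y)) * cnj (v y)" for y
  define r where "r y = v (x \<otimes> y) * cnj (v (inv b \<otimes> y))" for y
  define s where "s y = v (inv b \<otimes> (x \<otimes> y)) * cnj (v (inv b \<otimes> y))" for y
  have bv: "bounded_fun G (\<lambda>y. v (x \<otimes> y))" "bounded_fun G (\<lambda>y. v (inv b \<otimes> (x \<otimes> y)))"
    "bounded_fun G (\<lambda>y. v (inv b \<otimes> y))"
    using v b x bounded_fun_translate[OF bounded_fun_translate[OF v, of "inv b"], of x]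
    by (auto intro: bounded_fun_translate)
  have bd: "bounded_fun G p" "bounded_fun G q" "bounded_fun G r" "bounded_fun G s"
    using v bv unfolding p_def[abs_def] q_def[abs_def] r_def[abs_def] s_def[abs_def] by auto
  have expand: "(p1 + z * p2) / 2 * cnj ((q1 + z * q2) / 2) =
      1/4 * (p1 * cnj q1) + z/4 * (p2 * cnj q1) + (cnj z/4 * (p1 * cnj q2) + (z * cnj z)/4 * (p2 * cnj q2))"
    for p1 p2 q1 q2 by (simp add: algebra_simps add_divide_distrib)
  have "self (\<lambda>y. (v y + z * v (inv b \<otimes> y)) / 2) x =
      M (\<lambda>y. 1/4 * p y + z/4 * q y + (cnj z/4 * r y + (z * cnj z)/4 * s y))"
    using x by (simp only: self_def ip_def p_def q_def r_def s_def expand if_True)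
  also have "\<dots> = 1/4 * M p + z/4 * M q + (cnj z/4 * M r + (z * cnj z)/4 * M s)"
    using bd by (simp only: M_add M_cmult bounded_fun_add bounded_fun_mult bounded_fun_const)
  also have "M p = self v x" using x by (simp add: self_def ip_def p_def[abs_def])
  also have "M q = self v (inv b \<otimes> x)"
    using x b unfolding self_def ip_def q_def
    by (auto intro!: M_cong simp: m_assoc)
  also have "M r = self v (b \<otimes> x)"
  proof -
    have "M r = M (\<lambda>y. r (b \<otimes> y))" by (rule M_shift[OF b, symmetric])
    also have "\<dots> = self v (b \<otimes> x)"
    proof -
      have "r (b \<otimes> y) = v (b \<otimes> x \<otimes> y) * cnj (v y)" if "y \<in> carrier G" for y
      proof -
        have "inv b \<otimes> (b \<otimes> y) = y" using b that by (simp add: m_assoc[symmetric])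
        moreover have "x \<otimes> (b \<otimes> y) = b \<otimes> x \<otimes> y" using b x that by (simp add: m_assoc m_lcomm)
        ultimately show ?thesis by (simp add: r_def)
      qed
      then show ?thesis using b x unfolding self_def ip_def by (auto intro: M_cong)
    qed
    finally show ?thesis .
  qed
  also have "M s = self v x"
  proof -
    have "M s = M (\<lambda>y. s (b \<otimes> y))" by (rule M_shift[OF b, symmetric])
    also have "\<dots> = self v x"
    proof -
      have "s (b \<otimes> y) = v (x \<otimes> y) * cnj (v y)" if "y \<in> carrier G" for y
      proof -
        have "inv b \<otimes> (b \<otimes> y) = y" using b that by (simp add: m_assoc[symmetric])
        moreover have "inv b \<otimes> (x \<otimes> (b \<otimes> y)) = x \<otimes> y"
          using b x that by (simp add: m_lcomm[of x b]) (simp add: m_assoc[symmetric])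
        ultimately show ?thesis by (simp add: s_def)
      qed
      then show ?thesis using b x unfolding self_def ip_def by (auto intro: M_cong)
    qed
    finally show ?thesis .
  qed
  finally show ?thesis using x by (simp add: mix_def zz algebra_simps)
next
  case False
  then show ?thesis by (simp add: self_def mix_def)
qed

lemma self_scale:
  assumes "bounded_fun G v" shows "self (\<lambda>y. c * v y) x = c * cnj c * self v x"
proof (cases "x \<in> carrier G")
  case True
  then have "bounded_fun G (\<lambda>y. v (x \<otimes> y) * cnj (v y))"
    using bounded_fun_translate[OF assms True] assms by auto
  then show ?thesis using True M_cmult[of "\<lambda>y. v (x \<otimes> y) * cnj (v y)" "c * cnj c"]
    by (simp add: self_def ip_def mult_ac)
qed (simp add: self_def)

lemma self_one: "bounded_fun G v \<Longrightarrow> Re (self v \<one>) = nsq v"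
  unfolding self_def nsq_def by (simp add: ip_cong[of "\<lambda>y. v (\<one> \<otimes> y)" v v v])

lemma norm_self_le:
  assumes v: "bounded_fun G v" "nsq v \<le> 1" shows "norm (self v x) \<le> 1"
proof (cases "x \<in> carrier G")
  case x: True
  have "nsq (\<lambda>y. v (x \<otimes> y)) = nsq v"
    unfolding nsq_def ip_def using M_shift[OF x, of "\<lambda>y. v y * cnj (v y)"] by simp
  then have "(norm (self v x))\<^sup>2 \<le> 1"
    using norm_ip_le[OF bounded_fun_translate[OF v(1) x] v] x v(2) by (simp add: self_def)
  then show ?thesis by (simp add: power_le_one_iff abs_square_le_1)
qed (simp add: self_def)

lemma self_cong:
  assumes "\<And>x. x \<in> carrier G \<Longrightarrow> v x = v' x" shows "self v = self v'"
  unfolding self_def by (intro ext if_cong refl ip_cong) (auto simp: assms)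

end

section \<open>The variational problem behind Bohr's theorem\<close>

locale bohr = mean_group G M for G (structure) and M +
  fixes f :: "'a \<Rightarrow> complex" and a :: 'a and B :: real
  assumes f_bound: "\<And>x. x \<in> carrier G \<Longrightarrow> norm (f x) \<le> B"
    and f_ap: "almost_periodic G f"
    and a: "a \<in> carrier G"
    and f_a: "f a \<noteq> f \<one>"
begin

lemma B_pos: "0 < B"
proof -
  have "0 \<le> norm (f \<one>)" "0 \<le> norm (f a)" by auto
  moreover have "norm (f \<one>) \<le> B" "norm (f a) \<le> B" using f_bound a by auto
  moreover have "norm (f \<one>) > 0 \<or> norm (f a) > 0" using f_a by auto
  ultimately show ?thesis by linarith
qed

definition F :: "'a \<Rightarrow> complex" where "F x = f x - f (a \<otimes> x)"

lemma F_bound: "x \<in> carrier G \<Longrightarrow> norm (F x) \<le> 2 * B"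
  unfolding F_def using f_bound[of x] f_bound[of "a \<otimes> x"] a
    norm_triangle_ineq4[of "f x" "f (a \<otimes> x)"] by simp

lemma F_bounded: "bounded_fun G F"
  using F_bound by (rule bounded_funI)

lemma F_near:
  assumes "near G f e x x'" "x \<in> carrier G" "x' \<in> carrier G" "y \<in> carrier G"
  shows "norm (F (x \<otimes> y) - F (x' \<otimes> y)) \<le> 2 * e"
proof -
  have "norm (f (x \<otimes> y) - f (x' \<otimes> y)) \<le> e" "norm (f (x \<otimes> (a \<otimes> y)) - f (x' \<otimes> (a \<otimes> y))) \<le> e"
    using assms a by (auto simp: near_def)
  moreover have "a \<otimes> (x \<otimes> y) = x \<otimes> (a \<otimes> y)" "a \<otimes> (x' \<otimes> y) = x' \<otimes> (a \<otimes> y)"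
    using assms a by (simp_all add: m_lcomm)
  moreover have "norm (F (x \<otimes> y) - F (x' \<otimes> y)) \<le>
     norm (f (x \<otimes> y) - f (x' \<otimes> y)) + norm (f (a \<otimes> (x \<otimes> y)) - f (a \<otimes> (x' \<otimes> y)))"
    using norm_triangle_ineq4[of "f (x \<otimes> y) - f (x' \<otimes> y)" "f (a \<otimes> (x \<otimes> y)) - f (a \<otimes> (x' \<otimes> y))"]
    by (simp add: F_def algebra_simps)
  ultimately show ?thesis by simp
qed

lemma wave_F: "wave f a v x = M (\<lambda>y. F (x \<otimes> y) * v y)"
  by (simp add: wave_def F_def)

lemma wave_bounded: "bounded_fun G v \<Longrightarrow> bounded_fun G (wave f a v)"
  using bounded_fun_correlation[OF F_bounded, of v] by (simp add: wave_F[abs_def])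

lemma wave_le:
  assumes v: "bounded_fun G v" "nsq v \<le> 1" and x: "x \<in> carrier G"
  shows "norm (wave f a v x) \<le> 2 * B"
  unfolding wave_F by (rule norm_M_mult_le[OF _ v]) (use x F_bound in auto)

lemma wave_near:
  assumes v: "bounded_fun G v" "nsq v \<le> 1" and x: "x \<in> carrier G" "x' \<in> carrier G" "near G f e x x'"
  shows "norm (wave f a v x - wave f a v x') \<le> 2 * e"
proof -
  have "wave f a v x - wave f a v x' = M (\<lambda>y. F (x \<otimes> y) * v y - F (x' \<otimes> y) * v y)"
    unfolding wave_F using v x F_bounded bounded_fun_translate by (simp add: M_diff)
  also have "\<dots> = M (\<lambda>y. (F (x \<otimes> y) - F (x' \<otimes> y)) * v y)" by (simp add: algebra_simps)
  also have "norm \<dots> \<le> 2 * e"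
    by (rule norm_M_mult_le[OF _ v]) (use F_near x in auto)
  finally show ?thesis .
qed

lemma wave_scale:
  assumes v: "bounded_fun G v" and x: "x \<in> carrier G"
  shows "wave f a (\<lambda>y. c * v y) x = c * wave f a v x"
proof -
  have "bounded_fun G (\<lambda>y. F (x \<otimes> y) * v y)"
    using F_bounded v x bounded_fun_translate by auto
  from M_cmult[OF this, of c] show ?thesis by (simp add: wave_F mult_ac)
qed

text \<open>Translating \<open>v\<close> by \<open>b\<close> inside the correlation amounts, after
  an invariant shift, to translating the wave by \<open>inv b\<close>; hence the inverse in the
  statement of \<open>self_mix\<close>.\<close>

lemma wave_mix:
  assumes v: "bounded_fun G v" and b: "b \<in> carrier G" and x: "x \<in> carrier G"
  shows "wave f a (\<lambda>y. (v y + z * v (b \<otimes> y)) / 2) x = (wave f a v x + z * wave f a v (inv b \<otimes> x)) / 2"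
proof -
  define p where "p y = F (x \<otimes> y) * v y" for y
  define q where "q y = F (x \<otimes> y) * v (b \<otimes> y)" for y
  have bd: "bounded_fun G p" "bounded_fun G q"
    using F_bounded v x b bounded_fun_translate unfolding p_def[abs_def] q_def[abs_def] by auto
  have "wave f a (\<lambda>y. (v y + z * v (b \<otimes> y)) / 2) x = M (\<lambda>y. 1/2 * p y + z/2 * q y)"
    by (simp add: wave_F p_def q_def field_simps)
  also have "\<dots> = 1/2 * M p + z/2 * M q"
    using bd by (simp only: M_add M_cmult bounded_fun_mult bounded_fun_const)
  also have "M q = M (\<lambda>y. q (inv b \<otimes> y))" using M_shift[of "inv b" q] b by simp
  also have "\<dots> = wave f a v (inv b \<otimes> x)"
    unfolding wave_F
  proof (rule M_cong)
    fix y assume y: "y \<in> carrier G"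
    have "b \<otimes> (inv b \<otimes> y) = y" using b y by (simp add: m_assoc[symmetric])
    moreover have "x \<otimes> (inv b \<otimes> y) = inv b \<otimes> x \<otimes> y" using b x y by (simp add: m_assoc m_lcomm)
    ultimately show "q (inv b \<otimes> y) = F (inv b \<otimes> x \<otimes> y) * v y" by (simp add: q_def)
  qed
  finally show ?thesis by (simp add: wave_F p_def field_simps)
qed

text \<open>Averaging \<open>v\<close> with a rotated translate realises the multiplier
  \<open>mix\<close> on the autocorrelation, so \<open>mix\<close> can be applied while staying
  among functions that come from some \<open>v\<close>.\<close>

lemma autoc_mix:
  assumes v: "bounded_fun G v" and b: "b \<in> carrier G" and z: "norm z = 1"
  shows "autoc f a (\<lambda>y. (v y + z * v (b \<otimes> y)) / 2) = mix z b (autoc f a v)"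
proof -
  have "autoc f a (\<lambda>y. (v y + z * v (b \<otimes> y)) / 2) =
      self (\<lambda>x. (wave f a v x + z * wave f a v (inv b \<otimes> x)) / 2)"
    unfolding autoc_def by (rule self_cong) (rule wave_mix[OF v b])
  also have "\<dots> = mix z b (autoc f a v)"
    unfolding autoc_def using self_mix[OF wave_bounded[OF v] b z] by blast
  finally show ?thesis .
qed

text \<open>The square norm is the autocorrelation at the identity, so \<open>self_mix\<close>
  evaluates it through \<open>self v b\<close>. A bound that depends on \<open>v\<close> only
  through \<open>self v\<close> survives the passage to limits.\<close>

lemma nsq_mix_le:
  assumes v: "bounded_fun G v" "nsq v \<le> 1" and b: "b \<in> carrier G" and z: "norm z = 1"
  shows "nsq (\<lambda>y. (v y + z * v (b \<otimes> y)) / 2) \<le> (1 + Re (z * self v b)) / 2"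
proof -
  define u where "u y = (v y + z * v (inv (inv b) \<otimes> y)) / 2" for y
  have bu: "bounded_fun G u"
    unfolding u_def[abs_def]
    by (intro bounded_fun_divide bounded_fun_add bounded_fun_mult bounded_fun_const v
        bounded_fun_translate[OF v(1)]) (use b in simp)
  have ib: "inv b \<in> carrier G" using b by simp
  have "nsq u = Re (self u \<one>)" by (rule self_one[OF bu, symmetric])
  also have "self u \<one> = mix z (inv b) (self v) \<one>"
    unfolding u_def by (rule self_mix[OF v(1) ib z])
  also have "Re \<dots> = nsq v / 2 + (Re (z * self v b) + Re (cnj z * self v (inv b))) / 4"
    using b self_one[OF v(1)] by (simp add: mix_def)
  also have "self v (inv b) = cnj (self v b)"
  proof -
    have "self v (inv b) = M (\<lambda>y. v (inv b \<otimes> y) * cnj (v y))" using b by (simp add: self_def ip_def)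
    also have "\<dots> = M (\<lambda>y. v (inv b \<otimes> (b \<otimes> y)) * cnj (v (b \<otimes> y)))"
      by (rule M_shift[OF b, symmetric])
    also have "\<dots> = ip v (\<lambda>y. v (b \<otimes> y))"
      unfolding ip_def by (rule M_cong) (use b in \<open>simp add: m_assoc[symmetric]\<close>)
    also have "\<dots> = cnj (self v b)"
      using ip_cnj[OF bounded_fun_translate[OF v(1) b] v(1)] b by (simp add: self_def)
    finally show ?thesis .
  qed
  also have "Re (cnj z * cnj (self v b)) = Re (z * self v b)" by simp
  finally have "nsq u \<le> (1 + Re (z * self v b)) / 2"
    using v(2) by (simp del: times_complex.sel)
  then show ?thesis using b by (simp add: u_def[abs_def] del: times_complex.sel)
qed

lemma autoc_le:
  assumes v: "bounded_fun G v" "nsq v \<le> 1" shows "norm (autoc f a v x) \<le> 4 * B\<^sup>2"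
proof (cases "x \<in> carrier G")
  case x: True
  have "norm (M (\<lambda>y. wave f a v (x \<otimes> y) * cnj (wave f a v y))) \<le> 4 * B\<^sup>2"
  proof (rule M_norm_le)
    fix y assume y: "y \<in> carrier G"
    have "norm (wave f a v (x \<otimes> y) * cnj (wave f a v y)) \<le> (2 * B) * (2 * B)"
      unfolding norm_mult complex_mod_cnj
      using wave_le[OF v] x y B_pos by (intro mult_mono) auto
    then show "norm (wave f a v (x \<otimes> y) * cnj (wave f a v y)) \<le> 4 * B\<^sup>2"
      by (simp add: power2_eq_square)
  qed
  then show ?thesis using x by (simp add: autoc_def self_def ip_def)
qed (simp add: autoc_def self_def)

text \<open>The constant is the product of the Lipschitz constant \<open>2\<close> and the bound
  \<open>2 * B\<close> of a wave. Being independent of \<open>v\<close>, it makes the family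
  equicontinuous.\<close>

lemma autoc_controlled:
  assumes v: "bounded_fun G v" "nsq v \<le> 1" shows "controlled G f (4 * B) (autoc f a v)"
  unfolding controlled_def
proof (intro ballI allI impI)
  fix x x' e assume x: "x \<in> carrier G" "x' \<in> carrier G" "near G f e x x'"
  let ?w = "wave f a v"
  have bw: "bounded_fun G ?w" by (rule wave_bounded[OF v(1)])
  have "autoc f a v x - autoc f a v x' = M (\<lambda>y. ?w (x \<otimes> y) * cnj (?w y) - ?w (x' \<otimes> y) * cnj (?w y))"
    using x bw bounded_fun_translate[OF bw] by (simp add: autoc_def self_def ip_def M_diff)
  also have "norm \<dots> \<le> 4 * B * e"
  proof (rule M_norm_le)
    fix y assume y: "y \<in> carrier G"
    have "near G f e (x \<otimes> y) (x' \<otimes> y)"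
      using near_translate[OF x(3,1,2) y] x y by (simp add: m_comm)
    then have 1: "norm (?w (x \<otimes> y) - ?w (x' \<otimes> y)) \<le> 2 * e"
      using wave_near[OF v] x y by simp
    have "?w (x \<otimes> y) * cnj (?w y) - ?w (x' \<otimes> y) * cnj (?w y) = (?w (x \<otimes> y) - ?w (x' \<otimes> y)) * cnj (?w y)"
      by (simp add: algebra_simps)
    also have "norm \<dots> \<le> (2 * e) * (2 * B)"
      unfolding norm_mult complex_mod_cnj
      using 1 wave_le[OF v y] near_nonneg[OF x(3)] by (intro mult_mono) auto
    finally show "norm (?w (x \<otimes> y) * cnj (?w y) - ?w (x' \<otimes> y) * cnj (?w y)) \<le> 4 * B * e"
      by (simp add: mult_ac)
  qed
  finally show "norm (autoc f a v x - autoc f a v x') \<le> 4 * B * e" .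
qed

text \<open>A compact set that contains all attainable pairs. The second component is recorded
  because \<open>mix_bound\<close> needs the limit of \<open>self v\<close> along with that of
  \<open>autoc f a v\<close>.\<close>

definition state_space :: "(('a \<Rightarrow> complex) \<times> ('a \<Rightarrow> complex)) set" where
  "state_space = {p. (\<forall>x. norm (fst p x) \<le> 4 * B\<^sup>2) \<and> (\<forall>x. norm (snd p x) \<le> 1) \<and>
     controlled G f (4 * B) (fst p)}"

lemma continuous_on_coord:
  fixes S :: "(('a \<Rightarrow> complex) \<times> ('a \<Rightarrow> complex)) set"
  shows "continuous_on S (\<lambda>p. fst p x)" "continuous_on S (\<lambda>p. snd p x)"
proof -
  have "continuous_on S fst" "continuous_on S snd"
    by (intro continuous_on_fst continuous_on_snd continuous_on_id)+
  then show "continuous_on S (\<lambda>p. fst p x)" "continuous_on S (\<lambda>p. snd p x)"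
    by (auto intro: continuous_on_product_then_coordinatewise)
qed

lemma closed_state_space: "closed state_space"
proof -
  have c: "closed {p :: ('a \<Rightarrow> complex) \<times> ('a \<Rightarrow> complex). norm (fst p x) \<le> c}"
    "closed {p :: ('a \<Rightarrow> complex) \<times> ('a \<Rightarrow> complex). norm (snd p x) \<le> c}"
    "closed {p :: ('a \<Rightarrow> complex) \<times> ('a \<Rightarrow> complex). norm (fst p x - fst p x') \<le> c}" for x x' c
    by (intro closed_Collect_le continuous_on_norm continuous_on_diff continuous_on_coord
        continuous_on_const)+
  show ?thesis
    unfolding state_space_def controlled_def Ball_def
    by (intro closed_Collect_conj closed_Collect_all closed_Collect_imp open_Collect_const c)
qed

lemma compact_state_space: "compact state_space"
proof -
  have "compact (Pi\<^sub>E UNIV (\<lambda>_::'a. cball (0::complex) c))" for c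
    using compactin_PiE[of "\<lambda>_. euclidean" UNIV "\<lambda>_::'a. cball (0::complex) c"]
    by (simp add: euclidean_product_topology)
  then have "compact (Pi\<^sub>E UNIV (\<lambda>_::'a. cball (0::complex) (4 * B\<^sup>2)) \<times>
      Pi\<^sub>E UNIV (\<lambda>_::'a. cball (0::complex) 1) \<inter> state_space)"
    by (intro compact_Int_closed compact_Times closed_state_space)
  moreover have "Pi\<^sub>E UNIV (\<lambda>_::'a. cball (0::complex) (4 * B\<^sup>2)) \<times>
      Pi\<^sub>E UNIV (\<lambda>_::'a. cball (0::complex) 1) \<inter> state_space = state_space"
    by (auto simp: state_space_def PiE_iff)
  ultimately show ?thesis by simp
qed

definition states :: "(('a \<Rightarrow> complex) \<times> ('a \<Rightarrow> complex)) set" where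
  "states = {(autoc f a v, self v) | v. bounded_fun G v \<and> nsq v \<le> 1}"

lemma states_subset: "states \<subseteq> state_space"
  unfolding states_def state_space_def
  using autoc_le autoc_controlled norm_self_le by auto

lemma closure_states_subset: "closure states \<subseteq> state_space"
  by (rule closure_minimal[OF states_subset closed_state_space])

lemma norm_mix_le:
  fixes p q r z :: complex
  assumes "norm z = 1"
  shows "norm (p / 2 + (z * q + cnj z * r) / 4) \<le> norm p / 2 + (norm q + norm r) / 4"
proof -
  have "norm (p / 2 + (z * q + cnj z * r) / 4) \<le> norm (p / 2) + norm ((z * q + cnj z * r) / 4)"
    by (rule norm_triangle_ineq)
  also have "\<dots> = norm p / 2 + norm (z * q + cnj z * r) / 4"
    by (simp only: norm_divide norm_numeral)
  also have "norm (z * q + cnj z * r) \<le> norm q + norm r"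
    using norm_triangle_ineq[of "z * q" "cnj z * r"] assms by (simp add: norm_mult)
  finally show ?thesis by simp
qed

lemma mix_le: "(\<And>x. norm (\<phi> x) \<le> c) \<Longrightarrow> norm z = 1 \<Longrightarrow> norm (mix z b \<phi> x) \<le> c"
proof -
  assume c: "\<And>x. norm (\<phi> x) \<le> c" and z: "norm z = 1"
  have "0 \<le> c" using c[of x] norm_ge_zero order_trans by blast
  moreover have "norm (\<phi> x) / 2 + (norm (\<phi> (inv b \<otimes> x)) + norm (\<phi> (b \<otimes> x))) / 4 \<le> c"
    using c[of x] c[of "inv b \<otimes> x"] c[of "b \<otimes> x"] by argo
  ultimately show ?thesis
    unfolding mix_def using order_trans[OF norm_mix_le[OF z]] by (simp only: norm_zero split: if_split) blast
qed

lemma mix_controlled: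
  assumes "controlled G f K \<phi>" "b \<in> carrier G" "norm z = 1"
  shows "controlled G f K (mix z b \<phi>)"
  unfolding controlled_def
proof (intro ballI allI impI)
  fix x x' e assume x: "x \<in> carrier G" "x' \<in> carrier G" "near G f e x x'"
  have 1: "norm (\<phi> x - \<phi> x') \<le> K * e" "norm (\<phi> (inv b \<otimes> x) - \<phi> (inv b \<otimes> x')) \<le> K * e"
    "norm (\<phi> (b \<otimes> x) - \<phi> (b \<otimes> x')) \<le> K * e"
    using assms x by (auto intro!: controlledD[OF assms(1)] near_translate)
  have "mix z b \<phi> x - mix z b \<phi> x' = (\<phi> x - \<phi> x') / 2 +
      (z * (\<phi> (inv b \<otimes> x) - \<phi> (inv b \<otimes> x')) + cnj z * (\<phi> (b \<otimes> x) - \<phi> (b \<otimes> x'))) / 4"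
    using x by (simp add: mix_def field_simps)
  also have "norm \<dots> \<le>
      norm (\<phi> x - \<phi> x') / 2 + (norm (\<phi> (inv b \<otimes> x) - \<phi> (inv b \<otimes> x')) + norm (\<phi> (b \<otimes> x) - \<phi> (b \<otimes> x'))) / 4"
    by (rule norm_mix_le[OF assms(3)])
  also have "\<dots> \<le> K * e" using 1 by argo
  finally show "norm (mix z b \<phi> x - mix z b \<phi> x') \<le> K * e" .
qed

lemma continuous_on_nsq_fst: "continuous_on state_space (\<lambda>p. nsq (fst p))"
  by (rule continuous_on_nsq[OF f_ap, where K = "4 * B" and B = "4 * B\<^sup>2"])
    (auto simp: state_space_def intro: continuous_on_coord)

lemma continuous_on_nsq_mix:
  assumes "b \<in> carrier G" "norm z = 1"
  shows "continuous_on state_space (\<lambda>p. nsq (mix z b (fst p)))"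
proof (rule continuous_on_nsq[OF f_ap, where K = "4 * B" and B = "4 * B\<^sup>2"])
  show "continuous_on state_space (\<lambda>p. mix z b (fst p) x)" if "x \<in> carrier G" for x
    unfolding mix_def using that by (auto intro!: continuous_intros continuous_on_coord)
  show "controlled G f (4 * B) (mix z b (fst p))" if "p \<in> state_space" for p
    using that assms by (intro mix_controlled) (auto simp: state_space_def)
  show "norm (mix z b (fst p) x) \<le> 4 * B\<^sup>2" if "p \<in> state_space" for p x
    using that assms by (intro mix_le) (auto simp: state_space_def)
qed

end

section \<open>Existence and rigidity of a maximizer\<close>

context bohr
begin

lemma statesI: "bounded_fun G v \<Longrightarrow> nsq v \<le> 1 \<Longrightarrow> (autoc f a v, self v) \<in> states"
  unfolding states_def mem_Collect_eq by (intro exI[of _ v] conjI refl)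

lemma autoc_bounded: "bounded_fun G v \<Longrightarrow> bounded_fun G (autoc f a v)"
proof -
  assume v: "bounded_fun G v"
  have "bounded_fun G (\<lambda>x. M (\<lambda>y. wave f a v (x \<otimes> y) * cnj (wave f a v y)))"
    by (intro bounded_fun_correlation wave_bounded bounded_fun_cnj v)
  then show ?thesis
    by (rule bounded_fun_cong[THEN iffD1, rotated]) (simp add: autoc_def self_def ip_def)
qed

text \<open>\<open>autoc\<close> is quadratic in \<open>v\<close> and \<open>nsq\<close> is
  quadratic again, hence the fourth power.\<close>

lemma nsq_autoc_scale:
  assumes v: "bounded_fun G v"
  shows "nsq (autoc f a (\<lambda>y. of_real c * v y)) = c^4 * nsq (autoc f a v)"
proof -
  have "autoc f a (\<lambda>y. of_real c * v y) = self (\<lambda>x. of_real c * wave f a v x)"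
    unfolding autoc_def by (rule self_cong) (rule wave_scale[OF v])
  also have "\<dots> = (\<lambda>x. of_real (c\<^sup>2) * autoc f a v x)"
    unfolding autoc_def using self_scale[OF wave_bounded[OF v], of "of_real c"]
    by (simp add: power2_eq_square fun_eq_iff)
  finally have "nsq (autoc f a (\<lambda>y. of_real c * v y)) = (norm (of_real (c\<^sup>2) :: complex))\<^sup>2 * nsq (autoc f a v)"
    using nsq_scale[OF autoc_bounded[OF v]] by simp
  also have "(norm (of_real (c\<^sup>2) :: complex))\<^sup>2 = c^4"
    by (simp only: norm_of_real abs_power2) (simp flip: power_mult)
  finally show ?thesis .
qed

text \<open>The maximum is sought on the closure of the attainable pairs, a closed part of the
  compact \<open>state_space\<close>, because a limit pair need not come from any
  \<open>v\<close>.\<close>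

lemma maximizer_exists:
  obtains \<phi> s where "(\<phi>, s) \<in> closure states" "\<And>p. p \<in> closure states \<Longrightarrow> nsq (fst p) \<le> nsq \<phi>"
proof -
  have "compact (state_space \<inter> closure states)"
    by (intro compact_Int_closed compact_state_space closed_closure)
  then have "compact (closure states)" using closure_states_subset by (simp add: Int_absorb1)
  moreover have "(autoc f a (\<lambda>_. 0), self (\<lambda>_. 0)) \<in> states"
    using M_const[of 0] by (intro statesI) (simp_all add: nsq_def ip_def)
  then have "closure states \<noteq> {}" using closure_subset by blast
  moreover have "continuous_on (closure states) (\<lambda>p. nsq (fst p))"
    by (rule continuous_on_subset[OF continuous_on_nsq_fst closure_states_subset])
  ultimately show ?thesis using continuous_attains_sup that by (metis prod.collapse)
qed

text \<open>By homogeneity \<open>nsq v \<le> r\<close> implies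
  \<open>nsq (autoc f a v) \<le> \<nu> * r\<^sup>2\<close>. Applied to the average from
  \<open>nsq_mix_le\<close>, this gives the bound on \<open>states\<close>; both sides are
  continuous in the pair, so it extends to the closure.\<close>

lemma mix_bound:
  assumes max: "\<And>p. p \<in> closure states \<Longrightarrow> nsq (fst p) \<le> \<nu>"
    and p: "p \<in> closure states" and b: "b \<in> carrier G" and z: "norm z = 1"
  shows "nsq (mix z b (fst p)) \<le> \<nu> * ((1 + Re (z * snd p b)) / 2)\<^sup>2"
proof -
  have scaled: "nsq (autoc f a v) \<le> \<nu> * r\<^sup>2" if v: "bounded_fun G v" and r: "nsq v \<le> r" "0 < r" for v r
  proof -
    define c where "c = 1 / sqrt r"
    have c: "c\<^sup>2 = 1 / r" using r by (simp add: c_def power_divide)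
    then have c4: "c^4 = 1 / r\<^sup>2"
      using power_mult[of c 2 2] by (simp add: power_divide)
    have "nsq (\<lambda>y. of_real c * v y) = nsq v / r"
      using nsq_scale[OF v, of "of_real c"] c by simp
    then have "nsq (\<lambda>y. of_real c * v y) \<le> 1" using r by simp
    then have "(autoc f a (\<lambda>y. of_real c * v y), self (\<lambda>y. of_real c * v y)) \<in> states"
      using v by (intro statesI) auto
    then have "nsq (autoc f a (\<lambda>y. of_real c * v y)) \<le> \<nu>"
      using max[OF subsetD[OF closure_subset]] by (metis fst_conv)
    then show ?thesis using r by (simp add: nsq_autoc_scale[OF v] c4 divide_le_eq)
  qed
  define h where "h p = nsq (mix z b (fst p)) - \<nu> * ((1 + Re (z * snd p b)) / 2)\<^sup>2" for p
  have "states \<subseteq> {p \<in> state_space. h p \<le> 0}"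
  proof
    fix p assume "p \<in> states"
    then obtain v where v: "bounded_fun G v" "nsq v \<le> 1" and p: "p = (autoc f a v, self v)"
      unfolding states_def by auto
    define t where "t = (1 + Re (z * self v b)) / 2"
    define u where "u y = (v y + z * v (b \<otimes> y)) / 2" for y
    have bu: "bounded_fun G u"
      unfolding u_def[abs_def]
      by (intro bounded_fun_divide bounded_fun_add bounded_fun_mult bounded_fun_const v
          bounded_fun_translate[OF v(1)] b)
    have t0: "0 \<le> t"
    proof -
      have "\<bar>Re (z * self v b)\<bar> \<le> norm (z * self v b)" by (rule abs_Re_le_cmod)
      also have "\<dots> \<le> 1" using norm_self_le[OF v] z by (simp add: norm_mult)
      finally have "-1 \<le> Re (z * self v b)" by linarith
      then show ?thesis unfolding t_def by argo
    qed
    have ut: "nsq u \<le> t" unfolding u_def t_def by (rule nsq_mix_le[OF v b z])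
    \<comment> \<open>The bound \<open>t\<close> may be \<open>0\<close>, where rescaling is
      impossible, so it is raised by a null sequence.\<close>
    have "nsq (autoc f a u) \<le> \<nu> * (t + 0)\<^sup>2"
    proof (rule LIMSEQ_le_const)
      show "(\<lambda>n. \<nu> * (t + inverse (real (Suc n)))\<^sup>2) \<longlonglongrightarrow> \<nu> * (t + 0)\<^sup>2"
        by (intro tendsto_intros LIMSEQ_inverse_real_of_nat)
      have "nsq (autoc f a u) \<le> \<nu> * (t + inverse (real (Suc n)))\<^sup>2" for n
      proof (rule scaled[OF bu])
        have "0 < inverse (real (Suc n))" by simp
        then show "nsq u \<le> t + inverse (real (Suc n))" "0 < t + inverse (real (Suc n))"
          using ut t0 by linarith+
      qed
      then show "\<exists>N. \<forall>n\<ge>N. nsq (autoc f a u) \<le> \<nu> * (t + inverse (real (Suc n)))\<^sup>2" by blast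
    qed
    moreover have "autoc f a u = mix z b (autoc f a v)" unfolding u_def by (rule autoc_mix[OF v(1) b z])
    ultimately have "h p \<le> 0" by (simp add: h_def p t_def del: times_complex.sel)
    then show "p \<in> {p \<in> state_space. h p \<le> 0}" using \<open>p \<in> states\<close> states_subset by blast
  qed
  moreover have "closed {p \<in> state_space. h p \<le> 0}"
  proof -
    have "continuous_on state_space h"
      unfolding h_def
      by (intro continuous_on_diff continuous_on_nsq_mix[OF b z] continuous_on_mult
          continuous_on_const continuous_on_power continuous_on_divide continuous_on_add
          continuous_on_Re continuous_on_coord) auto
    then have "closed (state_space \<inter> h -` {..0})"
      by (rule continuous_closed_preimage[OF _ closed_state_space]) simp
    moreover have "state_space \<inter> h -` {..0} = {p \<in> state_space. h p \<le> 0}" by auto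
    ultimately show ?thesis by simp
  qed
  ultimately have "p \<in> {p \<in> state_space. h p \<le> 0}" using p closure_minimal by blast
  then show ?thesis by (simp add: h_def del: times_complex.sel)
qed

text \<open>Since \<open>\<phi> = mix z b \<phi> + mix (-z) b \<phi>\<close>, strict convexity of the square norm turns the two
  bounds \<open>mix_bound\<close> into equalities at a maximizer \<open>\<phi>\<close>, and makes \<open>\<phi>\<close> an eigenvector of all
  translations.\<close>

lemma maximizer_mix:
  fixes \<phi> s :: "'a \<Rightarrow> complex"
  assumes max: "\<And>p. p \<in> closure states \<Longrightarrow> nsq (fst p) \<le> nsq \<phi>"
    and p: "(\<phi>, s) \<in> closure states" and b: "b \<in> carrier G" and z: "norm z = 1"
    and x: "x \<in> carrier G"
  shows "mix z b \<phi> x = of_real ((1 + Re (z * s b)) / 2) * \<phi> x"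
proof -
  define t where "t = (1 + Re (z * s b)) / 2"
  define w where "w = mix z b \<phi>"
  have "(\<phi>, s) \<in> state_space" by (rule subsetD[OF closure_states_subset p])
  then have \<phi>: "controlled G f (4 * B) \<phi>" "\<And>x. norm (\<phi> x) \<le> 4 * B\<^sup>2" and s: "norm (s b) \<le> 1"
    by (auto simp: state_space_def)
  have b\<phi>: "bounded_fun G \<phi>" by (rule bounded_funI[OF \<phi>(2)])
  have w: "controlled G f (4 * B) w" unfolding w_def by (rule mix_controlled[OF \<phi>(1) b z])
  have bw: "bounded_fun G w"
    unfolding w_def by (rule bounded_funI, rule mix_le[OF \<phi>(2) z])
  have t: "0 \<le> t" "t \<le> 1"
  proof -
    have "\<bar>Re (z * s b)\<bar> \<le> norm (z * s b)" by (rule abs_Re_le_cmod)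
    also have "\<dots> \<le> 1" using s z by (simp add: norm_mult)
    finally have "-1 \<le> Re (z * s b)" "Re (z * s b) \<le> 1" by linarith+
    then show "0 \<le> t" "t \<le> 1" unfolding t_def by argo+
  qed
  have P: "nsq w \<le> nsq \<phi> * t\<^sup>2"
    using mix_bound[of "nsq \<phi>", OF max p b z] by (simp add: w_def t_def del: times_complex.sel)
  \<comment> \<open>The complementary multiplier sends \<phi> to \<phi> minus \<open>w\<close>, and
    its bound carries the factor \<open>1 - t\<close>.\<close>
  have "nsq (mix (-z) b \<phi>) \<le> nsq \<phi> * ((1 + Re (- z * s b)) / 2)\<^sup>2"
    using mix_bound[of "nsq \<phi>", OF max p b, of "-z"] z by (simp del: times_complex.sel)
  also have "(1 + Re (- z * s b)) / 2 = 1 - t" by (simp add: t_def field_simps)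
  also have "nsq (mix (-z) b \<phi>) = nsq (\<lambda>x. \<phi> x - 1 * w x)"
    by (rule nsq_cong) (simp add: w_def mix_def field_simps)
  also have "\<dots> = nsq \<phi> - 2 * Re (ip \<phi> w) + nsq w"
    using nsq_diff_scale[OF b\<phi> bw, of 1] by simp
  finally have Q: "nsq \<phi> - 2 * Re (ip \<phi> w) + nsq w \<le> nsq \<phi> * (1 - t)\<^sup>2" .
  have "nsq (\<lambda>x. w x - of_real t * \<phi> x) = nsq w - 2 * t * Re (ip w \<phi>) + t\<^sup>2 * nsq \<phi>"
    using nsq_diff_scale[OF bw b\<phi>, of "of_real t"] by simp
  also have "Re (ip w \<phi>) = Re (ip \<phi> w)" using ip_cnj[OF b\<phi> bw] by (metis cnj.sel(1))
  \<comment> \<open>The left side equals (1 - t) nsq w + t nsq (\<phi> - w) - t (1 - t) nsq \<phi>.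
    Inserting the bounds \<open>P\<close> and \<open>Q\<close> leaves nsq \<phi> times t (1 - t) (t
    + (1 - t) - 1), which is 0.\<close>
  also have "nsq w - 2 * t * Re (ip \<phi> w) + t\<^sup>2 * nsq \<phi> \<le> 0"
  proof -
    have "t * (nsq \<phi> - 2 * Re (ip \<phi> w) + nsq w) \<le> t * (nsq \<phi> * (1 - t)\<^sup>2)"
      by (rule mult_left_mono[OF Q t(1)])
    moreover have "(1 - t) * nsq w \<le> (1 - t) * (nsq \<phi> * t\<^sup>2)"
      using P t by (intro mult_left_mono) auto
    ultimately show ?thesis by (simp add: algebra_simps power2_eq_square)
  qed
  finally have "nsq (\<lambda>x. w x - of_real t * \<phi> x) \<le> 0" .
  from nsq_le_zeroD[OF f_ap controlled_diff_scale[OF w \<phi>(1)] _ this x] bw b\<phi>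
  have "w x - of_real t * \<phi> x = 0" by auto
  then show ?thesis by (simp add: w_def t_def)
qed

text \<open>The choices \<open>1\<close> and \<i> for \<open>z\<close> give the sum and the
  difference of \<phi> at the translates by \<open>b\<close> and by its inverse, which together
  determine each of them.\<close>

lemma maximizer_translate:
  fixes \<phi> s :: "'a \<Rightarrow> complex"
  assumes max: "\<And>p. p \<in> closure states \<Longrightarrow> nsq (fst p) \<le> nsq \<phi>"
    and p: "(\<phi>, s) \<in> closure states" and b: "b \<in> carrier G" and x: "x \<in> carrier G"
  shows "\<phi> (b \<otimes> x) = cnj (s b) * \<phi> x"
proof -
  have 1: "\<phi> x / 2 + (1 * \<phi> (inv b \<otimes> x) + cnj 1 * \<phi> (b \<otimes> x)) / 4 = of_real ((1 + Re (1 * s b)) / 2) * \<phi> x"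
    using maximizer_mix[OF max p b _ x, of 1] x by (simp add: mix_def)
  have 2: "\<phi> x / 2 + (\<i> * \<phi> (inv b \<otimes> x) + cnj \<i> * \<phi> (b \<otimes> x)) / 4 = of_real ((1 + Re (\<i> * s b)) / 2) * \<phi> x"
    using maximizer_mix[OF max p b _ x, of \<i>] x by (simp add: mix_def)
  have solve: "q = 2 * c * p" if "p / 2 + q / 4 = (1 + c) / 2 * p" for p q c :: complex
  proof -
    have "q = 4 * (p / 2 + q / 4) - 2 * p" by (simp add: distrib_left)
    also have "\<dots> = 2 * c * p" unfolding that by (simp add: algebra_simps)
    finally show ?thesis .
  qed
  from 1 have A: "\<phi> (inv b \<otimes> x) + \<phi> (b \<otimes> x) = 2 * of_real (Re (s b)) * \<phi> x"
    using solve[of "\<phi> x" "\<phi> (inv b \<otimes> x) + \<phi> (b \<otimes> x)" "of_real (Re (s b))"] by simp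
  from 2 have "\<i> * (\<phi> (inv b \<otimes> x) - \<phi> (b \<otimes> x)) = - 2 * of_real (Im (s b)) * \<phi> x"
    using solve[of "\<phi> x" "\<i> * (\<phi> (inv b \<otimes> x) - \<phi> (b \<otimes> x))" "- of_real (Im (s b))"]
    by (simp add: right_diff_distrib)
  then have "\<i> * (\<i> * (\<phi> (inv b \<otimes> x) - \<phi> (b \<otimes> x))) = \<i> * (- 2 * of_real (Im (s b)) * \<phi> x)" by simp
  then have C: "\<phi> (b \<otimes> x) - \<phi> (inv b \<otimes> x) = - 2 * \<i> * of_real (Im (s b)) * \<phi> x"
    by (simp add: algebra_simps)
  have "2 * \<phi> (b \<otimes> x) = (\<phi> (inv b \<otimes> x) + \<phi> (b \<otimes> x)) + (\<phi> (b \<otimes> x) - \<phi> (inv b \<otimes> x))" by simp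
  also have "\<dots> = 2 * ((of_real (Re (s b)) - \<i> * of_real (Im (s b))) * \<phi> x)"
    unfolding A C by (simp add: algebra_simps)
  also have "of_real (Re (s b)) - \<i> * of_real (Im (s b)) = cnj (s b)" by (simp add: complex_eq_iff)
  finally show ?thesis by simp
qed

text \<open>The test function is the conjugate of \<open>F\<close>, scaled to be admissible: its
  wave at the identity is the square norm of \<open>F\<close> up to a factor. Strict positivity of
  the mean then leads from \<open>F\<close> to the wave and on to its autocorrelation.\<close>

lemma maximizer_pos:
  assumes max: "\<And>p. p \<in> closure states \<Longrightarrow> nsq (fst p) \<le> nsq \<phi>"
  shows "0 < nsq \<phi>"
proof -
  define v where "v y = cnj (F y) / of_real (2 * B)" for y
  have bv: "bounded_fun G v" unfolding v_def[abs_def] using F_bounded by auto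
  have v1: "nsq v \<le> 1"
  proof -
    have "norm (v y) \<le> 1" if "y \<in> carrier G" for y
      using F_bound[OF that] B_pos by (simp add: v_def norm_divide)
    from nsq_le[OF this] show ?thesis by simp
  qed
  define w where "w = wave f a v"
  have bw: "bounded_fun G w" unfolding w_def by (rule wave_bounded[OF bv])
  have "controlled G f 2 F"
    unfolding controlled_def using F_near[of _ _ _ \<one>] by simp
  moreover have "F \<one> \<noteq> 0" using f_a a by (simp add: F_def)
  ultimately have "0 < nsq F" using nsq_le_zeroD[OF f_ap _ F_bounded _ one_closed] by fastforce
  moreover have "w \<one> = ip F F / of_real (2 * B)"
  proof -
    have "w \<one> = M (\<lambda>y. (1 / of_real (2 * B)) * (F y * cnj (F y)))"
      unfolding w_def wave_F by (rule M_cong) (simp add: v_def)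
    also have "\<dots> = (1 / of_real (2 * B)) * ip F F"
      unfolding ip_def by (rule M_cmult) (use F_bounded in auto)
    finally show ?thesis by simp
  qed
  ultimately have "w \<one> \<noteq> 0" using B_pos by (auto simp: nsq_def)
  moreover have "controlled G f 2 w" unfolding controlled_def w_def using wave_near[OF bv v1] by blast
  ultimately have "0 < nsq w" using nsq_le_zeroD[OF f_ap _ bw _ one_closed] by fastforce
  then have "autoc f a v \<one> \<noteq> 0"
    using self_one[OF bw] unfolding autoc_def w_def[symmetric] by auto
  then have "0 < nsq (autoc f a v)"
    using nsq_le_zeroD[OF f_ap autoc_controlled[OF bv v1] autoc_bounded[OF bv] _ one_closed] by fastforce
  moreover have "(autoc f a v, self v) \<in> closure states"
    using statesI[OF bv v1] closure_subset by blast
  ultimately show ?thesis using max[of "(autoc f a v, self v)"] by simp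
qed

text \<open>The difference \<open>f - f(a .)\<close> passes linearly through both correlations, so
  \<open>autoc f a v\<close> is itself some \<kappa> minus the translate of \<kappa> by
  \<open>a\<close>. Against an \<open>a\<close>-invariant function the two parts cancel.\<close>

lemma ip_autoc_invariant:
  assumes v: "bounded_fun G v" and \<xi>: "bounded_fun G \<xi>" "\<And>x. x \<in> carrier G \<Longrightarrow> \<xi> (a \<otimes> x) = \<xi> x"
  shows "ip (autoc f a v) \<xi> = 0"
proof -
  define U where "U x = M (\<lambda>y. f (x \<otimes> y) * v y)" for x
  define w where "w = wave f a v"
  define \<kappa> where "\<kappa> x = M (\<lambda>y. U (x \<otimes> y) * cnj (w y))" for x
  have bf: "bounded_fun G f" using f_bound by (rule bounded_funI)
  have bw: "bounded_fun G w" unfolding w_def by (rule wave_bounded[OF v])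
  have bU: "bounded_fun G U" unfolding U_def[abs_def] by (rule bounded_fun_correlation[OF bf v])
  have b\<kappa>: "bounded_fun G \<kappa>" unfolding \<kappa>_def[abs_def]
    by (rule bounded_fun_correlation[OF bU bounded_fun_cnj[OF bw]])
  have wU: "w x = U x - U (a \<otimes> x)" if x: "x \<in> carrier G" for x
  proof -
    have "bounded_fun G (\<lambda>y. f (x \<otimes> y) * v y)" "bounded_fun G (\<lambda>y. f (a \<otimes> x \<otimes> y) * v y)"
      using bounded_fun_translate[OF bf] v a x by auto
    then have "U x - U (a \<otimes> x) = M (\<lambda>y. f (x \<otimes> y) * v y - f (a \<otimes> x \<otimes> y) * v y)"
      by (simp add: U_def M_diff)
    also have "\<dots> = w x"
      unfolding w_def wave_F by (rule M_cong) (use a x in \<open>simp add: F_def m_assoc algebra_simps\<close>)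
    finally show ?thesis by simp
  qed
  have diff: "autoc f a v x = \<kappa> x - \<kappa> (a \<otimes> x)" if x: "x \<in> carrier G" for x
  proof -
    have "bounded_fun G (\<lambda>y. U (x \<otimes> y) * cnj (w y))" "bounded_fun G (\<lambda>y. U (a \<otimes> x \<otimes> y) * cnj (w y))"
      using bounded_fun_translate[OF bU] bw a x by auto
    then have "\<kappa> x - \<kappa> (a \<otimes> x) = M (\<lambda>y. U (x \<otimes> y) * cnj (w y) - U (a \<otimes> x \<otimes> y) * cnj (w y))"
      by (simp add: \<kappa>_def M_diff)
    also have "\<dots> = M (\<lambda>y. w (x \<otimes> y) * cnj (w y))"
      by (rule M_cong) (use a x in \<open>simp add: wU m_assoc algebra_simps\<close>)
    finally show ?thesis using x by (simp add: autoc_def self_def ip_def w_def)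
  qed
  have "ip (autoc f a v) \<xi> = M (\<lambda>x. \<kappa> x * cnj (\<xi> x) - \<kappa> (a \<otimes> x) * cnj (\<xi> (a \<otimes> x)))"
    unfolding ip_def by (rule M_cong) (simp add: \<xi>(2) diff left_diff_distrib)
  also have "\<dots> = M (\<lambda>x. \<kappa> x * cnj (\<xi> x)) - M (\<lambda>x. \<kappa> (a \<otimes> x) * cnj (\<xi> (a \<otimes> x)))"
    using b\<kappa> \<xi>(1) bounded_fun_translate[OF b\<kappa> a] bounded_fun_translate[OF \<xi>(1) a] by (simp add: M_diff)
  also have "\<dots> = 0" using M_shift[OF a, of "\<lambda>x. \<kappa> x * cnj (\<xi> x)"] by simp
  finally show ?thesis .
qed

text \<open>The eigenvalue \<open>cnj (s b)\<close> is multiplicative in \<open>b\<close>. It is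
  bounded by \<open>1\<close> at \<open>b\<close> and at \<open>inv b\<close>, hence unimodular, and
  it inherits control from \<phi>, of which it is a scalar multiple on the carrier.\<close>

theorem character_exists:
  "\<exists>\<xi> K. (\<forall>x\<in>carrier G. \<forall>y\<in>carrier G. \<xi> (x \<otimes> y) = \<xi> x * \<xi> y) \<and>
     (\<forall>x\<in>carrier G. norm (\<xi> x) = 1) \<and> \<xi> a \<noteq> 1 \<and> controlled G f K \<xi>"
proof -
  obtain \<phi> s where p: "(\<phi>, s) \<in> closure states"
    and max: "\<And>p. p \<in> closure states \<Longrightarrow> nsq (fst p) \<le> nsq \<phi>"
    using maximizer_exists by blast
  have "(\<phi>, s) \<in> state_space" by (rule subsetD[OF closure_states_subset p])
  then have \<phi>: "controlled G f (4 * B) \<phi>" "\<And>x. norm (\<phi> x) \<le> 4 * B\<^sup>2" and s: "\<And>b. norm (s b) \<le> 1"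
    by (auto simp: state_space_def)
  define \<xi> where "\<xi> b = cnj (s b)" for b
  have \<xi>\<phi>: "\<phi> (b \<otimes> x) = \<xi> b * \<phi> x" if "b \<in> carrier G" "x \<in> carrier G" for b x
    using maximizer_translate[OF max p that] by (simp add: \<xi>_def)
  have \<phi>1: "\<phi> b = \<xi> b * \<phi> \<one>" if "b \<in> carrier G" for b
    using \<xi>\<phi>[OF that one_closed] that by simp
  have nz: "\<phi> \<one> \<noteq> 0"
  proof
    assume "\<phi> \<one> = 0"
    then have "\<phi> b = 0" if "b \<in> carrier G" for b using \<phi>1[OF that] by simp
    then have "nsq \<phi> \<le> 0\<^sup>2" by (intro nsq_le) auto
    with maximizer_pos[OF max] show False by simp
  qed
  have mult: "\<xi> (x \<otimes> y) = \<xi> x * \<xi> y" if "x \<in> carrier G" "y \<in> carrier G" for x y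
  proof -
    have "\<xi> (x \<otimes> y) * \<phi> \<one> = \<phi> (x \<otimes> y)" using \<phi>1[of "x \<otimes> y"] that by simp
    also have "\<dots> = \<xi> x * \<xi> y * \<phi> \<one>" using \<xi>\<phi>[OF that] \<phi>1[OF that(2)] by simp
    finally show ?thesis using nz by simp
  qed
  have \<xi>1: "\<xi> \<one> = 1" using \<phi>1[OF one_closed] nz by simp
  have norm: "norm (\<xi> x) = 1" if x: "x \<in> carrier G" for x
  proof -
    have "\<xi> x * \<xi> (inv x) = 1" using mult[OF x, of "inv x"] x \<xi>1 by simp
    then have "norm (\<xi> x) * norm (\<xi> (inv x)) = 1" by (metis norm_mult norm_one)
    moreover have "norm (\<xi> x) \<le> 1" "norm (\<xi> (inv x)) \<le> 1" using s by (auto simp: \<xi>_def)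
    ultimately show ?thesis
      by (metis antisym mult.right_neutral mult_left_mono norm_ge_zero)
  qed
  have b\<xi>: "bounded_fun G \<xi>" using norm by (intro bounded_funI[where B = 1]) simp
  have "controlled G f (4 * B / norm (\<phi> \<one>)) \<xi>"
    unfolding controlled_def
  proof (intro ballI allI impI)
    fix x x' e assume x: "x \<in> carrier G" "x' \<in> carrier G" "near G f e x x'"
    have "norm (\<xi> x - \<xi> x') * norm (\<phi> \<one>) = norm (\<phi> x - \<phi> x')"
      using \<phi>1[OF x(1)] \<phi>1[OF x(2)] by (simp add: left_diff_distrib flip: norm_mult)
    also have "\<dots> \<le> 4 * B * e" using controlledD[OF \<phi>(1) x(3,1,2)] .
    finally show "norm (\<xi> x - \<xi> x') \<le> 4 * B / norm (\<phi> \<one>) * e" using nz by (simp add: field_simps)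
  qed
  \<comment> \<open>Otherwise \<xi> is \<open>a\<close>-invariant and so, by continuity, orthogonal
    to the first component of every pair in the closure, in particular to \<phi>, which is a nonzero
    multiple of \<xi>.\<close>
  moreover have "\<xi> a \<noteq> 1"
  proof
    assume "\<xi> a = 1"
    then have inv: "\<xi> (a \<otimes> x) = \<xi> x" if "x \<in> carrier G" for x using mult[OF a that] by simp
    have "continuous_on state_space (\<lambda>p. ip (fst p) \<xi>)"
      by (rule continuous_on_ip[OF f_ap, where K = "4 * B"])
        (auto simp: state_space_def b\<xi> intro: continuous_on_coord bounded_funI)
    then have "closed (state_space \<inter> (\<lambda>p. ip (fst p) \<xi>) -` {0})"
      by (rule continuous_closed_preimage[OF _ closed_state_space]) simp
    moreover have "states \<subseteq> state_space \<inter> (\<lambda>p. ip (fst p) \<xi>) -` {0}"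
      using states_subset ip_autoc_invariant[OF _ b\<xi> inv] unfolding states_def by auto
    ultimately have "closure states \<subseteq> state_space \<inter> (\<lambda>p. ip (fst p) \<xi>) -` {0}"
      by (intro closure_minimal)
    then have "ip \<phi> \<xi> = 0" using p by auto
    moreover have "ip \<phi> \<xi> = M (\<lambda>x. \<phi> \<one>)"
      unfolding ip_def
    proof (rule M_cong)
      fix x assume x: "x \<in> carrier G"
      have "\<xi> x * cnj (\<xi> x) = 1" using norm[OF x] by (simp add: complex_norm_square[symmetric])
      then show "\<phi> x * cnj (\<xi> x) = \<phi> \<one>" using \<phi>1[OF x] by (simp add: algebra_simps)
    qed
    ultimately show False using nz by (simp add: M_const)
  qed
  ultimately show ?thesis using mult norm by blast
qed

end

theorem (in comm_group) almost_periodic_character: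
  assumes "bounded_fun G f" "almost_periodic G f" "a \<in> carrier G" "f a \<noteq> f \<one>"
  obtains \<xi> K where "\<And>x y. x \<in> carrier G \<Longrightarrow> y \<in> carrier G \<Longrightarrow> \<xi> (x \<otimes> y) = \<xi> x * \<xi> y"
    "\<And>x. x \<in> carrier G \<Longrightarrow> norm (\<xi> x) = 1" "\<xi> a \<noteq> 1" "controlled G f K \<xi>"
proof -
  obtain M where M: "M \<in> means G (carrier G)" using invariant_mean_exists by blast
  obtain B where B: "\<forall>x\<in>carrier G. norm (f x) \<le> B" using assms(1) by (auto simp: bounded_fun_def)
  interpret bohr G M f a B
    using M B assms by unfold_locales auto
  show thesis using character_exists that by blast
qed

section \<open>Annihilators\<close>

lemma (in group) mem_rcos_iff:
  assumes "subgroup N G" "x \<in> carrier G" "y \<in> carrier G"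
  shows "y \<in> N #> x \<longleftrightarrow> y \<otimes> inv x \<in> N"
proof
  assume "y \<in> N #> x"
  then obtain n where n: "n \<in> N" "y = n \<otimes> x" by (auto simp: r_coset_def)
  then have "n \<in> carrier G" using assms(1) subgroup.mem_carrier by metis
  then show "y \<otimes> inv x \<in> N" using n assms by (simp add: m_assoc)
next
  assume *: "y \<otimes> inv x \<in> N"
  have "y = (y \<otimes> inv x) \<otimes> x" using assms by (simp add: m_assoc)
  then show "y \<in> N #> x" using * by (auto simp: r_coset_def)
qed

lemma (in group) rcos_eq_iff:
  assumes "subgroup N G" "x \<in> carrier G" "y \<in> carrier G"
  shows "N #> x = N #> y \<longleftrightarrow> x \<otimes> inv y \<in> N"
proof -
  have "N #> x = N #> y \<longleftrightarrow> x \<in> N #> y"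
    using repr_independence[OF _ assms(3,1), of x] rcos_self[OF assms(2,1)] by auto
  then show ?thesis using mem_rcos_iff[OF assms(1,3,2)] by simp
qed

lemma (in group) rcosets_image: "rcosets N = (\<lambda>x. N #> x) ` carrier G"
  by (auto simp: RCOSETS_def)

lemma (in group) finite_index_transversal:
  assumes N: "subgroup N G" "finite (rcosets N)"
  obtains T where "finite T" "T \<subseteq> carrier G" "card T = group_index G N"
    "\<And>x. x \<in> carrier G \<Longrightarrow> \<exists>!t. t \<in> T \<and> x \<otimes> inv t \<in> N"
proof -
  define r where "r C = (SOME x. x \<in> carrier G \<and> C = N #> x)" for C
  have r: "r C \<in> carrier G \<and> C = N #> r C" if "C \<in> rcosets N" for C
    unfolding r_def by (rule someI_ex) (use that in \<open>auto simp: rcosets_image\<close>)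
  have "inj_on r (rcosets N)" using r by (metis inj_onI)
  then have "card (r ` (rcosets N)) = group_index G N" by (simp add: group_index_def card_image)
  moreover have "\<exists>!t. t \<in> r ` (rcosets N) \<and> x \<otimes> inv t \<in> N" if x: "x \<in> carrier G" for x
  proof -
    have "x \<otimes> inv (r C) \<in> N \<longleftrightarrow> C = N #> x" if "C \<in> rcosets N" for C
      using r[OF that] rcos_eq_iff[OF N(1) x, of "r C"] by auto
    moreover have "N #> x \<in> rcosets N" using x by (simp add: rcosets_image)
    ultimately show ?thesis by (intro ex1I[of _ "r (N #> x)"]) auto
  qed
  ultimately show thesis using that[of "r ` (rcosets N)"] N(2) r by blast
qed

text \<open>Each fibre of \<open>f\<close> lies in one coset of \<open>N\<close>, so the value of
  \<open>f\<close> determines the coset.\<close>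

lemma (in group) index_le_card_image:
  assumes N: "subgroup N G" and fin: "finite (f ` carrier G)"
    and f: "\<And>x y. x \<in> carrier G \<Longrightarrow> y \<in> carrier G \<Longrightarrow> f x = f y \<Longrightarrow> x \<otimes> inv y \<in> N"
  shows "finite (rcosets N)" "group_index G N \<le> card (f ` carrier G)"
proof -
  define r where "r e = N #> (SOME x. x \<in> carrier G \<and> f x = e)" for e
  have "N #> x = r (f x)" if x: "x \<in> carrier G" for x
  proof -
    have "(SOME y. y \<in> carrier G \<and> f y = f x) \<in> carrier G \<and> f (SOME y. y \<in> carrier G \<and> f y = f x) = f x"
      by (rule someI[where x = x]) (simp add: x)
    then show ?thesis unfolding r_def using rcos_eq_iff[OF N x] f[OF x] by simp
  qed
  then have "rcosets N = r ` (f ` carrier G)" by (auto simp: rcosets_image image_image)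
  then show "finite (rcosets N)" "group_index G N \<le> card (f ` carrier G)"
    using fin by (simp_all add: group_index_def card_image_le)
qed

lemma (in group) index_pos:
  assumes "finite (rcosets N)" shows "0 < group_index G N"
proof -
  have "N #> \<one> \<in> rcosets N" by (simp add: rcosets_image)
  then show ?thesis using assms by (auto simp: group_index_def card_gt_0_iff)
qed

text \<open>Distinct characters are orthonormal with respect to an invariant mean, and comparing them with the
  indicator function of \<open>N\<close> gives the bound on their number.\<close>

lemma (in comm_group) card_characters_le_index:
  assumes N: "subgroup N G" "finite (rcosets N)" and E: "finite E"
    and mult: "\<And>e x y. e \<in> E \<Longrightarrow> x \<in> carrier G \<Longrightarrow> y \<in> carrier G \<Longrightarrow> e (x \<otimes> y) = e x * e y"
    and norm: "\<And>e x. e \<in> E \<Longrightarrow> x \<in> carrier G \<Longrightarrow> norm (e x :: complex) = 1"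
    and triv: "\<And>e x. e \<in> E \<Longrightarrow> x \<in> N \<Longrightarrow> e x = 1"
    and dist: "\<And>e e'. e \<in> E \<Longrightarrow> e' \<in> E \<Longrightarrow> e \<noteq> e' \<Longrightarrow> \<exists>x\<in>carrier G. e x \<noteq> e' x"
  shows "card E \<le> group_index G N"
proof -
  obtain M where M: "M \<in> means G (carrier G)" using invariant_mean_exists by blast
  interpret mean_group G M by unfold_locales (rule M)
  define n where "n = group_index G N"
  have n: "n > 0" unfolding n_def by (rule index_pos[OF N(2)])
  define I :: "'a \<Rightarrow> complex" where "I x = (if x \<in> N then 1 else 0)" for x
  have bI: "bounded_fun G I" by (rule bounded_funI[where B = 1]) (simp add: I_def)
  have be: "bounded_fun G e" if "e \<in> E" for e
    by (rule bounded_funI[where B = 1]) (simp add: norm that)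
  \<comment> \<open>The translates of \<open>N\<close> along a transversal partition the group and
    share the same mean.\<close>
  have MI: "M I = 1 / of_nat n"
  proof -
    obtain T where T: "finite T" "T \<subseteq> carrier G" "card T = n"
      "\<And>x. x \<in> carrier G \<Longrightarrow> \<exists>!t. t \<in> T \<and> x \<otimes> inv t \<in> N"
      by (rule finite_index_transversal[OF N]) (rule that, assumption, assumption, simp only: n_def)
    have 1: "(\<Sum>t\<in>T. I (inv t \<otimes> x)) = 1" if x: "x \<in> carrier G" for x
    proof -
      obtain s where s: "s \<in> T" "x \<otimes> inv s \<in> N" "\<And>t. t \<in> T \<Longrightarrow> x \<otimes> inv t \<in> N \<Longrightarrow> t = s"
        using T(4)[OF x] by blast
      have "I (inv t \<otimes> x) = (if t = s then 1 else 0)" if t: "t \<in> T" for t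
      proof -
        have comm: "inv t \<otimes> x = x \<otimes> inv t" by (rule m_comm) (use t T(2) x in auto)
        have "x \<otimes> inv t \<in> N \<longleftrightarrow> t = s" using s(2) s(3)[OF t] by metis
        then show ?thesis by (simp only: I_def comm)
      qed
      then show ?thesis using s(1) T(1) by simp
    qed
    have "M (\<lambda>x. 1) = M (\<lambda>x. \<Sum>t\<in>T. I (inv t \<otimes> x))"
      by (rule M_cong) (simp add: 1)
    also have "\<dots> = (\<Sum>t\<in>T. M (\<lambda>x. I (inv t \<otimes> x)))"
      using T(2) by (intro M_sum bounded_fun_translate[OF bI]) auto
    also have "\<dots> = (\<Sum>t\<in>T. M I)"
      using T(2) by (intro sum.cong M_shift) auto
    finally show ?thesis using n by (simp add: M_one T(3) field_simps)
  qed
  have nI: "nsq I = 1 / of_nat n"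
  proof -
    have "ip I I = M I" unfolding ip_def by (rule M_cong) (simp add: I_def)
    then show ?thesis by (simp add: nsq_def MI)
  qed
  have eI: "ip e I = 1 / of_nat n" if "e \<in> E" for e
    unfolding MI[symmetric] ip_def by (rule M_cong) (simp add: I_def triv[OF that])
  have ee: "ip e e' = (if e = e' then 1 else 0)" if e: "e \<in> E" "e' \<in> E" for e e'
  proof (cases "e = e'")
    case True
    have "ip e e = M (\<lambda>x. 1)"
      unfolding ip_def by (rule M_cong) (simp add: norm e complex_norm_square[symmetric])
    then show ?thesis using True by (simp add: M_one)
  next
    case False
    then obtain a where a: "a \<in> carrier G" "e a \<noteq> e' a" using dist e by blast
    define c where "c = e a * cnj (e' a)"
    have c: "c \<noteq> 1"
    proof
      assume "c = 1"
      then have "e a * (cnj (e' a) * e' a) = e' a" by (simp add: c_def flip: mult.assoc)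
      moreover have "cnj (e' a) * e' a = 1"
        using norm[OF e(2) a(1)] complex_norm_square[of "e' a"] by (simp add: mult.commute)
      ultimately show False using a by simp
    qed
    have "M (\<lambda>x. e x * cnj (e' x)) = 0"
      by (rule M_character[OF _ _ a(1)]) (use c in \<open>simp_all add: c_def mult norm norm_mult e mult_ac\<close>)
    then show ?thesis using False by (simp add: ip_def)
  qed
  define u where "u x = (\<Sum>e\<in>E. e x)" for x
  have bu: "bounded_fun G u" unfolding u_def[abs_def] using be by auto
  have ipu: "ip u v = (\<Sum>e\<in>E. ip e v)" if "bounded_fun G v" for v
    unfolding ip_def u_def sum_distrib_right by (rule M_sum) (use be that in auto)
  have "ip u I = of_nat (card E) / of_nat n" using ipu[OF bI] eI by simp
  moreover have "ip u u = of_nat (card E)"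
  proof -
    have "ip e u = 1" if e: "e \<in> E" for e
    proof -
      have "ip e u = cnj (ip u e)" by (rule ip_cnj[OF bu be[OF e], symmetric])
      also have "ip u e = (\<Sum>e'\<in>E. if e' = e then 1 else 0)"
        unfolding ipu[OF be[OF e]] by (rule sum.cong) (use ee e in auto)
      also have "\<dots> = 1" using e E by simp
      finally show ?thesis by simp
    qed
    then show ?thesis using ipu[OF bu] by simp
  qed
  \<comment> \<open>If \<open>E\<close> were the full set of characters trivial on \<open>N\<close>,
    then \<open>u\<close> would be \<open>n\<close> times the indicator. In general the three terms
    are |E|, -2 |E| and n, and positivity reads 0 \<le> n - |E|.\<close>
  ultimately have "nsq (\<lambda>x. u x - of_nat n * I x) =
      real (card E) - 2 * Re (of_nat n * (of_nat (card E) / of_nat n)) + (real n)\<^sup>2 * (1 / real n)"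
    using nsq_diff_scale[OF bu bI, of "of_nat n"] nI by (simp add: nsq_def)
  also have "of_nat n * (of_nat (card E) / of_nat n) = (of_nat (card E) :: complex)" using n by simp
  also have "(real n)\<^sup>2 * (1 / real n) = real n" using n by (simp add: power2_eq_square)
  finally have "nsq (\<lambda>x. u x - of_nat n * I x) = real n - real (card E)" by simp
  moreover have "0 \<le> nsq (\<lambda>x. u x - of_nat n * I x)" using bu bI by (intro nsq_nonneg) auto
  ultimately show ?thesis by (simp add: n_def)
qed

lemma (in comm_group) set_mult_finite_subgroups:
  assumes "F \<in> finite_subgroups G" "F' \<in> finite_subgroups G"
  shows "F <#> F' \<in> finite_subgroups G"
  using assms mult_subgroups[of F F'] by (auto simp: finite_subgroups_def set_mult_def)

lemma bij_betw_SUP_cong: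
  fixes f :: "'a \<Rightarrow> 'c::complete_lattice"
  assumes "bij_betw h A B" "\<And>x. x \<in> A \<Longrightarrow> g (h x) = f x"
  shows "(SUP x\<in>A. f x) = (SUP y\<in>B. g y)"
  using assms by (auto simp: bij_betw_def image_image intro!: SUP_cong)

text \<open>Abstract, so that one counting argument serves a discrete group paired with its dual and
  the dual of a compact group paired with that group. In both cases finite-index subgroups live in
  \<open>G\<close> and finite ones in \<open>X\<close>.\<close>

locale group_pairing = G: comm_group G + X: comm_group X
  for G :: "('a, 'c) monoid_scheme" and X :: "('x, 'd) monoid_scheme" +
  fixes pair :: "'a \<Rightarrow> 'x \<Rightarrow> complex"
  assumes pair_mult_left: "x \<in> carrier G \<Longrightarrow> y \<in> carrier G \<Longrightarrow> \<xi> \<in> carrier X \<Longrightarrow>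
      pair (x \<otimes>\<^bsub>G\<^esub> y) \<xi> = pair x \<xi> * pair y \<xi>"
    and pair_mult_right: "x \<in> carrier G \<Longrightarrow> \<xi> \<in> carrier X \<Longrightarrow> \<psi> \<in> carrier X \<Longrightarrow>
      pair x (\<xi> \<otimes>\<^bsub>X\<^esub> \<psi>) = pair x \<xi> * pair x \<psi>"
    and pair_norm: "x \<in> carrier G \<Longrightarrow> \<xi> \<in> carrier X \<Longrightarrow> norm (pair x \<xi>) = 1"
begin

definition annX :: "'a set \<Rightarrow> 'x set" where
  "annX N = {\<xi> \<in> carrier X. \<forall>x\<in>N. pair x \<xi> = 1}"

definition annG :: "'x set \<Rightarrow> 'a set" where
  "annG F = {x \<in> carrier G. \<forall>\<xi>\<in>F. pair x \<xi> = 1}"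

lemma pair_nonzero: "x \<in> carrier G \<Longrightarrow> \<xi> \<in> carrier X \<Longrightarrow> pair x \<xi> \<noteq> 0"
  using pair_norm by fastforce

lemma pair_one_right: "x \<in> carrier G \<Longrightarrow> pair x \<one>\<^bsub>X\<^esub> = 1"
  using pair_mult_right[of x "\<one>\<^bsub>X\<^esub>" "\<one>\<^bsub>X\<^esub>"] pair_nonzero[of x "\<one>\<^bsub>X\<^esub>"] by simp

lemma pair_one_left: "\<xi> \<in> carrier X \<Longrightarrow> pair \<one>\<^bsub>G\<^esub> \<xi> = 1"
  using pair_mult_left[of "\<one>\<^bsub>G\<^esub>" "\<one>\<^bsub>G\<^esub>" \<xi>] pair_nonzero[of "\<one>\<^bsub>G\<^esub>" \<xi>] by simp

lemma pair_inv_right: "x \<in> carrier G \<Longrightarrow> \<xi> \<in> carrier X \<Longrightarrow> pair x \<xi> * pair x (inv\<^bsub>X\<^esub> \<xi>) = 1"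
  using pair_mult_right[of x \<xi> "inv\<^bsub>X\<^esub> \<xi>"] by (simp add: pair_one_right)

lemma pair_inv_left: "x \<in> carrier G \<Longrightarrow> \<xi> \<in> carrier X \<Longrightarrow> pair x \<xi> * pair (inv\<^bsub>G\<^esub> x) \<xi> = 1"
  using pair_mult_left[of x "inv\<^bsub>G\<^esub> x" \<xi>] by (simp add: pair_one_left)

lemma pair_diff_left:
  assumes "x \<in> carrier G" "y \<in> carrier G" "\<xi> \<in> carrier X" "pair x \<xi> = pair y \<xi>"
  shows "pair (x \<otimes>\<^bsub>G\<^esub> inv\<^bsub>G\<^esub> y) \<xi> = 1"
  using pair_mult_left[of x "inv\<^bsub>G\<^esub> y" \<xi>] pair_inv_left[of y \<xi>] assms by simp

lemma pair_diff_right: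
  assumes "x \<in> carrier G" "\<psi> \<in> carrier X" "\<xi> \<in> carrier X" "pair x \<xi> = pair x \<psi>"
  shows "pair x (\<xi> \<otimes>\<^bsub>X\<^esub> inv\<^bsub>X\<^esub> \<psi>) = 1"
  using pair_mult_right[of x \<xi> "inv\<^bsub>X\<^esub> \<psi>"] pair_inv_right[of x \<psi>] assms by simp

lemma subgroup_annX:
  assumes "N \<subseteq> carrier G" shows "subgroup (annX N) X"
proof (rule X.subgroupI)
  show "annX N \<noteq> {}" using assms pair_one_right by (auto simp: annX_def intro!: exI[of _ "\<one>\<^bsub>X\<^esub>"])
  show "inv\<^bsub>X\<^esub> \<xi> \<in> annX N" if "\<xi> \<in> annX N" for \<xi>
  proof -
    have "pair x (inv\<^bsub>X\<^esub> \<xi>) = 1" if "x \<in> N" for x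
      using pair_inv_right[of x \<xi>] that assms \<open>\<xi> \<in> annX N\<close> by (auto simp: annX_def)
    then show ?thesis using that by (auto simp: annX_def)
  qed
  show "\<xi> \<otimes>\<^bsub>X\<^esub> \<psi> \<in> annX N" if "\<xi> \<in> annX N" "\<psi> \<in> annX N" for \<xi> \<psi>
    using that assms pair_mult_right by (auto simp: annX_def subset_iff)
qed (auto simp: annX_def)

lemma subgroup_annG:
  assumes "F \<subseteq> carrier X" shows "subgroup (annG F) G"
proof (rule G.subgroupI)
  show "annG F \<noteq> {}" using assms pair_one_left by (auto simp: annG_def intro!: exI[of _ "\<one>\<^bsub>G\<^esub>"])
  show "inv\<^bsub>G\<^esub> x \<in> annG F" if "x \<in> annG F" for x
  proof -
    have "pair (inv\<^bsub>G\<^esub> x) \<xi> = 1" if "\<xi> \<in> F" for \<xi>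
      using pair_inv_left[of x \<xi>] that assms \<open>x \<in> annG F\<close> by (auto simp: annG_def)
    then show ?thesis using that by (auto simp: annG_def)
  qed
  show "x \<otimes>\<^bsub>G\<^esub> y \<in> annG F" if "x \<in> annG F" "y \<in> annG F" for x y
    using that assms pair_mult_left by (auto simp: annG_def subset_iff)
qed (auto simp: annG_def)

lemma annG_set_mult:
  assumes F: "subgroup F X" "subgroup F' X"
  shows "annG (F <#>\<^bsub>X\<^esub> F') = annG F \<inter> annG F'"
proof
  note c = subgroup.mem_carrier[OF F(1)] subgroup.mem_carrier[OF F(2)]
  show "annG F \<inter> annG F' \<subseteq> annG (F <#>\<^bsub>X\<^esub> F')"
    using c by (auto simp: annG_def set_mult_def pair_mult_right)
  show "annG (F <#>\<^bsub>X\<^esub> F') \<subseteq> annG F \<inter> annG F'"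
  proof
    fix x assume x: "x \<in> annG (F <#>\<^bsub>X\<^esub> F')"
    have "\<xi> \<in> F <#>\<^bsub>X\<^esub> F'" if "\<xi> \<in> F" for \<xi>
      using that subgroup.one_closed[OF F(2)] c X.r_one[of \<xi>] unfolding set_mult_def by force
    moreover have "\<xi> \<in> F <#>\<^bsub>X\<^esub> F'" if "\<xi> \<in> F'" for \<xi>
      using that subgroup.one_closed[OF F(1)] c X.l_one[of \<xi>] unfolding set_mult_def by force
    ultimately show "x \<in> annG F \<inter> annG F'" using x by (auto simp: annG_def)
  qed
qed

text \<open>Elements of \<open>G\<close> act as characters on the finite group \<open>F\<close>,
  whose trivial subgroup has index at most \<open>card F\<close>. So at most \<open>card F\<close>
  functions on \<open>F\<close> arise, and elements inducing the same one differ by a member of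
  \<open>annG F\<close>.\<close>

lemma finite_index_annG:
  assumes F: "F \<in> finite_subgroups X"
  shows "annG F \<in> finite_index_subgroups G" "group_index G (annG F) \<le> card F"
proof -
  have sF: "subgroup F X" and fF: "finite F" using F by (auto simp: finite_subgroups_def)
  have FX: "F \<subseteq> carrier X" by (rule subgroup.subset[OF sF])
  define H where "H = X\<lparr>carrier := F\<rparr>"
  interpret H: comm_group H
  proof (rule group.group_comm_groupI)
    show "group H" unfolding H_def by (rule subgroup.subgroup_is_group[OF sF X.group_axioms])
    show "x \<otimes>\<^bsub>H\<^esub> y = y \<otimes>\<^bsub>H\<^esub> x" if "x \<in> carrier H" "y \<in> carrier H" for x y
      using that FX by (auto simp: H_def intro: X.m_comm)
  qed
  have cH: "carrier H = F" and mH: "\<And>x y. x \<otimes>\<^bsub>H\<^esub> y = x \<otimes>\<^bsub>X\<^esub> y" and oH: "\<one>\<^bsub>H\<^esub> = \<one>\<^bsub>X\<^esub>"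
    by (simp_all add: H_def)
  have tr: "subgroup {\<one>\<^bsub>H\<^esub>} H" by (rule H.triv_subgroup)
  have rH: "finite (rcosets\<^bsub>H\<^esub> {\<one>\<^bsub>H\<^esub>})" using fF by (simp add: H.rcosets_image cH)
  have "card (rcosets\<^bsub>H\<^esub> {\<one>\<^bsub>H\<^esub>}) \<le> card F"
    unfolding H.rcosets_image cH by (rule card_image_le[OF fF])
  then have iH: "group_index H {\<one>\<^bsub>H\<^esub>} \<le> card F" by (simp add: group_index_def)
  define ev where "ev x = (\<lambda>\<xi>\<in>F. pair x \<xi>)" for x
  \<comment> \<open>The counting lemma takes finite sets of characters; a uniform bound on all
    finite subsets makes the whole set finite.\<close>
  have "finite (ev ` carrier G) \<and> card (ev ` carrier G) \<le> card F"
  proof (rule finite_if_finite_subsets_card_bdd)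
    fix E assume E: "E \<subseteq> ev ` carrier G" "finite E"
    have "card E \<le> group_index H {\<one>\<^bsub>H\<^esub>}"
    proof (rule H.card_characters_le_index[OF tr rH E(2)])
      fix e assume e: "e \<in> E"
      then obtain x where x: "x \<in> carrier G" "e = ev x" using E by auto
      show "e (\<xi> \<otimes>\<^bsub>H\<^esub> \<psi>) = e \<xi> * e \<psi>" if "\<xi> \<in> carrier H" "\<psi> \<in> carrier H" for \<xi> \<psi>
        using that x FX subgroup.m_closed[OF sF]
        by (auto simp: cH mH ev_def subset_iff intro!: pair_mult_right)
      show "norm (e \<xi>) = 1" if "\<xi> \<in> carrier H" for \<xi>
        using that x FX by (auto simp: cH ev_def subset_iff pair_norm)
      show "e \<xi> = 1" if "\<xi> \<in> {\<one>\<^bsub>H\<^esub>}" for \<xi>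
        using that x subgroup.one_closed[OF sF] by (simp add: ev_def oH pair_one_right)
      show "\<exists>\<xi>\<in>carrier H. e \<xi> \<noteq> e' \<xi>" if "e' \<in> E" "e \<noteq> e'" for e'
      proof -
        obtain y where y: "e' = ev y" using \<open>e' \<in> E\<close> E by auto
        show ?thesis using \<open>e \<noteq> e'\<close> unfolding x y cH ev_def
          by (auto simp: fun_eq_iff restrict_def split: if_splits)
      qed
    qed
    then show "card E \<le> card F" using iH by simp
  qed
  then have ev: "finite (ev ` carrier G)" "card (ev ` carrier G) \<le> card F" by auto
  have same: "x \<otimes>\<^bsub>G\<^esub> inv\<^bsub>G\<^esub> y \<in> annG F" if xy: "x \<in> carrier G" "y \<in> carrier G" "ev x = ev y" for x y
  proof -
    have "pair x \<xi> = pair y \<xi>" if "\<xi> \<in> F" for \<xi>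
      using fun_cong[OF xy(3), of \<xi>] that by (simp add: ev_def)
    then show ?thesis using xy FX by (auto simp: annG_def intro!: pair_diff_left)
  qed
  have "finite (rcosets\<^bsub>G\<^esub> annG F)" "group_index G (annG F) \<le> card (ev ` carrier G)"
    by (rule G.index_le_card_image[of "annG F" ev, OF subgroup_annG[OF FX] ev(1)]; erule (2) same)+
  then show "annG F \<in> finite_index_subgroups G" "group_index G (annG F) \<le> card F"
    using subgroup_annG[OF FX] ev(2) by (auto simp: finite_index_subgroups_def)
qed

end

text \<open>The hypotheses \<open>sep\<close> and \<open>refl\<close> are all that is needed of Pontryagin duality.\<close>

locale duality = group_pairing +
  assumes sep: "\<xi> \<in> carrier X \<Longrightarrow> (\<And>x. x \<in> carrier G \<Longrightarrow> pair x \<xi> = 1) \<Longrightarrow> \<xi> = \<one>\<^bsub>X\<^esub>"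
    and refl: "N \<in> finite_index_subgroups G \<Longrightarrow> annG (annX N) \<subseteq> N"
begin

text \<open>By \<open>sep\<close>, distinct elements of \<open>X\<close> induce distinct characters
  of \<open>G\<close>. Those in \<open>annX N\<close> are trivial on \<open>N\<close>, so
  orthogonality counts them.\<close>

lemma finite_annX:
  assumes N: "N \<in> finite_index_subgroups G"
  shows "annX N \<in> finite_subgroups X" "card (annX N) \<le> group_index G N"
proof -
  have sN: "subgroup N G" "finite (rcosets\<^bsub>G\<^esub> N)" using N by (auto simp: finite_index_subgroups_def)
  have NG: "N \<subseteq> carrier G" by (rule subgroup.subset[OF sN(1)])
  have inj: "inj_on (\<lambda>\<xi> x. pair x \<xi>) (annX N)" and
    dist: "\<xi> \<in> carrier X \<Longrightarrow> \<psi> \<in> carrier X \<Longrightarrow> \<xi> \<noteq> \<psi> \<Longrightarrow> \<exists>x\<in>carrier G. pair x \<xi> \<noteq> pair x \<psi>" for \<xi> \<psi>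
  proof -
    show d: "\<exists>x\<in>carrier G. pair x \<xi> \<noteq> pair x \<psi>"
      if "\<xi> \<in> carrier X" "\<psi> \<in> carrier X" "\<xi> \<noteq> \<psi>" for \<xi> \<psi>
    proof (rule ccontr)
      assume "\<not> ?thesis"
      then have "\<xi> \<otimes>\<^bsub>X\<^esub> inv\<^bsub>X\<^esub> \<psi> = \<one>\<^bsub>X\<^esub>"
        using that by (intro sep) (auto intro!: pair_diff_right)
      then show False using that X.inv_solve_right' X.inv_equality X.inv_inv X.inv_closed by metis
    qed
    show "inj_on (\<lambda>\<xi> x. pair x \<xi>) (annX N)"
      using d by (fastforce simp: inj_on_def annX_def fun_eq_iff)
  qed
  have "finite (annX N) \<and> card (annX N) \<le> group_index G N"
  proof (rule finite_if_finite_subsets_card_bdd)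
    fix F assume F: "F \<subseteq> annX N" "finite F"
    have "card ((\<lambda>\<xi> x. pair x \<xi>) ` F) \<le> group_index G N"
    proof (rule G.card_characters_le_index[OF sN])
      show "finite ((\<lambda>\<xi> x. pair x \<xi>) ` F)" using F by simp
      fix e assume "e \<in> (\<lambda>\<xi> x. pair x \<xi>) ` F"
      then obtain \<xi> where \<xi>: "\<xi> \<in> annX N" "e = (\<lambda>x. pair x \<xi>)" using F by auto
      then have \<xi>X: "\<xi> \<in> carrier X" by (simp add: annX_def)
      show "e (x \<otimes>\<^bsub>G\<^esub> y) = e x * e y" if "x \<in> carrier G" "y \<in> carrier G" for x y
        using that \<xi> \<xi>X by (simp add: pair_mult_left)
      show "norm (e x) = 1" if "x \<in> carrier G" for x using that \<xi> \<xi>X by (simp add: pair_norm)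
      show "e x = 1" if "x \<in> N" for x using that \<xi> by (simp add: annX_def)
      show "\<exists>x\<in>carrier G. e x \<noteq> e' x" if e': "e' \<in> (\<lambda>\<xi> x. pair x \<xi>) ` F" "e \<noteq> e'" for e'
      proof -
        obtain \<psi> where "\<psi> \<in> annX N" "e' = (\<lambda>x. pair x \<psi>)" using e' F by auto
        moreover from this have "\<psi> \<in> carrier X" by (simp add: annX_def)
        ultimately show ?thesis using dist[OF \<xi>X] \<xi> e'(2) by fastforce
      qed
    qed
    also have "card ((\<lambda>\<xi> x. pair x \<xi>) ` F) = card F"
      by (rule card_image[OF inj_on_subset[OF inj F(1)]])
    finally show "card F \<le> group_index G N" .
  qed
  then show "annX N \<in> finite_subgroups X" "card (annX N) \<le> group_index G N"
    using subgroup_annX[OF NG] by (auto simp: finite_subgroups_def)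
qed

text \<open>The chain card F \<le> card (annX (annG F)) \<le> [G : annG F] \<le> card F closes up,
  which yields both equalities at once.\<close>

lemma annX_annG:
  assumes F: "F \<in> finite_subgroups X"
  shows "annX (annG F) = F" "group_index G (annG F) = card F"
proof -
  note 1 = finite_index_annG[OF F] finite_annX[OF finite_index_annG(1)[OF F]]
  have "F \<subseteq> carrier X" using F subgroup.subset by (auto simp: finite_subgroups_def)
  then have sub: "F \<subseteq> annX (annG F)" by (auto simp: annX_def annG_def)
  have "finite (annX (annG F))" using 1(3) by (simp add: finite_subgroups_def)
  from card_seteq[OF this sub] 1 show eq: "annX (annG F) = F" by simp
  show "group_index G (annG F) = card F" using 1 eq by simp
qed

lemma annG_annX:
  assumes N: "N \<in> finite_index_subgroups G"
  shows "annG (annX N) = N" "card (annX N) = group_index G N"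
proof -
  have "N \<subseteq> carrier G" using N subgroup.subset by (auto simp: finite_index_subgroups_def)
  then have "N \<subseteq> annG (annX N)" by (auto simp: annX_def annG_def)
  with refl[OF N] show eq: "annG (annX N) = N" by simp
  show "card (annX N) = group_index G N" using annX_annG(2)[OF finite_annX(1)[OF N]] eq by simp
qed

lemma bij_annG: "bij_betw annG (finite_subgroups X) (finite_index_subgroups G)"
  by (rule bij_betw_byWitness[where f' = annX])
    (auto simp: annX_annG annG_annX finite_index_annG finite_annX)

lemma bij_annX: "bij_betw annX (finite_index_subgroups G) (finite_subgroups X)"
  by (rule bij_betw_byWitness[where f' = annG])
    (auto simp: annX_annG annG_annX finite_index_annG finite_annX)

text \<open>\<open>annG\<close> turns products into intersections by direct computation; the
  converse passage is transported through the bijection.\<close>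

lemma annX_Int:
  assumes N: "N \<in> finite_index_subgroups G" "N' \<in> finite_index_subgroups G"
  shows "annX (N \<inter> N') = annX N <#>\<^bsub>X\<^esub> annX N'"
proof -
  note F = finite_annX(1)[OF N(1)] finite_annX(1)[OF N(2)]
  have "annG (annX N <#>\<^bsub>X\<^esub> annX N') = N \<inter> N'"
    using annG_set_mult[of "annX N" "annX N'"] F N by (simp add: finite_subgroups_def annG_annX)
  then show ?thesis using annX_annG(1)[OF X.set_mult_finite_subgroups[OF F]] by simp
qed

text \<open>By adjointness \<open>annG\<close> carries trajectories of \<open>F\<close> to
  cotrajectories of \<open>annG F\<close>, with index equal to cardinality. The two sequences agree
  term by term, hence so do their \<open>lim\<close> values, and the suprema range over sets in
  bijection.\<close>

lemma ent_eq_ent_star: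
  assumes \<phi>: "\<phi> \<in> hom G G" and \<psi>: "\<psi> \<in> hom X X"
    and adj: "\<And>x \<xi>. x \<in> carrier G \<Longrightarrow> \<xi> \<in> carrier X \<Longrightarrow> pair (\<phi> x) \<xi> = pair x (\<psi> \<xi>)"
  shows "ent X \<psi> = ent_star G \<phi>"
proof -
  have \<phi>c: "(\<phi> ^^ n) x \<in> carrier G" if "x \<in> carrier G" for x n
    using that \<phi> by (induction n) (auto simp: hom_def)
  have \<psi>n: "\<psi> ^^ n \<in> hom X X" for n
  proof (induction n)
    case (Suc n)
    then show ?case using \<psi> by (auto simp: hom_def Pi_iff)
  qed (simp add: hom_def)
  have adjn: "pair ((\<phi> ^^ n) x) \<xi> = pair x ((\<psi> ^^ n) \<xi>)" if "x \<in> carrier G" "\<xi> \<in> carrier X" for n x \<xi>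
    using that
  proof (induction n arbitrary: \<xi>)
    case (Suc n)
    have "pair ((\<phi> ^^ Suc n) x) \<xi> = pair ((\<phi> ^^ n) x) (\<psi> \<xi>)" using Suc.prems \<phi>c by (simp add: adj)
    also have "\<dots> = pair x ((\<psi> ^^ n) (\<psi> \<xi>))" using Suc \<psi> by (auto simp: hom_def)
    finally show ?case by (simp add: funpow_swap1)
  qed simp
  have traj: "trajectory X \<psi> F n \<in> finite_subgroups X \<and>
      annG (trajectory X \<psi> F n) = cotrajectory G \<phi> (annG F) n" if F: "F \<in> finite_subgroups X" for F n
  proof (induction n)
    case 0
    show ?case
      using X.triv_subgroup by (auto simp: finite_subgroups_def annG_def cotrajectory_def pair_one_right)
  next
    case (Suc n)
    have sF: "subgroup F X" and fF: "finite F" using F by (auto simp: finite_subgroups_def)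
    have FX: "\<xi> \<in> carrier X" if "\<xi> \<in> F" for \<xi> using subgroup.mem_carrier[OF sF that] .
    interpret h: group_hom X X "\<psi> ^^ n" by unfold_locales (rule \<psi>n)
    have im: "(\<psi> ^^ n) ` F \<in> finite_subgroups X"
      using h.subgroup_img_is_subgroup[OF sF] fF by (simp add: finite_subgroups_def)
    have "annG ((\<psi> ^^ n) ` F) = {x \<in> carrier G. (\<phi> ^^ n) x \<in> annG F}"
      using FX by (auto simp: annG_def adjn \<phi>c)
    moreover have "annG (trajectory X \<psi> F (Suc n)) = annG (trajectory X \<psi> F n) \<inter> annG ((\<psi> ^^ n) ` F)"
      unfolding trajectory.simps by (rule annG_set_mult) (use Suc im in \<open>auto simp: finite_subgroups_def\<close>)
    ultimately have "annG (trajectory X \<psi> F (Suc n)) = cotrajectory G \<phi> (annG F) (Suc n)"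
      using Suc by (auto simp: cotrajectory_def less_Suc_eq)
    then show ?case using X.set_mult_finite_subgroups[OF conjunct1[OF Suc] im] by simp
  qed
  show ?thesis
    unfolding ent_def ent_star_def
  proof (rule bij_betw_SUP_cong[OF bij_annG])
    fix F assume F: "F \<in> finite_subgroups X"
    have "group_index G (cotrajectory G \<phi> (annG F) n) = card (trajectory X \<psi> F n)" for n
      using annX_annG(2) traj[OF F, of n] by metis
    then show "ereal (lim (\<lambda>n. ln (real (group_index G (cotrajectory G \<phi> (annG F) n))) / real n)) =
        ereal (lim (\<lambda>n. ln (real (card (trajectory X \<psi> F n))) / real n))" by simp
  qed
qed

end

section \<open>Duality for discrete groups\<close>

lemma continuous_map_binop:
  fixes h :: "complex \<Rightarrow> complex \<Rightarrow> complex"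
  assumes "continuous_map X euclidean f" "continuous_map X euclidean g"
    and "continuous_on UNIV (\<lambda>p. h (fst p) (snd p))"
  shows "continuous_map X euclidean (\<lambda>x. h (f x) (g x))"
proof -
  have "continuous_map X euclidean (\<lambda>x. (f x, g x))"
    using continuous_map_pairedI[OF assms(1,2)] by simp
  from continuous_map_compose[OF this, of euclidean "\<lambda>p. h (fst p) (snd p)"] assms(3)
  show ?thesis by (simp add: o_def flip: continuous_map_iff_continuous subtopology_UNIV)
qed

lemma continuous_map_complex_mult:
  fixes f g :: "'a \<Rightarrow> complex"
  assumes "continuous_map X euclidean f" "continuous_map X euclidean g"
  shows "continuous_map X euclidean (\<lambda>x. f x * g x)"
  by (rule continuous_map_binop[OF assms]) (intro continuous_intros)

lemma continuous_map_comp_continuous: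
  fixes f :: "'a \<Rightarrow> 'b::topological_space" and h :: "'b \<Rightarrow> 'c::topological_space"
  assumes "continuous_map X euclidean f" "continuous_on UNIV h"
  shows "continuous_map X euclidean (\<lambda>x. h (f x))"
  using continuous_map_compose[OF assms(1), of euclidean h] assms(2)
  by (simp add: o_def flip: continuous_map_iff_continuous subtopology_UNIV)

lemma compact_space_finite_cover:
  assumes "compact_space X" and V: "\<And>x. x \<in> topspace X \<Longrightarrow> openin X (V x) \<and> x \<in> V x"
  obtains T where "finite T" "T \<subseteq> topspace X" "topspace X \<subseteq> \<Union> (V ` T)"
proof -
  have "\<exists>\<F>. finite \<F> \<and> \<F> \<subseteq> V ` topspace X \<and> topspace X \<subseteq> \<Union> \<F>"
    by (rule compactinD) (use assms in \<open>auto simp: compact_space_def\<close>)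
  then show ?thesis using that finite_subset_image by metis
qed

lemma continuous_map_complexI:
  fixes f :: "'a \<Rightarrow> complex"
  assumes "\<And>x e. x \<in> topspace X \<Longrightarrow> 0 < e \<Longrightarrow> \<exists>U. openin X U \<and> x \<in> U \<and> (\<forall>y\<in>U. norm (f y - f x) < e)"
  shows "continuous_map X euclidean f"
  using assms unfolding mtopology_is_euclidean[symmetric] Met_TC.continuous_map_to_metric
  by (simp add: dist_norm norm_minus_commute)

lemma openin_near_complex:
  fixes f :: "'a \<Rightarrow> complex"
  assumes "continuous_map X euclidean f" shows "openin X {x \<in> topspace X. norm (f x - c) < e}"
  using openin_continuous_map_preimage[OF assms, of "ball c e"] by (simp add: dist_norm norm_minus_commute)

lemma topological_abelian_groupD:
  assumes "topological_abelian_group G"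
  shows "comm_group G" "topspace (gtop G) = carrier G"
    and "continuous_map Z (gtop G) f \<Longrightarrow> continuous_map Z (gtop G) g \<Longrightarrow>
      continuous_map Z (gtop G) (\<lambda>z. f z \<otimes>\<^bsub>G\<^esub> g z)"
proof -
  show "comm_group G" "topspace (gtop G) = carrier G"
    using assms by (auto simp: topological_abelian_group_def)
  have m: "continuous_map (prod_topology (gtop G) (gtop G)) (gtop G) (\<lambda>(x, y). x \<otimes>\<^bsub>G\<^esub> y)"
    using assms by (auto simp: topological_abelian_group_def)
  show "continuous_map Z (gtop G) (\<lambda>z. f z \<otimes>\<^bsub>G\<^esub> g z)"
    if "continuous_map Z (gtop G) f" "continuous_map Z (gtop G) g"
    using continuous_map_compose[OF continuous_map_pairedI[OF that] m] by (simp add: o_def)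
qed

lemma AG_topological_abelian_group:
  assumes "G \<in> Obj AG" shows "topological_abelian_group G"
proof -
  have G: "comm_group G" "gtop G = discrete_topology (carrier G)" using assms by (auto simp: AG_def)
  interpret comm_group G by (rule G)
  show ?thesis
    using G by (auto simp: topological_abelian_group_def simp flip: prod_topology_discrete_topology)
qed

lemma circle_topology: "gtop circle_group = subtopology euclidean (sphere 0 1)"
  by (simp add: circle_group_def)

text \<open>Unimodularity replaces the circle as codomain, so continuity can be handled in the
  complex plane.\<close>

lemma characters_iff:
  assumes "topspace (gtop G) = carrier G"
  shows "\<xi> \<in> characters G \<longleftrightarrow> \<xi> \<in> extensional (carrier G) \<and>
    (\<forall>x\<in>carrier G. \<forall>y\<in>carrier G. \<xi> (x \<otimes>\<^bsub>G\<^esub> y) = \<xi> x * \<xi> y) \<and>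
    (\<forall>x\<in>carrier G. norm (\<xi> x) = 1) \<and> continuous_map (gtop G) euclidean \<xi>"
  unfolding characters_def circle_topology continuous_map_in_subtopology
  using assms by (auto simp: hom_def circle_group_def)

lemma characters_extensional: "\<xi> \<in> characters G \<Longrightarrow> \<xi> \<in> extensional (carrier G)"
  by (simp add: characters_def)

lemma character_mult:
  "\<xi> \<in> characters G \<Longrightarrow> x \<in> carrier G \<Longrightarrow> y \<in> carrier G \<Longrightarrow> \<xi> (x \<otimes>\<^bsub>G\<^esub> y) = \<xi> x * \<xi> y"
  by (simp add: characters_def hom_def circle_group_def)

lemma character_norm: "\<xi> \<in> characters G \<Longrightarrow> x \<in> carrier G \<Longrightarrow> norm (\<xi> x) = 1"
  by (auto simp: characters_def hom_def circle_group_def)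

lemma character_continuous: "\<xi> \<in> characters G \<Longrightarrow> continuous_map (gtop G) euclidean \<xi>"
  by (simp add: characters_def circle_topology continuous_map_in_subtopology)

lemma character_mult_cnj: "\<xi> \<in> characters G \<Longrightarrow> x \<in> carrier G \<Longrightarrow> \<xi> x * cnj (\<xi> x) = 1"
  using complex_norm_square[of "\<xi> x"] by (simp add: character_norm)

lemma continuous_map_restrict_iff:
  "topspace X = A \<Longrightarrow> continuous_map X Y (restrict f A) \<longleftrightarrow> continuous_map X Y f"
  by (auto intro: continuous_map_eq)

lemma mult_in_characters:
  assumes "topspace (gtop G) = carrier G" "\<xi> \<in> characters G" "\<psi> \<in> characters G" "group G"
  shows "(\<lambda>x\<in>carrier G. \<xi> x * \<psi> x) \<in> characters G"
proof -
  interpret group G by (rule assms)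
  show ?thesis
    unfolding characters_iff[OF assms(1)] continuous_map_restrict_iff[OF assms(1)]
    using assms by (auto simp: character_mult character_norm norm_mult character_continuous
        intro!: continuous_map_complex_mult)
qed

lemma one_in_characters:
  assumes "topspace (gtop G) = carrier G" "group G"
  shows "(\<lambda>x\<in>carrier G. 1) \<in> characters G"
proof -
  interpret group G by (rule assms)
  show ?thesis unfolding characters_iff[OF assms(1)] continuous_map_restrict_iff[OF assms(1)] by auto
qed

lemma cnj_in_characters:
  assumes "topspace (gtop G) = carrier G" "\<xi> \<in> characters G" "group G"
  shows "(\<lambda>x\<in>carrier G. cnj (\<xi> x)) \<in> characters G"
proof -
  interpret group G by (rule assms)
  have "continuous_map (gtop G) euclidean (\<lambda>x. cnj (\<xi> x))"
    by (rule continuous_map_comp_continuous[OF character_continuous[OF assms(2)]])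
      (intro continuous_intros)
  then show ?thesis
    unfolding characters_iff[OF assms(1)] continuous_map_restrict_iff[OF assms(1)]
    using assms by (auto simp: character_mult character_norm)
qed

lemma dual_group_simps [simp]:
  "carrier (dual_group G) = characters G"
  "\<xi> \<otimes>\<^bsub>dual_group G\<^esub> \<psi> = (\<lambda>x\<in>carrier G. \<xi> x * \<psi> x)"
  "\<one>\<^bsub>dual_group G\<^esub> = (\<lambda>x\<in>carrier G. 1)"
  "gtop (dual_group G) = compact_open_topology G"
  by (simp_all add: dual_group_def)

lemma comm_group_dual_group:
  assumes "topspace (gtop G) = carrier G" "group G" shows "comm_group (dual_group G)"
proof (rule comm_groupI)
  fix \<xi> assume \<xi>: "\<xi> \<in> carrier (dual_group G)"
  show "\<exists>\<psi>\<in>carrier (dual_group G). \<psi> \<otimes>\<^bsub>dual_group G\<^esub> \<xi> = \<one>\<^bsub>dual_group G\<^esub>"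
  proof (rule bexI[where x = "\<lambda>x\<in>carrier G. cnj (\<xi> x)"])
    show "(\<lambda>x\<in>carrier G. cnj (\<xi> x)) \<in> carrier (dual_group G)"
      using \<xi> assms by (simp add: cnj_in_characters)
    show "(\<lambda>x\<in>carrier G. cnj (\<xi> x)) \<otimes>\<^bsub>dual_group G\<^esub> \<xi> = \<one>\<^bsub>dual_group G\<^esub>"
      using \<xi> by (auto simp: fun_eq_iff restrict_def mult.commute character_mult_cnj)
  qed
  show "\<one>\<^bsub>dual_group G\<^esub> \<otimes>\<^bsub>dual_group G\<^esub> \<xi> = \<xi>"
    using \<xi> characters_extensional[of \<xi> G] by (auto simp: fun_eq_iff restrict_def extensional_def)
qed (use assms in \<open>auto simp: mult_in_characters one_in_characters fun_eq_iff\<close>)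

lemma dual_group_inv:
  assumes "topspace (gtop G) = carrier G" "group G" "\<xi> \<in> characters G"
  shows "inv\<^bsub>dual_group G\<^esub> \<xi> = (\<lambda>x\<in>carrier G. cnj (\<xi> x))"
proof -
  interpret D: comm_group "dual_group G" by (rule comm_group_dual_group[OF assms(1,2)])
  show ?thesis
  proof (rule D.inv_equality)
    show "(\<lambda>x\<in>carrier G. cnj (\<xi> x)) \<otimes>\<^bsub>dual_group G\<^esub> \<xi> = \<one>\<^bsub>dual_group G\<^esub>"
      using assms(3) by (auto simp: fun_eq_iff restrict_def mult.commute character_mult_cnj)
  qed (use assms in \<open>auto simp: cnj_in_characters\<close>)
qed

lemma group_pairing_dual:
  assumes "topspace (gtop G) = carrier G" "comm_group G"
  shows "group_pairing G (dual_group G) (\<lambda>x \<xi>. \<xi> x)" "group_pairing (dual_group G) G (\<lambda>\<xi> x. \<xi> x)"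
proof -
  interpret comm_group G by (rule assms)
  interpret D: comm_group "dual_group G" by (rule comm_group_dual_group[OF assms(1) group_axioms])
  show "group_pairing G (dual_group G) (\<lambda>x \<xi>. \<xi> x)" "group_pairing (dual_group G) G (\<lambda>\<xi> x. \<xi> x)"
    by unfold_locales (auto simp: character_mult character_norm)
qed

text \<open>Reflexivity is Bohr's theorem for the indicator function of \<open>N\<close>. It has
  finitely many translates, and a character controlled by it is constant on cosets of
  \<open>N\<close>; so an \<open>a\<close> outside \<open>N\<close> has a character trivial on
  \<open>N\<close> but not at \<open>a\<close>.\<close>

lemma duality_discrete:
  assumes "G \<in> Obj AG"
  shows "duality G (dual_group G) (\<lambda>x \<xi>. \<xi> x)"
proof -
  have G: "comm_group G" "gtop G = discrete_topology (carrier G)" using assms by (auto simp: AG_def)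
  then have top: "topspace (gtop G) = carrier G" by simp
  interpret G: comm_group G by (rule G)
  interpret group_pairing G "dual_group G" "\<lambda>x \<xi>. \<xi> x" by (rule group_pairing_dual(1)[OF top G(1)])
  show ?thesis
  proof unfold_locales
    fix \<xi> assume "\<xi> \<in> carrier (dual_group G)" "\<And>x. x \<in> carrier G \<Longrightarrow> \<xi> x = 1"
    then show "\<xi> = \<one>\<^bsub>dual_group G\<^esub>"
      using characters_extensional[of \<xi> G] by (auto simp: fun_eq_iff extensional_def)
  next
    fix N assume "N \<in> finite_index_subgroups G"
    then have N: "subgroup N G" "finite (rcosets\<^bsub>G\<^esub> N)" by (auto simp: finite_index_subgroups_def)
    show "annG (annX N) \<subseteq> N"
    proof (rule ccontr)
      assume "\<not> annG (annX N) \<subseteq> N"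
      then obtain a where a: "a \<in> annG (annX N)" "a \<notin> N" by auto
      then have aG: "a \<in> carrier G" by (simp add: annG_def)
      define f :: "'a \<Rightarrow> complex" where "f x = (if x \<in> N then 1 else 0)" for x
      \<comment> \<open>Tolerance \<open>0\<close> is attained within a coset, so control later
        gives exact equality of character values.\<close>
      have near0: "near G f 0 x x'" if x: "x \<in> carrier G" "x' \<in> carrier G" "x \<otimes>\<^bsub>G\<^esub> inv\<^bsub>G\<^esub> x' \<in> N" for x x'
      proof -
        have "x \<otimes>\<^bsub>G\<^esub> y \<in> N \<longleftrightarrow> x' \<otimes>\<^bsub>G\<^esub> y \<in> N" if y: "y \<in> carrier G" for y
        proof -
          have "x \<otimes>\<^bsub>G\<^esub> y = (x \<otimes>\<^bsub>G\<^esub> inv\<^bsub>G\<^esub> x') \<otimes>\<^bsub>G\<^esub> (x' \<otimes>\<^bsub>G\<^esub> y)"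
            using x y by (simp add: G.m_assoc) (simp add: G.m_assoc[symmetric])
          moreover have "x' \<otimes>\<^bsub>G\<^esub> y = inv\<^bsub>G\<^esub> (x \<otimes>\<^bsub>G\<^esub> inv\<^bsub>G\<^esub> x') \<otimes>\<^bsub>G\<^esub> (x \<otimes>\<^bsub>G\<^esub> y)"
            using calculation x y by (subst G.inv_solve_left) auto
          ultimately show ?thesis
            using subgroup.m_closed[OF N(1)] subgroup.m_inv_closed[OF N(1)] x(3) by metis
        qed
        then show ?thesis by (simp add: near_def f_def)
      qed
      have "bounded_fun G f" by (rule bounded_funI[where B = 1]) (simp add: f_def)
      moreover have "almost_periodic G f"
        unfolding almost_periodic_def
      proof (intro allI impI)
        fix e :: real assume e: "e > 0"
        obtain T where T: "finite T" "T \<subseteq> carrier G"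
          "\<And>x. x \<in> carrier G \<Longrightarrow> \<exists>!t. t \<in> T \<and> x \<otimes>\<^bsub>G\<^esub> inv\<^bsub>G\<^esub> t \<in> N"
          by (rule G.finite_index_transversal[OF N]) (rule that)
        have "\<exists>q\<in>T. near G f e x q" if x: "x \<in> carrier G" for x
        proof -
          obtain q where "q \<in> T" "x \<otimes>\<^bsub>G\<^esub> inv\<^bsub>G\<^esub> q \<in> N" using T(3)[OF x] by blast
          then have "near G f 0 x q" using near0[OF x] T(2) by blast
          then have "near G f e x q" using e unfolding near_def by (meson less_imp_le order_trans)
          then show ?thesis using \<open>q \<in> T\<close> by blast
        qed
        then show "\<exists>X. finite X \<and> X \<subseteq> carrier G \<and> (\<forall>x\<in>carrier G. \<exists>q\<in>X. near G f e x q)"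
          using T(1,2) by blast
      qed
      moreover have "f a \<noteq> f \<one>\<^bsub>G\<^esub>" using a(2) subgroup.one_closed[OF N(1)] by (simp add: f_def)
      ultimately obtain \<xi> K where
        \<xi>: "\<And>x y. x \<in> carrier G \<Longrightarrow> y \<in> carrier G \<Longrightarrow> \<xi> (x \<otimes>\<^bsub>G\<^esub> y) = \<xi> x * \<xi> y"
          "\<And>x. x \<in> carrier G \<Longrightarrow> norm (\<xi> x) = 1" "\<xi> a \<noteq> 1" "controlled G f K \<xi>"
        using G.almost_periodic_character[of f a] aG by blast
      have \<xi>1: "\<xi> \<one>\<^bsub>G\<^esub> = 1" using \<xi>(1)[of "\<one>\<^bsub>G\<^esub>" "\<one>\<^bsub>G\<^esub>"] \<xi>(2)[of "\<one>\<^bsub>G\<^esub>"] by force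
      have "\<xi> n = 1" if n: "n \<in> N" for n
      proof -
        have nG: "n \<in> carrier G" using subgroup.mem_carrier[OF N(1) n] .
        then have "near G f 0 n \<one>\<^bsub>G\<^esub>" using n by (intro near0) auto
        then show ?thesis using controlledD[OF \<xi>(4) _ nG G.one_closed, of 0] \<xi>1 by simp
      qed
      moreover have "restrict \<xi> (carrier G) \<in> characters G"
        unfolding characters_iff[OF top] continuous_map_restrict_iff[OF top]
        using \<xi>(1,2) G(2) by auto
      ultimately have "restrict \<xi> (carrier G) \<in> annX N"
        using subgroup.mem_carrier[OF N(1)] by (auto simp: annX_def)
      then show False using a(1) aG \<xi>(3) by (force simp: annG_def)
    qed
  qed
qed

section \<open>Duality for compact groups\<close>

locale compact_group =
  fixes G :: "'a top_group" (structure)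
  assumes in_CAG: "G \<in> Obj CAG"
begin

lemma tag: "topological_abelian_group G" and compact: "compact_space (gtop G)"
  and Hausdorff: "Hausdorff_space (gtop G)"
  using in_CAG by (auto simp: CAG_def)

lemma top [simp]: "topspace (gtop G) = carrier G"
  by (rule topological_abelian_groupD(2)[OF tag])

sublocale comm_group G by (rule topological_abelian_groupD(1)[OF tag])

lemma continuous_translate:
  assumes "c \<in> carrier G" shows "continuous_map (gtop G) (gtop G) (\<lambda>x. c \<otimes> x)"
  by (rule topological_abelian_groupD(3)[OF tag]) (use assms in auto)

text \<open>\<open>near\<close> quantifies over the whole group, so continuity at single points is
  not enough; the tube lemma along the compact factor supplies a uniform neighbourhood.\<close>

lemma near_open:
  assumes f: "continuous_map (gtop G) euclidean f" and x: "x \<in> carrier G" and e: "0 < e"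
  shows "\<exists>V. openin (gtop G) V \<and> x \<in> V \<and> (\<forall>x'\<in>V. near G f e x' x)"
proof -
  let ?P = "prod_topology (gtop G) (gtop G)"
  have fst: "continuous_map ?P (gtop G) fst" and snd: "continuous_map ?P (gtop G) snd"
    by (rule continuous_map_fst continuous_map_snd)+
  have x': "continuous_map ?P (gtop G) (\<lambda>p. x)" using x by simp
  have 1: "continuous_map ?P euclidean (\<lambda>p. f (snd p \<otimes> fst p))"
    using continuous_map_compose[OF topological_abelian_groupD(3)[OF tag snd fst] f] by (simp add: o_def)
  have 2: "continuous_map ?P euclidean (\<lambda>p. f (x \<otimes> fst p))"
    using continuous_map_compose[OF topological_abelian_groupD(3)[OF tag x' fst] f] by (simp add: o_def)
  have "continuous_map ?P euclidean (\<lambda>p. f (snd p \<otimes> fst p) - f (x \<otimes> fst p))"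
    by (rule continuous_map_binop[OF 1 2]) (intro continuous_intros)
  from openin_near_complex[OF this, of 0 e]
  have W: "openin ?P {p \<in> carrier G \<times> carrier G. norm (f (snd p \<otimes> fst p) - f (x \<otimes> fst p)) < e}" (is "openin ?P ?W")
    by simp
  have "\<exists>U V. openin (gtop G) U \<and> openin (gtop G) V \<and> carrier G \<subseteq> U \<and> x \<in> V \<and> U \<times> V \<subseteq> ?W"
    by (rule tube_lemma_left[OF W]) (use compact x e in \<open>auto simp: compact_space_def\<close>)
  then obtain U V where UV: "openin (gtop G) V" "carrier G \<subseteq> U" "x \<in> V" "U \<times> V \<subseteq> ?W" by blast
  have "near G f e x' x" if x': "x' \<in> V" for x'
    unfolding near_def
  proof
    fix y assume "y \<in> carrier G"
    then have "(y, x') \<in> ?W" using UV x' by blast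
    then show "norm (f (x' \<otimes> y) - f (x \<otimes> y)) \<le> e" by simp
  qed
  then show ?thesis using UV by blast
qed

lemma continuous_almost_periodic:
  assumes f: "continuous_map (gtop G) euclidean f" shows "almost_periodic G f"
  unfolding almost_periodic_def
proof (intro allI impI)
  fix e :: real assume e: "e > 0"
  define V where "V x = (SOME V. openin (gtop G) V \<and> x \<in> V \<and> (\<forall>x'\<in>V. near G f e x' x))" for x
  have V: "openin (gtop G) (V x) \<and> x \<in> V x \<and> (\<forall>x'\<in>V x. near G f e x' x)" if "x \<in> carrier G" for x
    unfolding V_def using someI_ex[OF near_open[OF f that e]] .
  obtain T where T: "finite T" "T \<subseteq> carrier G" "carrier G \<subseteq> \<Union> (V ` T)"
    by (rule compact_space_finite_cover[OF compact, of V]) (use V in auto)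
  have "\<exists>q\<in>T. near G f e x q" if "x \<in> carrier G" for x
  proof -
    obtain q where "q \<in> T" "x \<in> V q" using T(3) \<open>x \<in> carrier G\<close> by blast
    then show ?thesis using V[of q] T(2) by blast
  qed
  then show "\<exists>X. finite X \<and> X \<subseteq> carrier G \<and> (\<forall>x\<in>carrier G. \<exists>q\<in>X. near G f e x q)"
    using T by blast
qed

text \<open>By \<open>near_open\<close> the pseudometric of a continuous \<open>f\<close> is
  compatible with the topology, so its Lipschitz functions are continuous. This is how a character
  found on the abstract group becomes a continuous one.\<close>

lemma controlled_continuous:
  assumes f: "continuous_map (gtop G) euclidean f" and \<xi>: "controlled G f K \<xi>"
  shows "continuous_map (gtop G) euclidean \<xi>"
proof (rule continuous_map_complexI)
  fix x and e :: real assume x: "x \<in> topspace (gtop G)" and e: "0 < e"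
  define d where "d = e / (2 * (\<bar>K\<bar> + 1))"
  have d: "d > 0" using e by (simp add: d_def add_nonneg_pos)
  have "K * d \<le> (\<bar>K\<bar> + 1) * d" using d by (intro mult_right_mono) auto
  also have "\<dots> = e / 2" unfolding d_def by (simp add: field_simps)
  finally have Kd: "K * d < e" using e by simp
  obtain V where V: "openin (gtop G) V" "x \<in> V" "\<forall>x'\<in>V. near G f d x' x"
    using near_open[OF f _ d, of x] x by auto
  have "norm (\<xi> y - \<xi> x) < e" if "y \<in> V" for y
  proof -
    have "y \<in> carrier G" using openin_subset[OF V(1)] that by auto
    then show ?thesis using controlledD[OF \<xi>, of d y x] V(3) that x Kd by fastforce
  qed
  then show "\<exists>U. openin (gtop G) U \<and> x \<in> U \<and> (\<forall>y\<in>U. norm (\<xi> y - \<xi> x) < e)" using V by blast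
qed

text \<open>A Urysohn function that tells \<open>a\<close> from the identity is the input for Bohr's
  theorem.\<close>

theorem characters_separate:
  assumes a: "a \<in> carrier G" "a \<noteq> \<one>"
  obtains \<xi> where "\<xi> \<in> characters G" "\<xi> a \<noteq> 1"
proof -
  have "normal_space (gtop G)"
    using compact_Hausdorff_or_regular_imp_normal_space compact Hausdorff by blast
  moreover have "closedin (gtop G) {x}" if "x \<in> carrier G" for x
    using closedin_Hausdorff_singleton[OF Hausdorff] that by simp
  ultimately obtain g where g: "continuous_map (gtop G) (top_of_set {0..1::real}) g" "g ` {\<one>} \<subseteq> {0}" "g ` {a} \<subseteq> {1}"
    using Urysohn_lemma[of "gtop G" "{\<one>}" "{a}" 0 "1::real"] a by auto
  have gc: "continuous_map (gtop G) euclidean g" "\<And>x. x \<in> carrier G \<Longrightarrow> g x \<in> {0..1}"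
    using g(1) by (auto simp: continuous_map_in_subtopology)
  define f where "f x = complex_of_real (g x)" for x
  have f: "continuous_map (gtop G) euclidean f"
    unfolding f_def by (rule continuous_map_comp_continuous[OF gc(1)]) (intro continuous_intros)
  have "bounded_fun G f" using gc(2) by (intro bounded_funI[where B = 1]) (auto simp: f_def)
  moreover have "f a \<noteq> f \<one>" using g by (simp add: f_def)
  ultimately obtain \<xi> K where
    \<xi>: "\<And>x y. x \<in> carrier G \<Longrightarrow> y \<in> carrier G \<Longrightarrow> \<xi> (x \<otimes> y) = \<xi> x * \<xi> y"
      "\<And>x. x \<in> carrier G \<Longrightarrow> norm (\<xi> x) = 1" "\<xi> a \<noteq> 1" "controlled G f K \<xi>"
    using almost_periodic_character[of f a] a continuous_almost_periodic[OF f] by blast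
  have "restrict \<xi> (carrier G) \<in> characters G"
    unfolding characters_iff[OF top] continuous_map_restrict_iff[OF top]
    using \<xi> controlled_continuous[OF f] by auto
  then show ?thesis using \<xi>(3) a that by force
qed

text \<open>Normalised to \<open>1\<close> at the identity, \<open>peak \<Xi>\<close> equals \<open>1\<close> exactly where all members of \<open>\<Xi>\<close> do, and
  its powers are linear combinations of products of members of \<open>\<Xi>\<close> and their conjugates.\<close>

definition peak :: "('a \<Rightarrow> complex) set \<Rightarrow> 'a \<Rightarrow> real" where
  "peak \<Xi> x = (\<Sum>\<xi>\<in>\<Xi>. (1 + Re (\<xi> x)) / 2) / real (card \<Xi>)"

lemma peak_props:
  assumes \<Xi>: "finite \<Xi>" "\<Xi> \<noteq> {}" "\<Xi> \<subseteq> characters G"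
  shows "continuous_map (gtop G) euclidean (peak \<Xi>)"
    and "x \<in> carrier G \<Longrightarrow> 0 \<le> peak \<Xi> x" "x \<in> carrier G \<Longrightarrow> peak \<Xi> x \<le> 1"
    and "x \<in> carrier G \<Longrightarrow> peak \<Xi> x = 1 \<Longrightarrow> \<xi> \<in> \<Xi> \<Longrightarrow> \<xi> x = 1"
    and "(\<And>\<xi>. \<xi> \<in> \<Xi> \<Longrightarrow> \<xi> x = 1) \<Longrightarrow> peak \<Xi> x = 1"
proof -
  have n: "real (card \<Xi>) > 0" using \<Xi> by (simp add: card_gt_0_iff)
  have le: "0 \<le> (1 + Re (\<xi> x)) / 2 \<and> (1 + Re (\<xi> x)) / 2 \<le> 1" if "\<xi> \<in> \<Xi>" "x \<in> carrier G" for \<xi> x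
  proof -
    have "\<bar>Re (\<xi> x)\<bar> \<le> 1" using abs_Re_le_cmod[of "\<xi> x"] character_norm[of \<xi> G x] that \<Xi> by auto
    then show ?thesis by auto
  qed
  show "continuous_map (gtop G) euclidean (peak \<Xi>)"
  proof -
    have "continuous_map (gtop G) euclidean (\<lambda>x. Re (\<xi> x))" if "\<xi> \<in> \<Xi>" for \<xi>
      using that \<Xi> by (intro continuous_map_comp_continuous[OF character_continuous] continuous_intros) auto
    then show ?thesis
      unfolding peak_def[abs_def] divide_inverse
      by (intro continuous_map_real_mult continuous_map_sum continuous_map_add \<Xi>) auto
  qed
  show "0 \<le> peak \<Xi> x" if "x \<in> carrier G"
    unfolding peak_def by (intro divide_nonneg_nonneg sum_nonneg) (use le[OF _ that] in auto)
  have s: "(\<Sum>\<xi>\<in>\<Xi>. (1 + Re (\<xi> x)) / 2) \<le> real (card \<Xi>)" if "x \<in> carrier G" for x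
    using sum_bounded_above[of \<Xi> "\<lambda>\<xi>. (1 + Re (\<xi> x)) / 2" 1] le[OF _ that] by simp
  show "peak \<Xi> x \<le> 1" if "x \<in> carrier G" unfolding peak_def using s[OF that] n by simp
  show "\<xi> x = 1" if x: "x \<in> carrier G" and p: "peak \<Xi> x = 1" and \<xi>: "\<xi> \<in> \<Xi>"
  proof -
    \<comment> \<open>An average of terms at most \<open>1\<close> equals \<open>1\<close> only if
      every term does; for a unimodular value, real part \<open>1\<close> forces the value
      \<open>1\<close>.\<close>
    have "(\<Sum>\<xi>\<in>\<Xi>. 1 - (1 + Re (\<xi> x)) / 2) = 0"
      using p n by (simp add: peak_def sum_subtractf)
    then have "1 - (1 + Re (\<xi> x)) / 2 = 0"
      by (subst (asm) sum_nonneg_eq_0_iff) (use \<Xi> le[OF _ x] \<xi> in auto)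
    then have "Re (\<xi> x) = 1" by simp
    moreover have "norm (\<xi> x) = 1" using character_norm[of \<xi> G x] \<xi> \<Xi> x by auto
    ultimately show ?thesis by (simp add: complex_eq_iff cmod_def)
  qed
  show "peak \<Xi> x = 1" if "\<And>\<xi>. \<xi> \<in> \<Xi> \<Longrightarrow> \<xi> x = 1"
  proof -
    have "(\<Sum>\<xi>\<in>\<Xi>. (1 + Re (\<xi> x)) / 2) = (\<Sum>\<xi>\<in>\<Xi>. 1)" by (rule sum.cong) (simp_all add: that)
    then show ?thesis using n by (simp add: peak_def)
  qed
qed

text \<open>One factor \<open>peak\<close> is a combination of \<open>1\<close>, \<xi> and the
  conjugate of \<xi> with \<xi> in \<open>N\<close>, and multiplying by these keeps \<psi> outside
  \<open>N\<close>. Induction over all such \<psi> ends at the mean of a nontrivial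
  character.\<close>

lemma mean_peak_power:
  assumes M: "M \<in> means G (carrier G)" and \<Xi>: "finite \<Xi>" "\<Xi> \<noteq> {}" "\<Xi> \<subseteq> N"
    and N: "subgroup N (dual_group G)" and \<psi>: "\<psi> \<in> characters G" "\<psi> \<notin> N"
  shows "M (\<lambda>x. of_real (peak \<Xi> x ^ k) * \<psi> x) = 0"
  using \<psi>
proof (induction k arbitrary: \<psi>)
  interpret mean_group G M by unfold_locales (rule M)
  interpret D: comm_group "dual_group G" by (rule comm_group_dual_group[OF top group_axioms])
  case 0
  then obtain a where "a \<in> carrier G" "\<psi> a \<noteq> 1"
  proof -
    have "\<psi> \<noteq> \<one>\<^bsub>dual_group G\<^esub>" using 0 subgroup.one_closed[OF N] by auto
    then obtain x where "\<psi> x \<noteq> (\<lambda>x\<in>carrier G. 1) x" by (auto simp: fun_eq_iff)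
    then have "x \<in> carrier G \<and> \<psi> x \<noteq> 1"
      using characters_extensional[OF 0(1)] by (auto simp: extensional_def split: if_splits)
    then show ?thesis using that by blast
  qed
  then show ?case using M_character[of \<psi> a] 0 by (simp add: character_mult character_norm)
next
  interpret mean_group G M by unfold_locales (rule M)
  interpret D: comm_group "dual_group G" by (rule comm_group_dual_group[OF top group_axioms])
  case (Suc k)
  have \<Xi>c: "\<Xi> \<subseteq> characters G" using \<Xi>(3) subgroup.subset[OF N] by auto
  define p where "p x = complex_of_real (peak \<Xi> x ^ k)" for x
  have bp: "bounded_fun G p"
    using peak_props(2,3)[OF \<Xi>(1,2) \<Xi>c] by (intro bounded_funI[where B = 1]) (simp add: p_def power_le_one norm_power)
  have bc: "bounded_fun G \<xi>" if "\<xi> \<in> characters G" for \<xi>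
    by (rule bounded_funI[where B = 1]) (simp add: character_norm[OF that])
  define n where "n = complex_of_nat (card \<Xi>)"
  have step: "of_real (peak \<Xi> x ^ Suc k) * \<psi> x =
      (\<Sum>\<xi>\<in>\<Xi>. 1 / (4 * n) * (2 * (p x * \<psi> x) + (p x * (\<xi> x * \<psi> x) + p x * (cnj (\<xi> x) * \<psi> x))))" for x
  proof -
    have "complex_of_real (peak \<Xi> x) = (\<Sum>\<xi>\<in>\<Xi>. (2 + (\<xi> x + cnj (\<xi> x))) / 4) / n"
      by (simp add: peak_def n_def complex_add_cnj add_divide_distrib sum.distrib)
    also have "\<dots> = (\<Sum>\<xi>\<in>\<Xi>. 1 / (4 * n) * (2 + (\<xi> x + cnj (\<xi> x))))"
      by (simp add: sum_divide_distrib)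
    finally have pk: "complex_of_real (peak \<Xi> x) = (\<Sum>\<xi>\<in>\<Xi>. 1 / (4 * n) * (2 + (\<xi> x + cnj (\<xi> x))))" .
    have "of_real (peak \<Xi> x ^ Suc k) * \<psi> x = of_real (peak \<Xi> x) * (p x * \<psi> x)"
      by (simp add: p_def)
    also have "\<dots> = (\<Sum>\<xi>\<in>\<Xi>. 1 / (4 * n) * (2 + (\<xi> x + cnj (\<xi> x))) * (p x * \<psi> x))"
      unfolding pk by (rule sum_distrib_right)
    also have "\<dots> = (\<Sum>\<xi>\<in>\<Xi>. 1 / (4 * n) *
        (2 * (p x * \<psi> x) + (p x * (\<xi> x * \<psi> x) + p x * (cnj (\<xi> x) * \<psi> x))))"
    proof -
      have ring: "c * (2 + (u + v)) * (P * Q) = c * (2 * (P * Q) + (P * (u * Q) + P * (v * Q)))"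
        for c u v P Q :: complex by (simp add: algebra_simps)
      show ?thesis by (simp only: ring)
    qed
    finally show ?thesis .
  qed
  have 0: "M (\<lambda>x. 1 / (4 * n) * (2 * (p x * \<psi> x) + (p x * (\<xi> x * \<psi> x) + p x * (cnj (\<xi> x) * \<psi> x)))) = 0"
    if \<xi>: "\<xi> \<in> \<Xi>" for \<xi>
  proof -
    have \<xi>c: "\<xi> \<in> characters G" and \<xi>N: "\<xi> \<in> N" using \<xi> \<Xi>c \<Xi>(3) by auto
    let ?i = "inv\<^bsub>dual_group G\<^esub> \<xi>"
    have i: "?i \<in> N" "?i \<in> characters G" "?i = (\<lambda>x\<in>carrier G. cnj (\<xi> x))"
      using subgroup.m_inv_closed[OF N \<xi>N] D.inv_closed[of \<xi>] \<xi>c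
        dual_group_inv[OF top group_axioms \<xi>c] by auto
    have out: "\<alpha> \<otimes>\<^bsub>dual_group G\<^esub> \<psi> \<in> characters G \<and> \<alpha> \<otimes>\<^bsub>dual_group G\<^esub> \<psi> \<notin> N" if "\<alpha> \<in> N" for \<alpha>
    proof -
      have ac: "\<alpha> \<in> carrier (dual_group G)" by (rule subgroup.mem_carrier[OF N that])
      have pc: "\<psi> \<in> carrier (dual_group G)" using Suc.prems by simp
      have "\<psi> = inv\<^bsub>dual_group G\<^esub> \<alpha> \<otimes>\<^bsub>dual_group G\<^esub> (\<alpha> \<otimes>\<^bsub>dual_group G\<^esub> \<psi>)"
        using ac pc D.inv_solve_left[OF pc ac D.m_closed[OF ac pc]] by blast
      then have "\<alpha> \<otimes>\<^bsub>dual_group G\<^esub> \<psi> \<notin> N"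
        using subgroup.m_closed[OF N] subgroup.m_inv_closed[OF N that] Suc.prems(2) by metis
      then show ?thesis using D.m_closed[OF ac pc] by simp
    qed
    have 1: "M (\<lambda>x. p x * \<psi> x) = 0" using Suc.IH[OF Suc.prems] by (simp add: p_def)
    have 2: "M (\<lambda>x. p x * (\<xi> x * \<psi> x)) = 0"
    proof -
      have "M (\<lambda>x. p x * (\<xi> x * \<psi> x)) = M (\<lambda>x. of_real (peak \<Xi> x ^ k) * (\<xi> \<otimes>\<^bsub>dual_group G\<^esub> \<psi>) x)"
        by (rule M_cong) (simp add: p_def)
      also have "\<dots> = 0"
        by (rule Suc.IH[OF conjunct1[OF out[OF \<xi>N]] conjunct2[OF out[OF \<xi>N]]])
      finally show ?thesis .
    qed
    have 3: "M (\<lambda>x. p x * (cnj (\<xi> x) * \<psi> x)) = 0"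
    proof -
      have "M (\<lambda>x. p x * (cnj (\<xi> x) * \<psi> x)) = M (\<lambda>x. of_real (peak \<Xi> x ^ k) * (?i \<otimes>\<^bsub>dual_group G\<^esub> \<psi>) x)"
        by (rule M_cong) (simp add: p_def i(3))
      also have "\<dots> = 0"
        by (rule Suc.IH[OF conjunct1[OF out[OF i(1)]] conjunct2[OF out[OF i(1)]]])
      finally show ?thesis .
    qed
    note b = bp bc[OF Suc.prems(1)] bc[OF \<xi>c]
    have "M (\<lambda>x. 1 / (4 * n) * (2 * (p x * \<psi> x) + (p x * (\<xi> x * \<psi> x) + p x * (cnj (\<xi> x) * \<psi> x)))) =
      1 / (4 * n) * (2 * M (\<lambda>x. p x * \<psi> x) + (M (\<lambda>x. p x * (\<xi> x * \<psi> x)) + M (\<lambda>x. p x * (cnj (\<xi> x) * \<psi> x))))"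
      using b by (simp only: M_cmult M_add bounded_fun_mult bounded_fun_add bounded_fun_const bounded_fun_cnj)
    then show ?thesis using 1 2 3 by simp
  qed
  have "M (\<lambda>x. of_real (peak \<Xi> x ^ Suc k) * \<psi> x) =
      (\<Sum>\<xi>\<in>\<Xi>. M (\<lambda>x. 1 / (4 * n) * (2 * (p x * \<psi> x) + (p x * (\<xi> x * \<psi> x) + p x * (cnj (\<xi> x) * \<psi> x)))))"
    unfolding step
  proof (rule M_sum)
    fix \<xi> assume "\<xi> \<in> \<Xi>"
    then have b: "bounded_fun G \<xi>" using \<Xi>c bc by auto
    show "bounded_fun G (\<lambda>x. 1 / (4 * n) * (2 * (p x * \<psi> x) + (p x * (\<xi> x * \<psi> x) + p x * (cnj (\<xi> x) * \<psi> x))))"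
      by (intro bounded_fun_mult bounded_fun_add bounded_fun_const bounded_fun_cnj bp bc Suc.prems b)
  qed
  also have "\<dots> = 0" using 0 by (intro sum.neutral) blast
  finally show ?case .
qed

text \<open>For \<psi> outside \<open>N\<close> the products of \<psi> with all powers of a peak
  function have mean \<open>0\<close>. Yet high powers concentrate where \<psi> is close to
  \<open>1\<close>, so their own means would decay too fast for a function that is close to
  \<open>1\<close> on a nonempty open set.\<close>

lemma annihilator_of_annihilator:
  assumes N: "subgroup N (dual_group G)" and \<psi>: "\<psi> \<in> characters G"
    and triv: "\<And>x. x \<in> carrier G \<Longrightarrow> (\<And>\<xi>. \<xi> \<in> N \<Longrightarrow> \<xi> x = 1) \<Longrightarrow> \<psi> x = 1"
  shows "\<psi> \<in> N"
proof (rule ccontr)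
  assume \<psi>N: "\<psi> \<notin> N"
  obtain M where M: "M \<in> means G (carrier G)" using invariant_mean_exists by blast
  interpret mean_group G M by unfold_locales (rule M)
  have Nc: "N \<subseteq> characters G" using subgroup.subset[OF N] by simp
  define C where "C = {x \<in> carrier G. 1/2 \<le> norm (\<psi> x - 1)}"
  have clC: "closedin (gtop G) C"
  proof -
    have "openin (gtop G) {x \<in> topspace (gtop G). norm (\<psi> x - 1) < 1/2}"
      by (rule openin_near_complex[OF character_continuous[OF \<psi>]])
    moreover have "C = topspace (gtop G) - {x \<in> topspace (gtop G). norm (\<psi> x - 1) < 1/2}"
      by (auto simp: C_def)
    ultimately show ?thesis using closedin_diff[OF closedin_topspace] by metis
  qed
  have compC: "compactin (gtop G) C" by (rule closedin_compact_space[OF compact clC])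
  define E where "E \<xi> = {x \<in> topspace (gtop G). \<xi> x = 1}" for \<xi> :: "'a \<Rightarrow> complex"
  have clE: "closedin (gtop G) (E \<xi>)" if "\<xi> \<in> N" for \<xi>
    unfolding E_def
    by (rule closedin_continuous_maps_eq[of euclidean]) (use that Nc character_continuous in auto)
  \<comment> \<open>The members of \<open>N\<close> have no common kernel inside \<open>C\<close>;
    compactness reduces this to finitely many of them.\<close>
  have "\<exists>\<Xi>0. finite \<Xi>0 \<and> \<Xi>0 \<subseteq> N \<and> C \<inter> \<Inter> (E ` \<Xi>0) = {}"
  proof (rule ccontr)
    assume "\<not> ?thesis"
    then have fin: "C \<inter> \<Inter> (E ` \<Xi>0) \<noteq> {}" if "finite \<Xi>0" "\<Xi>0 \<subseteq> N" for \<Xi>0 using that by blast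
    have "C \<inter> \<Inter> (E ` N) \<noteq> {}"
    proof (rule compactin_fip[THEN iffD1, OF compC, THEN conjunct2, rule_format], intro conjI ballI allI impI)
      fix A assume "A \<in> E ` N" then show "closedin (gtop G) A" using clE by auto
    next
      fix \<F> assume "finite \<F> \<and> \<F> \<subseteq> E ` N"
      then obtain \<Xi>0 where "finite \<Xi>0" "\<Xi>0 \<subseteq> N" "\<F> = E ` \<Xi>0" by (metis finite_subset_image)
      then show "C \<inter> \<Inter>\<F> \<noteq> {}" using fin by simp
    qed
    then obtain x where x: "x \<in> C" "\<And>\<xi>. \<xi> \<in> N \<Longrightarrow> \<xi> x = 1" by (auto simp: E_def)
    then have "\<psi> x = 1" by (intro triv) (auto simp: C_def)
    with x(1) show False by (simp add: C_def)
  qed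
  then obtain \<Xi>0 where \<Xi>0: "finite \<Xi>0" "\<Xi>0 \<subseteq> N" "C \<inter> \<Inter> (E ` \<Xi>0) = {}" by blast
  \<comment> \<open>The trivial character is added to make \<Xi> nonempty, since \<open>peak\<close>
    divides by its cardinality.\<close>
  define \<Xi> where "\<Xi> = insert \<one>\<^bsub>dual_group G\<^esub> \<Xi>0"
  have \<Xi>: "finite \<Xi>" "\<Xi> \<noteq> {}" "\<Xi> \<subseteq> N" "\<Xi> \<subseteq> characters G"
    using \<Xi>0 subgroup.one_closed[OF N] Nc unfolding \<Xi>_def by auto
  let ?r = "peak \<Xi>"
  note pp = peak_props[OF \<Xi>(1,2,4)]
  have lt: "?r x < 1" if "x \<in> C" for x
  proof (rule ccontr)
    assume "\<not> ?r x < 1"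
    moreover have x: "x \<in> carrier G" using that by (simp add: C_def)
    ultimately have "?r x = 1" using pp(3)[OF x] by simp
    then have "x \<in> \<Inter> (E ` \<Xi>0)" using pp(4)[OF x] x by (auto simp: E_def \<Xi>_def)
    then show False using \<Xi>0(3) that by blast
  qed
  \<comment> \<open>A uniform gap below the peak value on \<open>C\<close>; the cap
    \<open>1/2\<close> keeps \<open>1 - d\<close> nonnegative and \<open>1 - d/2\<close>
    positive.\<close>
  obtain d where d: "0 < d" "d \<le> 1/2" "\<And>x. x \<in> C \<Longrightarrow> ?r x \<le> 1 - d"
  proof (cases "C = {}")
    case True
    then show ?thesis using that[of "1/2"] by auto
  next
    case False
    have "compact (?r ` C)" using image_compactin[OF compC pp(1)] by simp
    then obtain s where s: "s \<in> ?r ` C" "\<And>t. t \<in> ?r ` C \<Longrightarrow> t \<le> s"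
      using compact_attains_sup[of "?r ` C"] False by auto
    then have "s < 1" using lt by auto
    moreover have "?r x \<le> 1 - min (1/2) (1 - s)" if "x \<in> C" for x
      using s(2)[of "?r x"] that by simp
    ultimately show ?thesis using that[OF _ min.cobounded1, of "1 - s"] by simp
  qed
  define V where "V x = {y \<in> topspace (gtop G). inv x \<otimes> y \<in> {z \<in> topspace (gtop G). ?r z \<in> {1 - d/2<..}}}" for x
  have "openin (gtop G) (V x) \<and> x \<in> V x" if "x \<in> topspace (gtop G)" for x
  proof
    have "openin (gtop G) {z \<in> topspace (gtop G). ?r z \<in> {1 - d/2<..}}"
      by (rule openin_continuous_map_preimage[OF pp(1)]) simp
    then show "openin (gtop G) (V x)"
      unfolding V_def using that by (intro openin_continuous_map_preimage[OF continuous_translate]) auto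
    have "?r \<one> = 1"
      by (rule pp(5)) (use \<Xi>(4) group_pairing.pair_one_left[OF group_pairing_dual(1)[OF top comm_group_axioms]] in auto)
    then show "x \<in> V x" using that d by (simp add: V_def)
  qed
  then obtain T where T: "finite T" "T \<subseteq> topspace (gtop G)" "topspace (gtop G) \<subseteq> \<Union> (V ` T)"
    using compact_space_finite_cover[OF compact, of V] by blast
  have b: "bounded_fun G (\<lambda>x. of_real (?r x ^ k))" for k
    using pp(2,3) by (intro bounded_funI[where B = 1]) (simp add: power_le_one norm_power)
  define m where "m k = Re (M (\<lambda>x. of_real (?r x ^ k)))" for k
  \<comment> \<open>Finitely many translates of the region where the peak function exceeds
    \<open>1 - d/2\<close> cover the group.\<close>
  have lower: "(1 - d/2) ^ k \<le> card T * m k" for k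
  proof -
    have "Re (M (\<lambda>x. of_real ((1 - d/2) ^ k))) \<le> Re (M (\<lambda>x. \<Sum>t\<in>T. of_real (?r (inv t \<otimes> x) ^ k)))"
    proof (rule M_Re_le)
      show "bounded_fun G (\<lambda>x. \<Sum>t\<in>T. of_real (?r (inv t \<otimes> x) ^ k))"
        using T(2) by (intro bounded_fun_sum bounded_fun_translate[OF b]) auto
      fix x assume x: "x \<in> carrier G"
      then obtain t where t: "t \<in> T" "x \<in> V t" using T(3) by auto
      have nn: "0 \<le> ?r (inv s \<otimes> x) ^ k" if "s \<in> T" for s
        using that T(2) x by (intro zero_le_power pp(2)) auto
      have "(1 - d/2) ^ k \<le> ?r (inv t \<otimes> x) ^ k"
        using t(2) d by (intro power_mono) (auto simp: V_def)
      also have "\<dots> \<le> (\<Sum>t\<in>T. ?r (inv t \<otimes> x) ^ k)"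
        by (rule member_le_sum[OF t(1)]) (use nn T(1) in auto)
      finally show "Re (of_real ((1 - d/2) ^ k)) \<le> Re (\<Sum>t\<in>T. of_real (?r (inv t \<otimes> x) ^ k))"
        by simp
    qed auto
    also have "M (\<lambda>x. \<Sum>t\<in>T. of_real (?r (inv t \<otimes> x) ^ k)) = (\<Sum>t\<in>T. M (\<lambda>x. of_real (?r (inv t \<otimes> x) ^ k)))"
      using T(2) by (intro M_sum bounded_fun_translate[OF b]) auto
    also have "\<dots> = (\<Sum>t\<in>T. M (\<lambda>x. of_real (?r x ^ k)))"
      using T(2) by (intro sum.cong M_shift[of _ "\<lambda>x. of_real (?r x ^ k)"]) auto
    finally show ?thesis by (simp add: M_const m_def)
  qed
  have b\<psi>: "bounded_fun G \<psi>" by (rule bounded_funI[where B = 1]) (simp add: character_norm[OF \<psi>])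
  \<comment> \<open>Subtracting a vanishing mean produces the factor \<open>1 - \<psi>\<close>,
    whose real part is at most \<open>1/2\<close> off \<open>C\<close> and at most \<open>2\<close>
    on \<open>C\<close>.\<close>
  have upper: "m k \<le> m k / 2 + 2 * (1 - d) ^ k" for k
  proof -
    have "m k = Re (M (\<lambda>x. of_real (?r x ^ k)) - M (\<lambda>x. of_real (?r x ^ k) * \<psi> x))"
      using mean_peak_power[OF M \<Xi>(1-3) N \<psi> \<psi>N] by (simp add: m_def)
    also have "\<dots> = Re (M (\<lambda>x. of_real (?r x ^ k) - of_real (?r x ^ k) * \<psi> x))"
      using M_diff[OF b bounded_fun_mult[OF b b\<psi>]] by simp
    also have "\<dots> \<le> Re (M (\<lambda>x. (1/2) * of_real (?r x ^ k) + of_real (2 * (1 - d) ^ k)))"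
    proof (rule M_Re_le)
      show "bounded_fun G (\<lambda>x. of_real (?r x ^ k) - of_real (?r x ^ k) * \<psi> x)"
        by (intro bounded_fun_diff bounded_fun_mult b b\<psi>)
      show "bounded_fun G (\<lambda>x. (1/2) * of_real (?r x ^ k) + of_real (2 * (1 - d) ^ k))"
        by (intro bounded_fun_add bounded_fun_mult bounded_fun_const b)
      fix x assume x: "x \<in> carrier G"
      have r0: "0 \<le> ?r x ^ k" using pp(2)[OF x] by simp
      have "Re (of_real (?r x ^ k) - of_real (?r x ^ k) * \<psi> x) = ?r x ^ k * Re (1 - \<psi> x)"
        by (simp add: algebra_simps)
      also have "\<dots> \<le> ?r x ^ k / 2 + 2 * (1 - d) ^ k"
      proof (cases "x \<in> C")
        case True
        have "Re (1 - \<psi> x) \<le> 2"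
          using abs_Re_le_cmod[of "\<psi> x"] character_norm[OF \<psi> x] by simp
        then have "?r x ^ k * Re (1 - \<psi> x) \<le> ?r x ^ k * 2" using r0 by (intro mult_left_mono)
        also have "\<dots> \<le> (1 - d) ^ k * 2"
          using d(3)[OF True] pp(2)[OF x] by (intro mult_right_mono power_mono) auto
        finally show ?thesis using r0 by simp
      next
        case False
        then have "norm (1 - \<psi> x) \<le> 1/2" using x by (simp add: C_def norm_minus_commute)
        then have "Re (1 - \<psi> x) \<le> 1/2" using complex_Re_le_cmod order_trans by blast
        then have "?r x ^ k * Re (1 - \<psi> x) \<le> ?r x ^ k * (1/2)" using r0 by (intro mult_left_mono)
        moreover have "0 \<le> (1 - d) ^ k" using d by simp
        ultimately show ?thesis by simp
      qed
      also have "\<dots> = Re ((1/2) * of_real (?r x ^ k) + of_real (2 * (1 - d) ^ k))" by simp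
      finally show "Re (of_real (?r x ^ k) - of_real (?r x ^ k) * \<psi> x) \<le>
          Re ((1/2) * of_real (?r x ^ k) + of_real (2 * (1 - d) ^ k))" .
    qed
    also have "M (\<lambda>x. (1/2) * of_real (?r x ^ k) + of_real (2 * (1 - d) ^ k)) =
        (1/2) * M (\<lambda>x. of_real (?r x ^ k)) + of_real (2 * (1 - d) ^ k)"
      using b[of k] by (simp only: M_add M_cmult M_const bounded_fun_mult bounded_fun_const)
    also have "Re \<dots> = m k / 2 + 2 * (1 - d) ^ k" unfolding m_def by simp
    finally show ?thesis .
  qed
  \<comment> \<open>The upper bound decays at rate \<open>1 - d\<close>, the lower one at the larger
    rate \<open>1 - d/2\<close>; their quotient tends to \<open>0\<close>.\<close>
  define q where "q = (1 - d) / (1 - d/2)"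
  have q: "0 \<le> q" "q < 1" using d by (auto simp: q_def)
  have "1 \<le> 4 * real (card T) * q ^ k" for k
  proof -
    have "m k \<le> 4 * (1 - d) ^ k" using upper[of k] by simp
    then have "card T * m k \<le> card T * (4 * (1 - d) ^ k)" by (intro mult_left_mono) auto
    then have "(1 - d/2) ^ k \<le> 4 * real (card T) * (1 - d) ^ k" using lower[of k] by simp
    moreover have "(1 - d/2) ^ k > 0" using d by simp
    ultimately show ?thesis unfolding q_def power_divide by (simp add: field_simps)
  qed
  moreover have "(\<lambda>k. 4 * real (card T) * q ^ k) \<longlonglongrightarrow> 4 * real (card T) * 0"
    using q by (intro tendsto_mult tendsto_const LIMSEQ_realpow_zero)
  ultimately have "1 \<le> 4 * real (card T) * 0" by (intro LIMSEQ_le_const) auto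
  then show False by simp
qed

text \<open>The dual takes the place of \<open>G\<close> and the compact group that of
  \<open>X\<close>, so separation concerns points of the group and reflexivity concerns subgroups of
  characters.\<close>

theorem duality_compact: "duality (dual_group G) G (\<lambda>\<xi> x. \<xi> x)"
proof -
  interpret group_pairing "dual_group G" G "\<lambda>\<xi> x. \<xi> x"
    by (rule group_pairing_dual(2)[OF top comm_group_axioms])
  show ?thesis
  proof unfold_locales
    fix x assume "x \<in> carrier G" "\<And>\<xi>. \<xi> \<in> carrier (dual_group G) \<Longrightarrow> \<xi> x = 1"
    then show "x = \<one>" using characters_separate[of x] by auto
  next
    fix N assume "N \<in> finite_index_subgroups (dual_group G)"
    then have N: "subgroup N (dual_group G)" by (simp add: finite_index_subgroups_def)
    show "annG (annX N) \<subseteq> N"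
    proof
      fix \<psi> assume "\<psi> \<in> annG (annX N)"
      then show "\<psi> \<in> N"
        by (intro annihilator_of_annihilator[OF N]) (auto simp: annG_def annX_def)
    qed
  qed
qed

end

section \<open>The subgroup functors\<close>

text \<open>All three categories consist of extensional maps between carriers under
  \<open>compose\<close>, so the unit and associativity laws are checked once.\<close>

lemma is_categoryI:
  assumes Id: "\<And>X. Id \<C> X = restrict id (c X)"
    and Comp: "\<And>X g f. Comp \<C> X g f = compose (c X) g f"
    and Hom: "\<And>X Y f. X \<in> Obj \<C> \<Longrightarrow> Y \<in> Obj \<C> \<Longrightarrow> f \<in> Hom \<C> X Y \<Longrightarrow> f \<in> c X \<rightarrow>\<^sub>E c Y"
    and id: "\<And>X. X \<in> Obj \<C> \<Longrightarrow> restrict id (c X) \<in> Hom \<C> X X"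
    and comp: "\<And>X Y Z f g. X \<in> Obj \<C> \<Longrightarrow> Y \<in> Obj \<C> \<Longrightarrow> Z \<in> Obj \<C> \<Longrightarrow> f \<in> Hom \<C> X Y \<Longrightarrow>
      g \<in> Hom \<C> Y Z \<Longrightarrow> compose (c X) g f \<in> Hom \<C> X Z"
  shows "is_category \<C>"
  unfolding is_category_def Id Comp
proof (intro conjI ballI)
  fix X Y f assume "X \<in> Obj \<C>" "Y \<in> Obj \<C>" "f \<in> Hom \<C> X Y"
  then have f: "f \<in> c X \<rightarrow>\<^sub>E c Y" by (rule Hom)
  show "compose (c X) f (restrict id (c X)) = f" "compose (c X) (restrict id (c Y)) f = f"
    using f by (auto simp: compose_def fun_eq_iff PiE_iff extensional_def)
next
  fix W X Y Z f g h
  assume "W \<in> Obj \<C>" "X \<in> Obj \<C>" "f \<in> Hom \<C> W X"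
  then have "f \<in> c W \<rightarrow>\<^sub>E c X" by (rule Hom)
  then show "compose (c W) h (compose (c W) g f) = compose (c W) (compose (c X) h g) f"
    by (intro compose_assoc) auto
qed (auto intro: id comp)

lemma hom_compose_extensional:
  assumes "f \<in> hom G H" "g \<in> hom H K" "group G"
  shows "compose (carrier G) g f \<in> hom G K"
proof -
  interpret group G by (rule assms)
  show ?thesis using assms by (auto simp: hom_def compose_def Pi_iff)
qed

lemma restrict_id_hom: "group G \<Longrightarrow> restrict id (carrier G) \<in> hom G G"
  by (auto simp: hom_def group.is_monoid monoid.m_closed)

lemma AG_comm_group: "G \<in> Obj AG \<Longrightarrow> comm_group G"
  by (simp add: AG_def)

lemma CAG_comm_group: "G \<in> Obj CAG \<Longrightarrow> comm_group G"
  by (simp add: CAG_def topological_abelian_group_def)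

lemma is_category_AG: "is_category AG"
proof (rule is_categoryI[where c = carrier])
  fix X Y Z :: "'a top_group" and f g
  assume *: "X \<in> Obj AG" "Y \<in> Obj AG" "Z \<in> Obj AG" "f \<in> Hom AG X Y" "g \<in> Hom AG Y Z"
  then show "compose (carrier X) g f \<in> Hom AG X Z"
    using hom_compose_extensional[of f X Y g Z] comm_group.axioms(2) by (auto simp: AG_def)
next
  fix X :: "'a top_group" assume X: "X \<in> Obj AG"
  show "restrict id (carrier X) \<in> Hom AG X X"
    using restrict_id_hom comm_group.axioms(2)[OF AG_comm_group[OF X]] by (simp add: AG_def)
qed (auto simp: AG_def hom_def PiE_iff)

lemma is_category_CAG: "is_category CAG"
proof (rule is_categoryI[where c = carrier])
  fix X Y Z :: "'a top_group" and f g
  assume *: "X \<in> Obj CAG" "Y \<in> Obj CAG" "Z \<in> Obj CAG" "f \<in> Hom CAG X Y" "g \<in> Hom CAG Y Z"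
  then have f: "f \<in> hom X Y" "continuous_map (gtop X) (gtop Y) f" and g: "g \<in> hom Y Z" "continuous_map (gtop Y) (gtop Z) g"
    and tX: "topspace (gtop X) = carrier X" by (auto simp: CAG_def topological_abelian_group_def)
  have "continuous_map (gtop X) (gtop Z) (compose (carrier X) g f)"
    unfolding compose_def continuous_map_restrict_iff[OF tX]
    using continuous_map_compose[OF f(2) g(2)] by (simp add: o_def)
  then show "compose (carrier X) g f \<in> Hom CAG X Z"
    using hom_compose_extensional[OF f(1) g(1)] comm_group.axioms(2)[OF CAG_comm_group[OF *(1)]]
    by (simp add: CAG_def)
next
  fix X :: "'a top_group" assume X: "X \<in> Obj CAG"
  then have "continuous_map (gtop X) (gtop X) (restrict id (carrier X))"
    by (subst continuous_map_restrict_iff) (auto simp: CAG_def topological_abelian_group_def)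
  then show "restrict id (carrier X) \<in> Hom CAG X X"
    using restrict_id_hom comm_group.axioms(2)[OF CAG_comm_group[OF X]] by (simp add: CAG_def)
qed (auto simp: CAG_def hom_def PiE_iff)

lemma is_category_NSG: "is_category NSG"
proof (rule is_categoryI[where c = carrier])
  fix X Y Z :: "'a nsemigroup" and f g
  assume *: "X \<in> Obj NSG" "Y \<in> Obj NSG" "Z \<in> Obj NSG" "f \<in> Hom NSG X Y" "g \<in> Hom NSG Y Z"
  have X: "op X x y \<in> carrier X" if "x \<in> carrier X" "y \<in> carrier X" for x y
    using * that by (simp add: NSG_def normed_semigroup_def)
  have f: "f x \<in> carrier Y" "nrm Y (f x) \<le> nrm X x" if "x \<in> carrier X" for x
    using * that by (auto simp: NSG_def semigroup_hom_def PiE_iff)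
  have g: "g x \<in> carrier Z" "nrm Z (g x) \<le> nrm Y x" if "x \<in> carrier Y" for x
    using * that by (auto simp: NSG_def semigroup_hom_def PiE_iff)
  have fm: "f (op X x y) = op Y (f x) (f y)" if "x \<in> carrier X" "y \<in> carrier X" for x y
    using * that by (auto simp: NSG_def semigroup_hom_def)
  have gm: "g (op Y x y) = op Z (g x) (g y)" if "x \<in> carrier Y" "y \<in> carrier Y" for x y
    using * that by (auto simp: NSG_def semigroup_hom_def)
  have "nrm Z (g (f x)) \<le> nrm X x" if "x \<in> carrier X" for x
    using f[OF that] g(2)[OF f(1)[OF that]] by simp
  then show "compose (carrier X) g f \<in> Hom NSG X Z"
    using X f(1) g(1) fm gm by (simp add: NSG_def semigroup_hom_def compose_def PiE_iff)
qed (auto simp: NSG_def semigroup_hom_def PiE_iff normed_semigroup_def)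

text \<open>A coset of the intersection is determined by the pair of cosets of \<open>N\<close> and
  \<open>N'\<close>.\<close>

lemma (in group) Int_finite_index_subgroups:
  assumes "N \<in> finite_index_subgroups G" "N' \<in> finite_index_subgroups G"
  shows "N \<inter> N' \<in> finite_index_subgroups G"
proof -
  have N: "subgroup N G" "finite (rcosets N)" "subgroup N' G" "finite (rcosets N')"
    using assms by (auto simp: finite_index_subgroups_def)
  have NN: "subgroup (N \<inter> N') G" by (rule subgroups_Inter_pair[OF N(1,3)])
  have "(\<lambda>x. (N #> x, N' #> x)) ` carrier G \<subseteq> (rcosets N) \<times> (rcosets N')" by (auto simp: rcosets_image)
  then have fin: "finite ((\<lambda>x. (N #> x, N' #> x)) ` carrier G)" by (rule finite_subset) (simp add: N)
  have "finite (rcosets (N \<inter> N'))"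
    by (rule index_le_card_image(1)[OF NN fin]) (auto simp: rcos_eq_iff N)
  with NN show ?thesis by (simp add: finite_index_subgroups_def)
qed

lemma subgroup_vimage:
  assumes "group G" "group H" "f \<in> hom G H" "subgroup N H"
  shows "subgroup {x \<in> carrier G. f x \<in> N} G"
proof -
  interpret group_hom G H f using assms by (simp add: group_hom_def group_hom_axioms_def)
  show ?thesis
    by (rule G.subgroupI)
      (auto simp: subgroup.one_closed[OF assms(4)] subgroup.m_closed[OF assms(4)]
        subgroup.m_inv_closed[OF assms(4)] intro!: exI[of _ "\<one>\<^bsub>G\<^esub>"])
qed

lemma index_vimage:
  assumes G: "group G" and H: "group H" and f: "f \<in> hom G H" and N: "N \<in> finite_index_subgroups H"
  shows "{x \<in> carrier G. f x \<in> N} \<in> finite_index_subgroups G"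
    "group_index G {x \<in> carrier G. f x \<in> N} \<le> group_index H N"
proof -
  interpret group_hom G H f using assms by (simp add: group_hom_def group_hom_axioms_def)
  have sN: "subgroup N H" "finite (rcosets\<^bsub>H\<^esub> N)" using N by (auto simp: finite_index_subgroups_def)
  let ?P = "{x \<in> carrier G. f x \<in> N}"
  have sP: "subgroup ?P G" by (rule subgroup_vimage[OF G H f sN(1)])
  have sub: "(\<lambda>x. N #>\<^bsub>H\<^esub> f x) ` carrier G \<subseteq> rcosets\<^bsub>H\<^esub> N" by (auto simp: H.rcosets_image)
  have fin: "finite ((\<lambda>x. N #>\<^bsub>H\<^esub> f x) ` carrier G)" by (rule finite_subset[OF sub sN(2)])
  have inj: "x \<otimes>\<^bsub>G\<^esub> inv\<^bsub>G\<^esub> y \<in> ?P" if "x \<in> carrier G" "y \<in> carrier G" "N #>\<^bsub>H\<^esub> f x = N #>\<^bsub>H\<^esub> f y" for x y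
    using that H.rcos_eq_iff[OF sN(1), of "f x" "f y"] by simp
  have "finite (rcosets\<^bsub>G\<^esub> ?P)" "group_index G ?P \<le> card ((\<lambda>x. N #>\<^bsub>H\<^esub> f x) ` carrier G)"
    by (rule G.index_le_card_image[OF sP fin]; erule (2) inj)+
  moreover have "card ((\<lambda>x. N #>\<^bsub>H\<^esub> f x) ` carrier G) \<le> group_index H N"
    unfolding group_index_def by (rule card_mono[OF sN(2) sub])
  ultimately show "?P \<in> finite_index_subgroups G" "group_index G ?P \<le> group_index H N"
    using sP by (auto simp: finite_index_subgroups_def)
qed

lemma subgroup_image:
  assumes "group G" "group H" "f \<in> hom G H" "subgroup F G" shows "subgroup (f ` F) H"
proof -
  interpret group_hom G H f using assms by (simp add: group_hom_def group_hom_axioms_def)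
  show ?thesis by (rule subgroup_img_is_subgroup[OF assms(4)])
qed

lemma image_finite_subgroups:
  assumes "group G" "group H" "f \<in> hom G H" "F \<in> finite_subgroups G"
  shows "f ` F \<in> finite_subgroups H"
  using subgroup_image[OF assms(1-3)] assms(4) by (simp add: finite_subgroups_def)

lemma sub_simps [simp]:
  "carrier (omap sub G) = finite_subgroups G"
  "op (omap sub G) F F' = F <#>\<^bsub>G\<^esub> F'"
  "nrm (omap sub G) F = ln (real (card F))"
  "mmap sub G H \<phi> = (\<lambda>F\<in>finite_subgroups G. \<phi> ` F)"
  "contravariant sub = False"
  by (simp_all add: sub_def)

lemma sub_star_simps [simp]:
  "carrier (omap sub_star G) = finite_index_subgroups G"
  "op (omap sub_star G) N N' = N \<inter> N'"
  "nrm (omap sub_star G) N = ln (real (group_index G N))"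
  "mmap sub_star G H \<phi> = (\<lambda>N\<in>finite_index_subgroups H. {x \<in> carrier G. \<phi> x \<in> N})"
  "contravariant sub_star = True"
  by (simp_all add: sub_star_def)

lemma NSG_simps [simp]:
  "S \<in> Obj NSG \<longleftrightarrow> normed_semigroup S"
  "f \<in> Hom NSG S T \<longleftrightarrow> f \<in> semigroup_hom S T \<and> (\<forall>x\<in>carrier S. nrm T (f x) \<le> nrm S x)"
  "Id NSG S = restrict id (carrier S)"
  "Comp NSG S g k = compose (carrier S) g k"
  by (simp_all add: NSG_def)

lemma card_finite_subgroup_pos: "F \<in> finite_subgroups G \<Longrightarrow> 0 < card F"
  using subgroup.one_closed by (force simp: finite_subgroups_def card_gt_0_iff)

lemma normed_semigroup_sub:
  assumes "comm_group G" shows "normed_semigroup (omap sub G)"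
proof -
  interpret comm_group G by (rule assms)
  have "F \<subseteq> carrier G" if "F \<in> finite_subgroups G" for F
    using that subgroup.subset by (auto simp: finite_subgroups_def)
  then show ?thesis
    using card_finite_subgroup_pos[of _ G]
    by (auto simp: normed_semigroup_def set_mult_finite_subgroups set_mult_assoc intro!: ln_ge_zero)
      (metis Suc_leI of_nat_1 of_nat_le_iff One_nat_def)
qed

lemma normed_semigroup_sub_star:
  assumes "comm_group G" shows "normed_semigroup (omap sub_star G)"
proof -
  interpret comm_group G by (rule assms)
  have "1 \<le> group_index G N" if "N \<in> finite_index_subgroups G" for N
    using index_pos[of N] that by (simp add: finite_index_subgroups_def)
  then show ?thesis
    by (auto simp: normed_semigroup_def Int_finite_index_subgroups intro!: ln_ge_zero)
qed

lemma sub_hom: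
  assumes G: "comm_group G" and H: "comm_group H" and f: "f \<in> hom G H"
  shows "mmap sub G H f \<in> Hom NSG (omap sub G) (omap sub H)"
proof -
  interpret G: comm_group G by (rule G)
  interpret H: comm_group H by (rule H)
  have sub: "F \<subseteq> carrier G" if "F \<in> finite_subgroups G" for F
    using that subgroup.subset by (auto simp: finite_subgroups_def)
  have "f ` (F <#>\<^bsub>G\<^esub> F') = f ` F <#>\<^bsub>H\<^esub> f ` F'" if "F \<in> finite_subgroups G" "F' \<in> finite_subgroups G" for F F'
    using f sub[OF that(1)] sub[OF that(2)]
    by (auto simp: set_mult_def hom_def subset_iff image_iff) (metis)+
  moreover have "ln (real (card (f ` F))) \<le> ln (real (card F))" if F: "F \<in> finite_subgroups G" for F
  proof -
    have "card (f ` F) \<le> card F" using F by (simp add: finite_subgroups_def card_image_le)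
    moreover have "0 < card (f ` F)"
      by (rule card_finite_subgroup_pos[OF image_finite_subgroups[OF G.group_axioms H.group_axioms f F]])
    ultimately show ?thesis by (subst ln_le_cancel_iff) auto
  qed
  ultimately show ?thesis
    using image_finite_subgroups[OF G.group_axioms H.group_axioms f]
    by (simp add: semigroup_hom_def PiE_iff G.set_mult_finite_subgroups)
qed

lemma sub_star_hom:
  assumes G: "comm_group G" and H: "comm_group H" and f: "f \<in> hom G H"
  shows "mmap sub_star G H f \<in> Hom NSG (omap sub_star H) (omap sub_star G)"
proof -
  interpret G: comm_group G by (rule G)
  interpret H: comm_group H by (rule H)
  note iv = index_vimage[OF G.group_axioms H.group_axioms f]
  have "ln (real (group_index G {x \<in> carrier G. f x \<in> N})) \<le> ln (real (group_index H N))"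
    if N: "N \<in> finite_index_subgroups H" for N
  proof -
    have "0 < group_index G {x \<in> carrier G. f x \<in> N}"
      using iv(1)[OF N] G.index_pos by (simp add: finite_index_subgroups_def)
    then show ?thesis using iv(2)[OF N] by (subst ln_le_cancel_iff) auto
  qed
  then show ?thesis
    using iv(1) by (auto simp: semigroup_hom_def PiE_iff H.Int_finite_index_subgroups)
qed

lemma is_functor_sub: "is_functor CAG NSG sub"
  unfolding is_functor_def
proof (intro conjI ballI)
  fix X Y Z :: "'a top_group" and f g :: "'a \<Rightarrow> 'a"
  assume X: "X \<in> Obj CAG" and Y: "Y \<in> Obj CAG" and f: "f \<in> Hom CAG X Y"
  interpret X: comm_group X by (rule CAG_comm_group[OF X])
  interpret Y: comm_group Y by (rule CAG_comm_group[OF Y])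
  have fh: "f \<in> hom X Y" using f by (simp add: CAG_def)
  show "mmap sub X Y f \<in> (if contravariant sub then Hom NSG (omap sub Y) (omap sub X)
      else Hom NSG (omap sub X) (omap sub Y))"
    using sub_hom[OF X.comm_group_axioms Y.comm_group_axioms fh] by simp
  have "compose (carrier X) g f ` F = g ` f ` F" if "F \<in> finite_subgroups X" for F
    using that subgroup.subset[of F X] by (auto simp: finite_subgroups_def compose_def image_iff)
  then show "mmap sub X Z (Comp CAG X g f) =
      (if contravariant sub then Comp NSG (omap sub Z) (mmap sub X Y f) (mmap sub Y Z g)
       else Comp NSG (omap sub X) (mmap sub Y Z g) (mmap sub X Y f))"
    using image_finite_subgroups[OF X.group_axioms Y.group_axioms fh]
    by (auto simp: fun_eq_iff compose_def[of "finite_subgroups X"] CAG_def)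
next
  fix X :: "'a top_group"
  have "restrict id (carrier X) ` F = F" if "F \<in> finite_subgroups X" for F
    using that subgroup.subset[of F X] by (auto simp: finite_subgroups_def image_iff)
  then show "mmap sub X X (Id CAG X) = Id NSG (omap sub X)"
    by (auto simp: fun_eq_iff CAG_def)
qed (auto simp: is_category_CAG is_category_NSG normed_semigroup_sub CAG_comm_group)

lemma is_functor_sub_star: "is_functor AG NSG sub_star"
  unfolding is_functor_def
proof (intro conjI ballI)
  fix X Y Z :: "'a top_group" and f g :: "'a \<Rightarrow> 'a"
  assume X: "X \<in> Obj AG" and Y: "Y \<in> Obj AG" and Z: "Z \<in> Obj AG" and f: "f \<in> Hom AG X Y" and g: "g \<in> Hom AG Y Z"
  interpret X: comm_group X by (rule AG_comm_group[OF X])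
  interpret Y: comm_group Y by (rule AG_comm_group[OF Y])
  interpret Z: comm_group Z by (rule AG_comm_group[OF Z])
  have fh: "f \<in> hom X Y" and gh: "g \<in> hom Y Z" using f g by (simp_all add: AG_def)
  have "{x \<in> carrier X. compose (carrier X) g f x \<in> N} = {x \<in> carrier X. f x \<in> {y \<in> carrier Y. g y \<in> N}}" for N
    using fh by (auto simp: compose_def hom_def)
  then show "mmap sub_star X Z (Comp AG X g f) =
      (if contravariant sub_star then Comp NSG (omap sub_star Z) (mmap sub_star X Y f) (mmap sub_star Y Z g)
       else Comp NSG (omap sub_star X) (mmap sub_star Y Z g) (mmap sub_star X Y f))"
    using index_vimage(1)[OF Y.group_axioms Z.group_axioms gh]
    by (auto simp: fun_eq_iff compose_def[of "finite_index_subgroups Z"] AG_def)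
next
  fix X :: "'a top_group"
  have "{x \<in> carrier X. restrict id (carrier X) x \<in> N} = N" if "N \<in> finite_index_subgroups X" for N
    using that subgroup.subset[of N X] by (auto simp: finite_index_subgroups_def)
  then show "mmap sub_star X X (Id AG X) = Id NSG (omap sub_star X)"
    by (auto simp: fun_eq_iff AG_def)
next
  fix X Y :: "'a top_group" and f
  assume X: "X \<in> Obj AG" and Y: "Y \<in> Obj AG" and f: "f \<in> Hom AG X Y"
  have fh: "f \<in> hom X Y" using f by (simp add: AG_def)
  show "mmap sub_star X Y f \<in> (if contravariant sub_star then Hom NSG (omap sub_star Y) (omap sub_star X)
      else Hom NSG (omap sub_star X) (omap sub_star Y))"
    using sub_star_hom[OF AG_comm_group[OF X] AG_comm_group[OF Y] fh] by simp
qed (auto simp: is_category_AG is_category_NSG normed_semigroup_sub_star AG_comm_group)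

section \<open>The dual group functor\<close>

lemma topspace_compact_open: "topspace (compact_open_topology G) = characters G"
proof -
  \<comment> \<open>The empty compact set imposes no condition, so this subbasic set is the whole
    dual.\<close>
  have "{\<xi> \<in> characters G. \<xi> ` {} \<subseteq> {}} \<in> {{\<xi> \<in> characters G. \<xi> ` K \<subseteq> U} | K U.
      compactin (gtop G) K \<and> openin (gtop circle_group) U}" by blast
  then show ?thesis unfolding compact_open_topology_def topology_generated_by_topspace by auto
qed

lemma openin_compact_open_topology:
  assumes "compactin (gtop G) K" "open U"
  shows "openin (compact_open_topology G) {\<xi> \<in> characters G. \<xi> ` K \<subseteq> U}"
proof -
  have "\<xi> ` K \<subseteq> sphere 0 1" if "\<xi> \<in> characters G" for \<xi>
    using that compactin_subset_topspace[OF assms(1)]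
    by (fastforce simp: characters_def continuous_map_def circle_topology)
  then have "{\<xi> \<in> characters G. \<xi> ` K \<subseteq> U} = {\<xi> \<in> characters G. \<xi> ` K \<subseteq> sphere 0 1 \<inter> U}" by auto
  moreover have "openin (gtop circle_group) (sphere 0 1 \<inter> U)"
    unfolding circle_topology using assms(2) by (simp add: openin_open_Int)
  ultimately show ?thesis
    unfolding compact_open_topology_def by (intro topology_generated_by_Basis) (use assms in blast)
qed

lemma topology_eqI_continuous:
  assumes "continuous_map X Y (\<lambda>x. x)" "continuous_map Y X (\<lambda>x. x)"
  shows "X = Y"
proof -
  have t: "topspace X = topspace Y" using assms by (auto simp: continuous_map_def)
  have "openin X U \<longleftrightarrow> openin Y U" for U
  proof
    assume U: "openin X U"
    then have "{x \<in> topspace Y. x \<in> U} = U" using openin_subset t by auto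
    then show "openin Y U" using openin_continuous_map_preimage[OF assms(2) U] by simp
  next
    assume U: "openin Y U"
    then have "{x \<in> topspace X. x \<in> U} = U" using openin_subset t by auto
    then show "openin X U" using openin_continuous_map_preimage[OF assms(1) U] by simp
  qed
  then show ?thesis by (simp add: topology_eq)
qed

text \<open>Compact sets of a discrete group are finite, so the topology is that of pointwise
  convergence and Tychonoff becomes available.\<close>

lemma compact_open_topology_discrete:
  assumes G: "gtop G = discrete_topology (carrier G)"
  shows "compact_open_topology G =
    subtopology (product_topology (\<lambda>_. gtop circle_group) (carrier G)) (characters G)"
    (is "?C = subtopology ?P _")
proof (rule topology_eqI_continuous)
  have ch: "characters G \<subseteq> topspace ?P"
    by (auto simp: characters_def hom_def circle_group_def PiE_def)
  show "continuous_map ?C (subtopology ?P (characters G)) (\<lambda>x. x)"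
    unfolding continuous_map_in_subtopology continuous_map_componentwise
  proof (intro conjI ballI)
    show "(\<lambda>x. x) ` topspace ?C \<subseteq> extensional (carrier G)"
      by (auto simp: topspace_compact_open characters_extensional)
    show "(\<lambda>x. x) \<in> topspace ?C \<rightarrow> characters G" by (simp add: topspace_compact_open)
    fix x assume x: "x \<in> carrier G"
    show "continuous_map ?C (gtop circle_group) (\<lambda>\<xi>. \<xi> x)"
      unfolding circle_topology continuous_map_in_subtopology
    proof
      show "continuous_map ?C euclidean (\<lambda>\<xi>. \<xi> x)"
        unfolding continuous_map_def
      proof (intro conjI allI impI)
        fix U :: "complex set" assume "openin euclidean U"
        then have "openin ?C {\<xi> \<in> characters G. \<xi> ` {x} \<subseteq> U}"
          using x by (intro openin_compact_open_topology) (auto simp: G compactin_discrete_topology)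
        then show "openin ?C {\<xi> \<in> topspace ?C. \<xi> x \<in> U}" by (simp add: topspace_compact_open)
      qed simp
      show "(\<lambda>\<xi>. \<xi> x) \<in> topspace ?C \<rightarrow> sphere 0 1"
        using x by (auto simp: topspace_compact_open character_norm)
    qed
  qed
  show "continuous_map (subtopology ?P (characters G)) ?C (\<lambda>x. x)"
  proof -
    have "openin (subtopology ?P (characters G)) ((\<lambda>x. x) -` U \<inter> topspace (subtopology ?P (characters G)))"
      if U: "U \<in> {{\<xi> \<in> characters G. \<xi> ` K \<subseteq> U} | K U.
        compactin (gtop G) K \<and> openin (gtop circle_group) U}" for U
    proof -
      obtain K V where KV: "U = {\<xi> \<in> characters G. \<xi> ` K \<subseteq> V}" "finite K" "K \<subseteq> carrier G" "openin (gtop circle_group) V"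
        using U by (auto simp: G compactin_discrete_topology)
      define W where "W = topspace ?P \<inter> \<Inter> ((\<lambda>x. {\<xi> \<in> topspace ?P. \<xi> x \<in> V}) ` K)"
      have V: "openin ?P {\<xi> \<in> topspace ?P. \<xi> x \<in> V}" if "x \<in> K" for x
        using that KV(3)
        by (intro openin_continuous_map_preimage[OF _ KV(4)]
            continuous_map_product_projection[of x _ "\<lambda>_. gtop circle_group"]) auto
      have "openin ?P W"
      proof (cases "K = {}")
        case True
        then have "W = topspace ?P" by (simp add: W_def)
        then show ?thesis by (simp only: openin_topspace)
      next
        case False
        then show ?thesis
          unfolding W_def by (intro openin_Int openin_topspace openin_Inter) (use KV(2) V in auto)
      qed
      moreover have "(\<lambda>x. x) -` U \<inter> topspace (subtopology ?P (characters G)) = characters G \<inter> W"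
        using ch by (auto simp: KV(1) W_def)
      ultimately show ?thesis by (metis openin_subtopology_Int2)
    qed
    moreover have "topspace (subtopology ?P (characters G)) \<subseteq> topspace ?C"
      by (simp add: topspace_compact_open)
    ultimately show ?thesis
      unfolding compact_open_topology_def topology_generated_by_topspace
      by (intro continuous_on_generated_topo) auto
  qed
qed

lemma circle_compact_Hausdorff: "compact_space (gtop circle_group)" "Hausdorff_space (gtop circle_group)"
  unfolding circle_topology
  by (auto intro: compact_space_subtopology Hausdorff_space_subtopology)

text \<open>The characters are closed in a product of circles, because each instance of
  multiplicativity equates two continuous functions of the character. Continuity of the operations
  is checked coordinatewise.\<close>

lemma dual_group_CAG:
  assumes "G \<in> Obj AG" shows "dual_group G \<in> Obj CAG"
proof -
  have G: "comm_group G" "gtop G = discrete_topology (carrier G)" using assms by (auto simp: AG_def)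
  interpret comm_group G by (rule G)
  have top: "topspace (gtop G) = carrier G" using G by simp
  let ?P = "product_topology (\<lambda>_. gtop circle_group) (carrier G)"
  let ?C = "compact_open_topology G"
  note C = compact_open_topology_discrete[OF G(2)]
  have tP: "topspace ?P = carrier G \<rightarrow>\<^sub>E sphere 0 1" by (simp add: circle_topology)
  have ev: "continuous_map ?P euclidean (\<lambda>\<xi>. \<xi> x)" if "x \<in> carrier G" for x
    using continuous_map_product_projection[OF that, of "\<lambda>_. gtop circle_group"]
    by (simp add: circle_topology continuous_map_in_subtopology)
  have evC: "continuous_map ?C euclidean (\<lambda>\<xi>. \<xi> x)" if "x \<in> carrier G" for x
    unfolding C by (rule continuous_map_from_subtopology[OF ev[OF that]])
  have intoC: "continuous_map Z ?C h"
    if "\<And>z. z \<in> topspace Z \<Longrightarrow> h z \<in> characters G" "\<And>x. x \<in> carrier G \<Longrightarrow> continuous_map Z euclidean (\<lambda>z. h z x)" for Z :: "'z topology" and h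
    unfolding C continuous_map_in_subtopology continuous_map_componentwise circle_topology
    using that by (auto simp: characters_extensional character_norm[of _ G])
  have "closedin ?P (characters G)"
  proof -
    have eq: "closedin ?P {\<xi> \<in> topspace ?P. \<xi> (x \<otimes>\<^bsub>G\<^esub> y) = \<xi> x * \<xi> y}" if "x \<in> carrier G" "y \<in> carrier G" for x y
      by (rule closedin_continuous_maps_eq[of euclidean])
        (use that in \<open>auto intro!: ev continuous_map_complex_mult\<close>)
    have "characters G = (\<Inter>p\<in>carrier G \<times> carrier G. {\<xi> \<in> topspace ?P. \<xi> (fst p \<otimes>\<^bsub>G\<^esub> snd p) = \<xi> (fst p) * \<xi> (snd p)})"
      unfolding tP set_eq_iff characters_iff[OF top] using G(2) one_closed
      by (auto simp: PiE_iff)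
    also have "closedin ?P \<dots>" by (rule closedin_Inter) (use eq one_closed in auto)
    finally show ?thesis .
  qed
  moreover have "compact_space ?P" by (simp add: compact_space_product_topology circle_compact_Hausdorff)
  ultimately have "compact_space ?C" unfolding C
    by (intro compact_space_subtopology closedin_compact_space)
  moreover have "Hausdorff_space ?C" unfolding C
    by (intro Hausdorff_space_subtopology) (simp add: Hausdorff_space_product_topology circle_compact_Hausdorff)
  moreover have "topological_abelian_group (dual_group G)"
    unfolding topological_abelian_group_def
  proof (intro conjI)
    show "comm_group (dual_group G)" by (rule comm_group_dual_group[OF top group_axioms])
    show "topspace (gtop (dual_group G)) = carrier (dual_group G)" by (simp add: topspace_compact_open)
    have "continuous_map (prod_topology ?C ?C) ?C (\<lambda>p. \<lambda>x\<in>carrier G. fst p x * snd p x)"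
    proof (rule intoC)
      show "(\<lambda>x\<in>carrier G. fst p x * snd p x) \<in> characters G" if "p \<in> topspace (prod_topology ?C ?C)" for p
        using that by (intro mult_in_characters[OF top _ _ group_axioms]) (auto simp: topspace_compact_open)
      fix x assume x: "x \<in> carrier G"
      have "continuous_map (prod_topology ?C ?C) euclidean (\<lambda>p. fst p x * snd p x)"
        using continuous_map_compose[OF continuous_map_fst evC[OF x]] continuous_map_compose[OF continuous_map_snd evC[OF x]]
        by (intro continuous_map_complex_mult) (simp_all add: o_def)
      then show "continuous_map (prod_topology ?C ?C) euclidean (\<lambda>p. (\<lambda>x\<in>carrier G. fst p x * snd p x) x)"
        using x by simp
    qed
    then show "continuous_map (prod_topology (gtop (dual_group G)) (gtop (dual_group G))) (gtop (dual_group G))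
        (\<lambda>(\<xi>, \<psi>). \<xi> \<otimes>\<^bsub>dual_group G\<^esub> \<psi>)"
      by (simp add: case_prod_unfold)
    have "continuous_map ?C ?C (\<lambda>\<xi>. \<lambda>x\<in>carrier G. cnj (\<xi> x))"
    proof (rule intoC)
      show "(\<lambda>x\<in>carrier G. cnj (\<xi> x)) \<in> characters G" if "\<xi> \<in> topspace ?C" for \<xi>
        using that by (intro cnj_in_characters[OF top _ group_axioms]) (auto simp: topspace_compact_open)
      fix x assume x: "x \<in> carrier G"
      have "continuous_map ?C euclidean (\<lambda>\<xi>. cnj (\<xi> x))"
        by (rule continuous_map_comp_continuous[OF evC[OF x]]) (intro continuous_intros)
      then show "continuous_map ?C euclidean (\<lambda>\<xi>. (\<lambda>x\<in>carrier G. cnj (\<xi> x)) x)" using x by simp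
    qed
    from continuous_map_eq[OF this, of "\<lambda>\<xi>. inv\<^bsub>dual_group G\<^esub> \<xi>"]
    show "continuous_map (gtop (dual_group G)) (gtop (dual_group G)) (\<lambda>\<xi>. inv\<^bsub>dual_group G\<^esub> \<xi>)"
      by (simp add: topspace_compact_open dual_group_inv[OF top group_axioms])
  qed
  ultimately show ?thesis by (simp add: CAG_def)
qed

text \<open>Squaring multiplies \<open>w - 1\<close> by \<open>w + 1\<close>, whose norm is at least
  \<open>3/2\<close> when \<open>w\<close> is within \<open>1/2\<close> of \<open>1\<close>.
  Repeated squaring would leave the disc unless \<open>z = 1\<close>.\<close>

lemma doubling_escape:
  fixes z :: complex
  assumes "\<And>n. norm (z ^ n - 1) < 1/2" shows "z = 1"
proof (rule ccontr)
  assume "z \<noteq> 1"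
  then have pos: "0 < norm (z - 1)" by simp
  have grow: "(3/2) ^ k * norm (z - 1) \<le> norm (z ^ (2 ^ k) - 1)" for k
  proof (induction k)
    case (Suc k)
    define w where "w = z ^ (2 ^ k)"
    have "norm (w - 1) < 1/2" using assms unfolding w_def .
    then have "3/2 \<le> norm (w + 1)"
      using norm_triangle_ineq2[of 2 "1 - w"] by (simp add: norm_minus_commute add.commute)
    then have "(3/2) * norm (w - 1) \<le> norm (w + 1) * norm (w - 1)" by (intro mult_right_mono) auto
    also have "\<dots> = norm (w ^ 2 - 1)" by (simp add: power2_eq_square algebra_simps flip: norm_mult)
    also have "w ^ 2 = z ^ (2 ^ Suc k)" by (simp add: w_def mult.commute flip: power_mult)
    finally show ?case using Suc by (simp add: w_def)
  qed simp
  obtain k where "1 / norm (z - 1) < (3/2) ^ k" using real_arch_pow[of "3/2"] by auto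
  then have "1 < (3/2) ^ k * norm (z - 1)" using pos by (simp add: field_simps)
  then show False using grow[of k] assms[of "2 ^ k"] by linarith
qed

context compact_group
begin

text \<open>The circle has no small subgroups: all powers of \<open>\<xi> x\<close> are again values
  of \<xi> and stay close to \<open>1\<close>.\<close>

lemma character_near_one:
  assumes \<xi>: "\<xi> \<in> characters G" and near: "\<And>x. x \<in> carrier G \<Longrightarrow> norm (\<xi> x - 1) < 1/2"
    and x: "x \<in> carrier G"
  shows "\<xi> x = 1"
proof (rule doubling_escape)
  have "\<xi> \<one> = 1" using group_pairing.pair_one_left[OF group_pairing_dual(1)[OF top comm_group_axioms]] \<xi> by simp
  then have "\<xi> (x [^] n) = \<xi> x ^ n" for n :: nat
    by (induction n) (use \<xi> x in \<open>auto simp: character_mult\<close>)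
  then show "norm (\<xi> x ^ n - 1) < 1/2" for n using near[of "x [^] n"] x by (metis nat_pow_closed)
qed

text \<open>Characters uniformly close to \<open>\<xi>\<close> are equal to \<open>\<xi>\<close>; finitely many compact sets on which \<open>\<xi>\<close> is
  nearly constant cover \<open>G\<close>, so that \<open>\<xi>\<close> is isolated in the compact-open topology.\<close>

lemma dual_discrete: "compact_open_topology G = discrete_topology (characters G)"
proof -
  have "openin (compact_open_topology G) {\<xi>}" if \<xi>: "\<xi> \<in> characters G" for \<xi>
  proof -
    \<comment> \<open>The radius \<open>1/8\<close> here and the radius \<open>1/4\<close> in
      \<open>W\<close> add up to less than \<open>1/2\<close>, the threshold of
      \<open>character_near_one\<close>.\<close>
    obtain Z where Z: "finite Z" "sphere 0 1 \<subseteq> (\<Union>z\<in>Z. ball (z::complex) (1/8))"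
    proof (rule compactE_image[of "sphere (0::complex) 1" "sphere 0 1" "\<lambda>z. ball z (1/8)"])
      show "sphere 0 1 \<subseteq> (\<Union>z\<in>sphere 0 1. ball (z::complex) (1/8))" by force
    qed auto
    define K where "K z = {x \<in> topspace (gtop G). \<xi> x \<in> cball z (1/8)}" for z
    have K: "compactin (gtop G) (K z)" for z
      unfolding K_def
      by (rule closedin_compact_space[OF compact closedin_continuous_map_preimage[OF character_continuous[OF \<xi>]]]) simp
    define W where "W = characters G \<inter> (\<Inter>z\<in>Z. {\<psi> \<in> characters G. \<psi> ` K z \<subseteq> ball z (1/4)})"
    have "openin (compact_open_topology G) W"
    proof (cases "Z = {}")
      case True
      then show ?thesis using openin_topspace[of "compact_open_topology G"]
        by (simp add: W_def topspace_compact_open)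
    next
      case False
      then have "W = \<Inter> ((\<lambda>z. {\<psi> \<in> characters G. \<psi> ` K z \<subseteq> ball z (1/4)}) ` Z)" by (auto simp: W_def)
      then show ?thesis using False Z(1) K openin_compact_open_topology[OF K open_ball]
        by (auto intro!: openin_Inter)
    qed
    moreover have "W = {\<xi>}"
    proof
      show "{\<xi>} \<subseteq> W" using \<xi> by (auto simp: W_def K_def)
      show "W \<subseteq> {\<xi>}"
      proof
        fix \<psi> assume \<psi>W: "\<psi> \<in> W"
        then have \<psi>: "\<psi> \<in> characters G" by (simp add: W_def)
        \<comment> \<open>The quotient of \<psi> by \<xi>; its distance from \<open>1\<close> at
          \<open>x\<close> is the distance between \<open>\<psi> x\<close> and
          \<open>\<xi> x\<close>.\<close>
        define \<alpha> where "\<alpha> = (\<lambda>x\<in>carrier G. \<psi> x * (\<lambda>x\<in>carrier G. cnj (\<xi> x)) x)"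
        have \<alpha>: "\<alpha> \<in> characters G"
          unfolding \<alpha>_def by (intro mult_in_characters cnj_in_characters top \<psi> \<xi> group_axioms)
        have "\<psi> x = \<xi> x" if x: "x \<in> carrier G" for x
        proof -
          have "norm (\<alpha> x - 1) < 1/2" if x: "x \<in> carrier G" for x
          proof -
            have "\<xi> x \<in> sphere 0 1" using character_norm[OF \<xi> x] by simp
            then obtain z where z: "z \<in> Z" "\<xi> x \<in> ball z (1/8)" using Z(2) by blast
            then have "x \<in> K z" using x by (auto simp: K_def)
            then have "\<psi> x \<in> ball z (1/4)" using \<psi>W z(1) unfolding W_def by blast
            then have close: "norm (\<psi> x - \<xi> x) < 1/2"
              using z(2) dist_triangle[of "\<psi> x" "\<xi> x" z] by (simp add: dist_norm norm_minus_commute)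
            have "\<alpha> x - 1 = (\<psi> x - \<xi> x) * cnj (\<xi> x)"
              using x character_mult_cnj[OF \<xi> x] by (simp add: \<alpha>_def algebra_simps)
            then have "norm (\<alpha> x - 1) = norm (\<psi> x - \<xi> x)" by (simp add: norm_mult character_norm[OF \<xi> x])
            then show ?thesis using close by simp
          qed
          from character_near_one[OF \<alpha> this x] have "\<psi> x * cnj (\<xi> x) = \<xi> x * cnj (\<xi> x)"
            using x character_mult_cnj[OF \<xi> x] by (simp add: \<alpha>_def)
          moreover have "cnj (\<xi> x) \<noteq> 0" using character_norm[OF \<xi> x] by auto
          ultimately show ?thesis by simp
        qed
        then show "\<psi> \<in> {\<xi>}"
          using characters_extensional[OF \<psi>] characters_extensional[OF \<xi>] by (auto intro: extensionalityI)
      qed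
    qed
    ultimately show ?thesis by simp
  qed
  then have "discrete_topology (characters G) = compact_open_topology G"
    unfolding discrete_topology_unique by (simp add: topspace_compact_open)
  then show ?thesis by simp
qed

lemma dual_group_AG: "dual_group G \<in> Obj AG"
  using comm_group_dual_group[OF top group_axioms] by (simp add: AG_def dual_discrete)

end

section \<open>Functoriality of the dual\<close>

lemma dual_simps [simp]:
  "omap dual = dual_group"
  "mmap dual G H \<phi> = (\<lambda>\<xi>\<in>characters H. compose (carrier G) \<xi> \<phi>)"
  "contravariant dual = True"
  by (simp_all add: dual_def)

lemma compose_in_characters:
  assumes G: "topological_abelian_group G" and H: "topological_abelian_group H"
    and \<phi>: "\<phi> \<in> hom G H" "continuous_map (gtop G) (gtop H) \<phi>" and \<xi>: "\<xi> \<in> characters H"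
  shows "compose (carrier G) \<xi> \<phi> \<in> characters G"
proof -
  interpret G: comm_group G by (rule topological_abelian_groupD(1)[OF G])
  note top = topological_abelian_groupD(2)[OF G]
  have "continuous_map (gtop G) euclidean (\<lambda>x. \<xi> (\<phi> x))"
    using continuous_map_compose[OF \<phi>(2) character_continuous[OF \<xi>]] by (simp add: o_def)
  then show ?thesis
    using \<phi>(1) \<xi> unfolding compose_def characters_iff[OF top] continuous_map_restrict_iff[OF top]
    by (auto simp: hom_def Pi_iff character_mult character_norm)
qed

lemma dual_morphism_hom:
  assumes G: "topological_abelian_group G" and H: "topological_abelian_group H"
    and \<phi>: "\<phi> \<in> hom G H" "continuous_map (gtop G) (gtop H) \<phi>"
  shows "mmap dual G H \<phi> \<in> hom (dual_group H) (dual_group G)"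
proof -
  interpret H: comm_group H by (rule topological_abelian_groupD(1)[OF H])
  have "\<phi> x \<in> carrier H" if "x \<in> carrier G" for x using \<phi>(1) that by (auto simp: hom_def)
  then show ?thesis
    using mult_in_characters[OF topological_abelian_groupD(2)[OF H] _ _ H.group_axioms]
    by (auto simp: hom_def compose_in_characters[OF assms, unfolded compose_def] compose_def fun_eq_iff)
qed

lemma dual_morphism_Id:
  "mmap dual G G (restrict id (carrier G)) = restrict id (characters G)"
  using characters_extensional by (fastforce simp: fun_eq_iff compose_def extensional_def)

lemma dual_morphism_Comp:
  assumes G: "topological_abelian_group G" and H: "topological_abelian_group H"
    and K: "topological_abelian_group K"
    and \<phi>: "\<phi> \<in> hom G H" and \<psi>: "\<psi> \<in> hom H K" "continuous_map (gtop H) (gtop K) \<psi>"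
  shows "mmap dual G K (compose (carrier G) \<psi> \<phi>) =
    compose (characters K) (mmap dual G H \<phi>) (mmap dual H K \<psi>)"
proof -
  have "\<phi> x \<in> carrier H" if "x \<in> carrier G" for x using \<phi>(1) that by (auto simp: hom_def)
  then show ?thesis
    using compose_in_characters[OF H K \<psi>] by (auto simp: fun_eq_iff compose_def)
qed

lemma AG_homD:
  assumes "\<phi> \<in> Hom AG G H" "G \<in> Obj AG" "H \<in> Obj AG"
  shows "\<phi> \<in> hom G H" "continuous_map (gtop G) (gtop H) \<phi>"
  using assms topological_abelian_groupD(2)[OF AG_topological_abelian_group[OF assms(3)]]
  by (auto simp: AG_def hom_def)

lemma CAG_homD:
  assumes "\<phi> \<in> Hom CAG G H"
  shows "\<phi> \<in> hom G H" "continuous_map (gtop G) (gtop H) \<phi>"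
  using assms by (auto simp: CAG_def)

lemma CAG_topological_abelian_group: "G \<in> Obj CAG \<Longrightarrow> topological_abelian_group G"
  by (simp add: CAG_def)

lemma is_functor_dual_AG: "is_functor AG CAG dual"
  unfolding is_functor_def
proof (intro conjI ballI)
  fix X :: "'a top_group" assume X: "X \<in> Obj AG"
  show "omap dual X \<in> Obj CAG" using dual_group_CAG[OF X] by simp
  show "mmap dual X X (Id AG X) = Id CAG (omap dual X)"
    using dual_morphism_Id[of X] by (simp add: AG_def CAG_def)
next
  fix X Y :: "'a top_group" and f assume X: "X \<in> Obj AG" and Y: "Y \<in> Obj AG" and f: "f \<in> Hom AG X Y"
  note tX = AG_topological_abelian_group[OF X] and tY = AG_topological_abelian_group[OF Y]
  note fh = AG_homD[OF f X Y]
  have CX: "compact_open_topology X = subtopology (product_topology (\<lambda>_. gtop circle_group) (carrier X)) (characters X)"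
    and CY: "compact_open_topology Y = subtopology (product_topology (\<lambda>_. gtop circle_group) (carrier Y)) (characters Y)"
    using X Y by (auto intro!: compact_open_topology_discrete simp: AG_def)
  \<comment> \<open>Continuity into the pointwise topology is tested by evaluations, and evaluating
    the image at \<open>x\<close> means evaluating at \<open>f x\<close>.\<close>
  have "continuous_map (compact_open_topology Y) (compact_open_topology X) (mmap dual X Y f)"
    unfolding CX continuous_map_in_subtopology continuous_map_componentwise
  proof (intro conjI ballI)
    show "mmap dual X Y f ` topspace (compact_open_topology Y) \<subseteq> extensional (carrier X)"
      by (auto simp: topspace_compact_open)
    show "mmap dual X Y f \<in> topspace (compact_open_topology Y) \<rightarrow> characters X"
      using compose_in_characters[OF tX tY fh] by (simp add: topspace_compact_open)
    fix x assume x: "x \<in> carrier X"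
    then have fx: "f x \<in> carrier Y" using fh by (auto simp: hom_def)
    have "continuous_map (compact_open_topology Y) (gtop circle_group) (\<lambda>\<xi>. \<xi> (f x))"
      unfolding CY by (rule continuous_map_from_subtopology[OF continuous_map_product_projection[OF fx]])
    then show "continuous_map (compact_open_topology Y) (gtop circle_group) (\<lambda>\<xi>. mmap dual X Y f \<xi> x)"
      by (rule continuous_map_eq) (simp add: topspace_compact_open x compose_def)
  qed
  then show "mmap dual X Y f \<in> (if contravariant dual then Hom CAG (omap dual Y) (omap dual X)
      else Hom CAG (omap dual X) (omap dual Y))"
    using dual_morphism_hom[OF tX tY fh] by (simp add: CAG_def)
next
  fix X Y Z :: "'a top_group" and f g :: "'a \<Rightarrow> 'a"
  assume X: "X \<in> Obj AG" and Y: "Y \<in> Obj AG" and Z: "Z \<in> Obj AG" and f: "f \<in> Hom AG X Y" and g: "g \<in> Hom AG Y Z"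
  have "Comp AG X g f = compose (carrier X) g f" by (simp add: AG_def)
  moreover have "Comp CAG (dual_group Z) u v = compose (characters Z) u v" for u v by (simp add: CAG_def)
  ultimately show "mmap dual X Z (Comp AG X g f) =
      (if contravariant dual then Comp CAG (omap dual Z) (mmap dual X Y f) (mmap dual Y Z g)
       else Comp CAG (omap dual X) (mmap dual Y Z g) (mmap dual X Y f))"
    using dual_morphism_Comp[OF AG_topological_abelian_group[OF X] AG_topological_abelian_group[OF Y]
        AG_topological_abelian_group[OF Z] AG_homD(1)[OF f X Y] AG_homD[OF g Y Z]] by (simp only: dual_simps if_True)
qed (rule is_category_AG is_category_CAG)+

lemma is_functor_dual_CAG: "is_functor CAG AG dual"
  unfolding is_functor_def
proof (intro conjI ballI)
  fix X :: "'a top_group" assume X: "X \<in> Obj CAG"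
  show "omap dual X \<in> Obj AG" using compact_group.dual_group_AG[of X] X by (simp add: compact_group_def)
  show "mmap dual X X (Id CAG X) = Id AG (omap dual X)"
    using dual_morphism_Id[of X] by (simp add: AG_def CAG_def)
next
  fix X Y :: "'a top_group" and f assume X: "X \<in> Obj CAG" and Y: "Y \<in> Obj CAG" and f: "f \<in> Hom CAG X Y"
  show "mmap dual X Y f \<in> (if contravariant dual then Hom AG (omap dual Y) (omap dual X)
      else Hom AG (omap dual X) (omap dual Y))"
    using dual_morphism_hom[OF CAG_topological_abelian_group[OF X] CAG_topological_abelian_group[OF Y] CAG_homD[OF f]]
    by (simp add: AG_def)
next
  fix X Y Z :: "'a top_group" and f g :: "'a \<Rightarrow> 'a"
  assume X: "X \<in> Obj CAG" and Y: "Y \<in> Obj CAG" and Z: "Z \<in> Obj CAG" and f: "f \<in> Hom CAG X Y" and g: "g \<in> Hom CAG Y Z"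
  have "Comp CAG X g f = compose (carrier X) g f" by (simp add: CAG_def)
  moreover have "Comp AG (dual_group Z) u v = compose (characters Z) u v" for u v by (simp add: AG_def)
  ultimately show "mmap dual X Z (Comp CAG X g f) =
      (if contravariant dual then Comp AG (omap dual Z) (mmap dual X Y f) (mmap dual Y Z g)
       else Comp AG (omap dual X) (mmap dual Y Z g) (mmap dual X Y f))"
    using dual_morphism_Comp[OF CAG_topological_abelian_group[OF X] CAG_topological_abelian_group[OF Y]
        CAG_topological_abelian_group[OF Z] CAG_homD(1)[OF f] CAG_homD[OF g]] by (simp only: dual_simps if_True)
qed (rule is_category_AG is_category_CAG)+

section \<open>The bridge theorem\<close>

text \<open>Stated outside the locales because the natural transformation ranges over all groups at
  once. It is \<open>annX\<close> in the pairing of a discrete group with its dual and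
  \<open>annG\<close> in the pairing of a dual with its compact group.\<close>

definition annihilator :: "'a top_group \<Rightarrow> 'a set \<Rightarrow> ('a \<Rightarrow> complex) set" where
  "annihilator G S = {\<xi> \<in> characters G. \<forall>x\<in>S. \<xi> x = 1}"

lemma functor_comp_dual_simps [simp]:
  "omap (functor_comp F dual) X = omap F (dual_group X)"
  "mmap (functor_comp F dual) X Y f = mmap F (dual_group Y) (dual_group X) (mmap dual X Y f)"
  "contravariant (functor_comp F dual) = (\<not> contravariant F)"
  by (simp_all add: functor_comp_def)

lemma SBT_sub_star_sub: "SBT AG CAG dual sub_star sub"
proof -
  define \<eta> where "\<eta> G = restrict (annihilator G) (finite_index_subgroups G)" for G :: "'a top_group"
  have iso: "norm_preserving_iso (omap sub_star G) (omap (functor_comp sub dual) G) (\<eta> G)" if G: "G \<in> Obj AG" for G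
  proof -
    interpret D: duality G "dual_group G" "\<lambda>x \<xi>. \<xi> x" by (rule duality_discrete[OF G])
    have ann: "annihilator G = D.annX" by (simp add: annihilator_def D.annX_def fun_eq_iff)
    have "bij_betw (\<eta> G) (finite_index_subgroups G) (finite_subgroups (dual_group G))"
      using D.bij_annX by (simp add: \<eta>_def ann cong: bij_betw_cong)
    then show ?thesis
      using D.annG_annX(2) D.annX_Int D.finite_annX(1) D.G.Int_finite_index_subgroups
      by (auto simp: norm_preserving_iso_def semigroup_hom_def \<eta>_def ann PiE_iff)
  qed
  moreover have "natural_transformation AG sub_star (functor_comp sub dual) \<eta>"
    unfolding natural_transformation_def
  proof (intro conjI ballI)
    fix G :: "'a top_group" assume "G \<in> Obj AG"
    then show "\<eta> G \<in> semigroup_hom (omap sub_star G) (omap (functor_comp sub dual) G)"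
      using iso by (simp add: norm_preserving_iso_def)
  next
    fix G H :: "'a top_group" and f assume G: "G \<in> Obj AG" and H: "H \<in> Obj AG" and f: "f \<in> Hom AG G H"
    interpret D: duality G "dual_group G" "\<lambda>x \<xi>. \<xi> x" by (rule duality_discrete[OF G])
    interpret E: duality H "dual_group H" "\<lambda>x \<xi>. \<xi> x" by (rule duality_discrete[OF H])
    have annG: "annihilator G = D.annX" and annH: "annihilator H = E.annX"
      by (simp_all add: annihilator_def D.annX_def E.annX_def fun_eq_iff)
    note fh = AG_homD[OF f G H]
    let ?f = "mmap dual G H f"
    have fd: "?f \<in> hom (dual_group H) (dual_group G)"
      by (rule dual_morphism_hom[OF AG_topological_abelian_group[OF G] AG_topological_abelian_group[OF H] fh])
    \<comment> \<open>The annihilator in \<open>G\<close> of an image under the dual map is a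
      preimage by direct computation; \<open>annX_annG\<close> converts this into the annihilator of
      a preimage.\<close>
    have key: "D.annX {x \<in> carrier G. f x \<in> N} = ?f ` E.annX N" if N: "N \<in> finite_index_subgroups H" for N
    proof -
      have F: "?f ` E.annX N \<in> finite_subgroups (dual_group G)"
        by (rule image_finite_subgroups[OF E.X.group_axioms D.X.group_axioms fd E.finite_annX(1)[OF N]])
      have "D.annG (?f ` E.annX N) = {x \<in> carrier G. f x \<in> E.annG (E.annX N)}"
        using fh by (auto simp: D.annG_def E.annG_def E.annX_def compose_def hom_def)
      then show ?thesis using D.annX_annG(1)[OF F] E.annG_annX(1)[OF N] by simp
    qed
    have "compose (finite_index_subgroups H) (\<eta> G) (mmap sub_star G H f) =
        compose (finite_index_subgroups H) (mmap sub (dual_group H) (dual_group G) ?f) (\<eta> H)"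
      using key index_vimage(1)[OF D.G.group_axioms E.G.group_axioms fh(1)] E.finite_annX(1)
      by (auto simp: compose_def fun_eq_iff \<eta>_def annG annH simp del: dual_simps)
    then show "if contravariant sub_star
        then compose (carrier (omap sub_star H)) (\<eta> G) (mmap sub_star G H f) =
          compose (carrier (omap sub_star H)) (mmap (functor_comp sub dual) G H f) (\<eta> H)
        else compose (carrier (omap sub_star G)) (\<eta> H) (mmap sub_star G H f) =
          compose (carrier (omap sub_star G)) (mmap (functor_comp sub dual) G H f) (\<eta> G)"
      by (simp only: sub_star_simps functor_comp_dual_simps if_True)
  qed
  ultimately show ?thesis
    unfolding SBT_def using is_functor_dual_AG is_functor_sub_star is_functor_sub by auto
qed

lemma SBT_sub_sub_star: "SBT CAG AG dual sub sub_star"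
proof -
  define \<eta> where "\<eta> G = restrict (annihilator G) (finite_subgroups G)" for G :: "'a top_group"
  have dual: "duality (dual_group G) G (\<lambda>\<xi> x. \<xi> x)" if "G \<in> Obj CAG" for G :: "'a top_group"
    using compact_group.duality_compact[of G] that by (simp add: compact_group_def)
  have iso: "norm_preserving_iso (omap sub G) (omap (functor_comp sub_star dual) G) (\<eta> G)" if G: "G \<in> Obj CAG" for G
  proof -
    interpret D: duality "dual_group G" G "\<lambda>\<xi> x. \<xi> x" by (rule dual[OF G])
    have ann: "annihilator G = D.annG" by (simp add: annihilator_def D.annG_def fun_eq_iff)
    have "bij_betw (\<eta> G) (finite_subgroups G) (finite_index_subgroups (dual_group G))"
      using D.bij_annG by (simp add: \<eta>_def ann cong: bij_betw_cong)
    moreover have "D.annG (F <#>\<^bsub>G\<^esub> F') = D.annG F \<inter> D.annG F'"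
      if "F \<in> finite_subgroups G" "F' \<in> finite_subgroups G" for F F'
      using that by (intro D.annG_set_mult) (auto simp: finite_subgroups_def)
    ultimately show ?thesis
      using D.annX_annG(2) D.finite_index_annG(1) D.X.set_mult_finite_subgroups
      by (auto simp: norm_preserving_iso_def semigroup_hom_def \<eta>_def ann PiE_iff)
  qed
  moreover have "natural_transformation CAG sub (functor_comp sub_star dual) \<eta>"
    unfolding natural_transformation_def
  proof (intro conjI ballI)
    fix G :: "'a top_group" assume "G \<in> Obj CAG"
    then show "\<eta> G \<in> semigroup_hom (omap sub G) (omap (functor_comp sub_star dual) G)"
      using iso by (simp add: norm_preserving_iso_def)
  next
    fix G H :: "'a top_group" and f assume G: "G \<in> Obj CAG" and H: "H \<in> Obj CAG" and f: "f \<in> Hom CAG G H"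
    interpret D: duality "dual_group G" G "\<lambda>\<xi> x. \<xi> x" by (rule dual[OF G])
    note fh = CAG_homD[OF f] and tG = CAG_topological_abelian_group[OF G] and tH = CAG_topological_abelian_group[OF H]
    let ?f = "mmap dual G H f"
    \<comment> \<open>Here the annihilator of an image is wanted, so unfolding the dual map
      suffices.\<close>
    have key: "annihilator H (f ` F) = {\<xi> \<in> characters H. ?f \<xi> \<in> annihilator G F}"
      if "F \<in> finite_subgroups G" for F
    proof -
      have "F \<subseteq> carrier G" using that subgroup.subset by (auto simp: finite_subgroups_def)
      then show ?thesis using compose_in_characters[OF tG tH fh] by (auto simp: annihilator_def compose_def)
    qed
    have "annihilator G F \<in> finite_index_subgroups (dual_group G)" if "F \<in> finite_subgroups G" for F
      using D.finite_index_annG(1)[OF that] by (simp add: annihilator_def D.annG_def)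
    then have "compose (finite_subgroups G) (\<eta> H) (mmap sub G H f) =
        compose (finite_subgroups G) (mmap sub_star (dual_group H) (dual_group G) ?f) (\<eta> G)"
      using key image_finite_subgroups[OF D.X.group_axioms comm_group.axioms(2)[OF CAG_comm_group[OF H]] fh(1)]
      by (auto simp: compose_def[of "finite_subgroups G"] fun_eq_iff \<eta>_def simp del: dual_simps)
    then show "if contravariant sub
        then compose (carrier (omap sub H)) (\<eta> G) (mmap sub G H f) =
          compose (carrier (omap sub H)) (mmap (functor_comp sub_star dual) G H f) (\<eta> H)
        else compose (carrier (omap sub G)) (\<eta> H) (mmap sub G H f) =
          compose (carrier (omap sub G)) (mmap (functor_comp sub_star dual) G H f) (\<eta> G)"
      by (simp only: sub_simps functor_comp_dual_simps if_False)
  qed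
  ultimately show ?thesis
    unfolding SBT_def using is_functor_dual_CAG is_functor_sub_star is_functor_sub by auto
qed

lemma BT_ent_star_ent: "BT AG dual ent_star ent"
  unfolding BT_def
proof (intro ballI)
  fix G :: "'a top_group" and \<phi> assume G: "G \<in> Obj AG" and \<phi>: "\<phi> \<in> Hom AG G G"
  interpret D: duality G "dual_group G" "\<lambda>x \<xi>. \<xi> x" by (rule duality_discrete[OF G])
  note t = AG_topological_abelian_group[OF G] and h = AG_homD[OF \<phi> G G]
  show "ent (omap dual G) (mmap dual G G \<phi>) = ent_star G \<phi>"
    using D.ent_eq_ent_star[OF h(1) dual_morphism_hom[OF t t h]] by (simp add: compose_def)
qed

text \<open>The compact group is now on the finite side of the pairing, and the dual endomorphism
  takes the role of \<phi> in \<open>ent_eq_ent_star\<close>.\<close>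

lemma BT_ent_ent_star: "BT CAG dual ent ent_star"
  unfolding BT_def
proof (intro ballI)
  fix G :: "'a top_group" and \<phi> assume G: "G \<in> Obj CAG" and \<phi>: "\<phi> \<in> Hom CAG G G"
  interpret D: duality "dual_group G" G "\<lambda>\<xi> x. \<xi> x"
    using compact_group.duality_compact[of G] G by (simp add: compact_group_def)
  note t = CAG_topological_abelian_group[OF G] and h = CAG_homD[OF \<phi>]
  show "ent_star (omap dual G) (mmap dual G G \<phi>) = ent G \<phi>"
    using D.ent_eq_ent_star[OF dual_morphism_hom[OF t t h] h(1)] by (simp add: compose_def)
qed

theorem theorem6p24:
  shows "(SBT (AG :: ('a top_group, 'a \<Rightarrow> 'a) cat) CAG dual sub_star sub \<and>
          BT (AG :: ('a top_group, 'a \<Rightarrow> 'a) cat) dual ent_star ent) \<and>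
         (SBT (CAG :: ('b top_group, 'b \<Rightarrow> 'b) cat) AG dual sub sub_star \<and>
          BT (CAG :: ('b top_group, 'b \<Rightarrow> 'b) cat) dual ent ent_star)"
  by (intro conjI SBT_sub_star_sub BT_ent_star_ent SBT_sub_sub_star BT_ent_ent_star)

end
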